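(* If $\theta\in(1,\infty)$, then for each $w\in\mathcal{C}_{2k}$, we have $p_\theta(w)>1$. So this is one example where the Catalan words contribute more than $1$ to the limiting moments $\beta_{2k}^{(\theta)}=\sum_{w}p_\theta(w)$ (sum over all pair-matched words $w$ of length $2k$).
   Context: For $\theta\in(0,\infty)$ and $n$ large enough that $\lfloor n/\theta\rfloor\ge1$, let $L_\theta(i,j)=(i+j)\bmod\lfloor n/\theta\rfloor$ for $1\le i,j\le n$. Here $k$ denotes a positive integer. A word of length $2k$ is a sequence of $2k$ letters whose first occurrences are in alphabetical order; $w[i]$ is its $i$-th letter; it is pair-matched if every letter appears exactly twice. A pair-matched word is Catalan if sequentially deleting all double letters (two adjacent equal letters) reduces the word to the empty word (e.g. $aabb$, $abbcca$); $\mathcal{C}_{2k}$ is the set of Catalan words of length $2k$. A circuit of length $2k$ is a function $\pi:\{0,\dots,2k\}\to\{1,\dots,n\}$ with $\pi(0)=\pi(2k)$. For a pair-matched word $w$ of length $2k$, $\Pi_\theta^*(w)$ is the set of such circuits for which $w[i]=w[j]$ implies $L_\theta(\pi(i-1),\pi(i))=L_\theta(\pi(j-1),\pi(j))$, and $p_\theta(w)=\lim_{n\to\infty}n^{-(k+1)}\#\Pi_\theta^*(w)$ (this limit exists). The number $\beta_{2k}^{(\theta)}$ is the $2k$-th moment of the almost sure weak limit, as $n\to\infty$, of the empirical spectral distributions of the symmetric $n\times n$ matrices $A_n^\theta=n^{-1/2}((x_{L_\theta(i,j)}))_{1\le i,j\le n}$, where the input sequence $\{x_i\}_{i\ge0}$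 consists of random variables with mean $0$ and variance $1$ that are either independent and uniformly bounded, or i.i.d., or independent with uniformly bounded moments of all orders.
   Formalization: The strict inequality p_θ(w)>1 is stated for k≥2 only: for k=1 the only Catalan word is aa, whose link condition always holds, so p_θ(aa)=1. The moment formula is kept for all k≥1. *)

theory Defs
  imports
    "HOL-Probability.Probability"
    "Jordan_Normal_Form.Char_Poly"
begin

subsection \<open>Words\<close>

text \<open>The alphabet is 0, 1, 2, \<dots> in its usual order. The list
  \<open>rev (remdups (rev w))\<close> consists of the letters of \<open>w\<close> ordered by first
  occurrence, so a word must use its letters 0, 1, \<dots> in this order, none skipped.\<close>

definition is_word :: "nat list \<Rightarrow> bool" where
  "is_word w \<longleftrightarrow> rev (remdups (rev w)) = [0..<card (set w)]"

definition pair_matched :: "nat list \<Rightarrow> bool" where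
  "pair_matched w \<longleftrightarrow> is_word w \<and> (\<forall>a\<in>set w. count_list w a = 2)"

inductive reduces_to_empty :: "'a list \<Rightarrow> bool" where
  empty: "reduces_to_empty []"
| delete: "reduces_to_empty (u @ v) \<Longrightarrow> reduces_to_empty (u @ [a, a] @ v)"

definition pair_matched_words :: "nat \<Rightarrow> nat list set" where
  "pair_matched_words k = {w. length w = 2 * k \<and> pair_matched w}"

definition catalan_words :: "nat \<Rightarrow> nat list set" where
  "catalan_words k = {w \<in> pair_matched_words k. reduces_to_empty w}"

lemma finite_pair_matched_words: "finite (pair_matched_words k)"
proof (rule finite_subset)
  show "finite {w. set w \<subseteq> {..<2 * k} \<and> length w = 2 * k}"
    by (rule finite_lists_length_eq) simp
  show "pair_matched_words k \<subseteq> {w. set w \<subseteq> {..<2 * k} \<and> length w = 2 * k}"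
  proof
    fix w assume "w \<in> pair_matched_words k"
    then have len: "length w = 2 * k" and w: "rev (remdups (rev w)) = [0..<card (set w)]"
      by (auto simp: pair_matched_words_def pair_matched_def is_word_def)
    have "set w = {..<card (set w)}"
      using arg_cong[OF w, of set] by (simp add: lessThan_atLeast0)
    also have "{..<card (set w)} \<subseteq> {..<2 * k}"
      using card_length[of w] len by simp
    finally show "w \<in> {w. set w \<subseteq> {..<2 * k} \<and> length w = 2 * k}"
      using len by simp
  qed
qed

subsection \<open>Link function, circuits and word limits\<close>

text \<open>Only \<open>n\<close> with \<open>\<lfloor>n / \<theta>\<rfloor> \<ge> 1\<close> matter; all uses below are limits in \<open>n\<close>.\<close>

definition link :: "real \<Rightarrow> nat \<Rightarrow> nat \<Rightarrow> nat \<Rightarrow> nat" where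
  "link \<theta> n i j = (i + j) mod nat \<lfloor>real n / \<theta>\<rfloor>"

definition circuits :: "nat \<Rightarrow> nat \<Rightarrow> (nat \<Rightarrow> nat) set" where
  "circuits n h = {\<pi> \<in> {0..h} \<rightarrow>\<^sub>E {1..n}. \<pi> 0 = \<pi> h}"

text \<open>The \<open>i\<close>-th letter of \<open>w\<close>, counted from 1, is \<open>w ! (i - 1)\<close>.\<close>

definition Pi_star :: "real \<Rightarrow> nat \<Rightarrow> nat list \<Rightarrow> (nat \<Rightarrow> nat) set" where
  "Pi_star \<theta> n w = {\<pi> \<in> circuits n (length w).
     \<forall>i\<in>{1..length w}. \<forall>j\<in>{1..length w}. w ! (i - 1) = w ! (j - 1) \<longrightarrow>
       link \<theta> n (\<pi> (i - 1)) (\<pi> i) = link \<theta> n (\<pi> (j - 1)) (\<pi> j)}"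

definition word_freq :: "real \<Rightarrow> nat list \<Rightarrow> nat \<Rightarrow> real" where
  "word_freq \<theta> w n = real (card (Pi_star \<theta> n w)) / real n ^ (length w div 2 + 1)"

definition word_limit :: "real \<Rightarrow> nat list \<Rightarrow> real" where
  "word_limit \<theta> w = lim (word_freq \<theta> w)"

text \<open>The only Catalan word of length 2 imposes no constraint on circuits, since the link
  function is symmetric. Its limit is exactly 1, so a strict inequality for Catalan words can
  hold only from length 4 on.\<close>

lemma catalan_words_1: "catalan_words 1 = {[0, 0]}"
proof -
  have "w = [0, 0]" if "w \<in> catalan_words 1" for w
  proof -
    from that have w: "length w = 2" "is_word w" "\<forall>a\<in>set w. count_list w a = 2"
      by (simp_all add: catalan_words_def pair_matched_words_def pair_matched_def)
    then obtain a b where ab: "w = [a, b]"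
      by (metis (no_types) length_0_conv length_Suc_conv numeral_2_eq_2)
    with w(3) have "a = b" by (simp split: if_splits)
    with ab w(2) show ?thesis by (simp add: is_word_def)
  qed
  moreover have "[0, 0] \<in> catalan_words 1"
    using reduces_to_empty.delete[of "[]" "[]" "0::nat"] reduces_to_empty.empty
    by (simp add: catalan_words_def pair_matched_words_def pair_matched_def is_word_def)
  ultimately show ?thesis by blast
qed

lemma word_limit_length_2: "word_limit \<theta> [0, 0] = 1"
proof -
  have Pi: "Pi_star \<theta> n [0, 0] = {\<pi> \<in> {0..2} \<rightarrow>\<^sub>E {1..n}. \<pi> 0 = \<pi> 2}" for n
  proof -
    have I: "{1..2::nat} = {1, 2}" by auto
    have "link \<theta> n a b = link \<theta> n b a" for a b
      by (simp add: link_def add.commute)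
    then have "\<forall>i\<in>{1, 2}. \<forall>j\<in>{1, 2}. [0, 0::nat] ! (i - 1) = [0, 0] ! (j - 1) \<longrightarrow>
        link \<theta> n (\<pi> (i - 1)) (\<pi> i) = link \<theta> n (\<pi> (j - 1)) (\<pi> j)"
      if "\<pi> 0 = \<pi> 2" for \<pi> :: "nat \<Rightarrow> nat"
      using that by simp
    moreover have "length [0, 0::nat] = 2" by simp
    ultimately show ?thesis
      unfolding Pi_star_def circuits_def by (simp only: I) blast
  qed
  have bij: "bij_betw (\<lambda>\<pi> :: nat \<Rightarrow> nat. (\<pi> 0, \<pi> 1)) {\<pi> \<in> {0..2} \<rightarrow>\<^sub>E {1..n}. \<pi> 0 = \<pi> 2}
      ({1..n} \<times> {1..n})" (is "bij_betw ?f ?A ?B") for n :: nat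
  proof (rule bij_betw_imageI)
    have I: "{0..2::nat} = {0, 1, 2}" by auto
    show "inj_on ?f ?A"
    proof (rule inj_onI)
      fix \<pi> \<rho> assume *: "\<pi> \<in> ?A" "\<rho> \<in> ?A" "?f \<pi> = ?f \<rho>"
      show "\<pi> = \<rho>"
      proof (rule PiE_ext)
        show "\<pi> \<in> {0..2} \<rightarrow>\<^sub>E {1..n}" "\<rho> \<in> {0..2} \<rightarrow>\<^sub>E {1..n}"
          using * by simp_all
        show "\<pi> i = \<rho> i" if "i \<in> {0..2}" for i
          using * that unfolding I by auto
      qed
    qed
    show "?f ` ?A = ?B"
    proof (intro equalityI subsetI)
      fix y assume "y \<in> ?f ` ?A"
      then obtain \<pi> :: "nat \<Rightarrow> nat"
        where "\<pi> \<in> {0..2} \<rightarrow>\<^sub>E {1..n}" and y: "y = (\<pi> 0, \<pi> 1)" by auto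
      then show "y \<in> ?B"
        by (simp add: PiE_iff)
    next
      fix y assume y: "y \<in> ?B"
      define \<pi> where "\<pi> = (\<lambda>i\<in>{0..2::nat}. if i = 1 then snd y else fst y)"
      have "\<pi> \<in> ?A" using y by (auto simp: \<pi>_def)
      moreover have "y = ?f \<pi>" by (simp add: \<pi>_def)
      ultimately show "y \<in> ?f ` ?A" by (intro image_eqI[of y ?f \<pi> ?A])
    qed
  qed
  have "card (Pi_star \<theta> n [0, 0]) = n ^ 2" for n
    unfolding Pi bij_betw_same_card[OF bij] by (simp add: card_cartesian_product power2_eq_square)
  then have "word_freq \<theta> [0, 0] n = 1" if "n \<ge> 1" for n
    using that by (simp add: word_freq_def power2_eq_square)
  then have "eventually (\<lambda>n. word_freq \<theta> [0, 0] n = 1) sequentially"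
    by (auto simp: eventually_sequentially)
  then have "word_freq \<theta> [0, 0] \<longlonglongrightarrow> 1"
    by (rule tendsto_eventually)
  then show ?thesis
    by (simp add: word_limit_def limI)
qed

subsection \<open>The random matrices and their spectral distributions\<close>

definition identically_distributed :: "'a measure \<Rightarrow> (nat \<Rightarrow> 'a \<Rightarrow> real) \<Rightarrow> bool" where
  "identically_distributed M X \<longleftrightarrow> (\<forall>i. distr M borel (X i) = distr M borel (X 0))"

definition uniformly_bounded :: "'a measure \<Rightarrow> (nat \<Rightarrow> 'a \<Rightarrow> real) \<Rightarrow> bool" where
  "uniformly_bounded M X \<longleftrightarrow> (\<exists>B. \<forall>i. AE \<omega> in M. \<bar>X i \<omega>\<bar> \<le> B)"

definition uniformly_bounded_moments :: "'a measure \<Rightarrow> (nat \<Rightarrow> 'a \<Rightarrow> real) \<Rightarrow> bool" where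
  "uniformly_bounded_moments M X \<longleftrightarrow> (\<forall>m::nat. \<exists>B. \<forall>i.
     integrable M (\<lambda>\<omega>. \<bar>X i \<omega>\<bar> ^ m) \<and> (\<integral>\<omega>. \<bar>X i \<omega>\<bar> ^ m \<partial>M) \<le> B)"

definition input_sequence :: "'a measure \<Rightarrow> (nat \<Rightarrow> 'a \<Rightarrow> real) \<Rightarrow> bool" where
  "input_sequence M X \<longleftrightarrow>
     prob_space M \<and>
     prob_space.indep_vars M (\<lambda>_. borel) X UNIV \<and>
     (\<forall>i. integrable M (X i) \<and> integrable M (\<lambda>\<omega>. (X i \<omega>)\<^sup>2) \<and>
          prob_space.expectation M (X i) = 0 \<and> prob_space.variance M (X i) = 1) \<and>
     (uniformly_bounded M X \<or> identically_distributed M X \<or> uniformly_bounded_moments M X)"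

text \<open>Matrix indices start at 0 in the library, hence the successors.\<close>

definition patterned_matrix :: "real \<Rightarrow> nat \<Rightarrow> (nat \<Rightarrow> real) \<Rightarrow> real mat" where
  "patterned_matrix \<theta> n x = mat n n (\<lambda>(i, j). x (link \<theta> n (Suc i) (Suc j)) / sqrt (real n))"

text \<open>Distribution function of the uniform distribution on the real eigenvalues, counted with
  algebraic multiplicity; it is used for symmetric matrices only, whose eigenvalues are all real.\<close>

definition esd :: "real mat \<Rightarrow> real \<Rightarrow> real" where
  "esd A t = real (size {# l \<in># proots (char_poly A). l \<le> t #}) / real (dim_row A)"

definition almost_sure_limiting_spectral_distribution ::
    "real \<Rightarrow> 'a measure \<Rightarrow> (nat \<Rightarrow> 'a \<Rightarrow> real) \<Rightarrow> real measure \<Rightarrow> bool" where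
  "almost_sure_limiting_spectral_distribution \<theta> M X \<mu> \<longleftrightarrow>
     real_distribution \<mu> \<and>
     (AE \<omega> in M. weak_conv (\<lambda>n. esd (patterned_matrix \<theta> n (\<lambda>i. X i \<omega>))) (cdf \<mu>))"

end

theory Submission
  imports Defs "Jordan_Normal_Form.Schur_Decomposition" "HOL-Real_Asymp.Real_Asymp"
      "HOL-Number_Theory.Cong"
begin

text \<open>
  With \<open>m = \<lfloor>n / \<theta>\<rfloor>\<close>, the link equations of a circuit are linear equations modulo \<open>m\<close>. In a
  pair-matched word the vertex 0 and the ends of the first occurrences of letters are free, and every
  other vertex is an integer combination of them modulo \<open>m\<close>, so it is determined up to its lift to
  \<open>{1..n}\<close>. Writing the normalized count as an expectation over independent uniform free vertices,
  dominated convergence gives the limit: the number of lifts is a difference of two floors, which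
  converges almost surely because a nontrivial linear form in the free vertices avoids any given value.

  Inserting a double letter into a Catalan word splits a vertex into two vertices that only have to
  agree modulo \<open>m\<close>. By Cauchy-Schwarz over the residue classes this gains a factor
  \<open>n / m \<ge> \<theta>\<close> for at least one insertion, and no insertion loses anything.

  The moment identity is the moment method. For inputs with uniformly bounded moments the expected
  normalized traces of even powers converge to the sum of the word limits, since circuits with fewer than
  \<open>k\<close> distinct link values are negligible. A spectral mean of a Lipschitz function moves little
  in mean when the inputs move little in mean square, which reduces identically distributed inputs to
  truncated ones. Finally \<open>x\<^bsup>2k\<^esup>\<close> is the monotone limit of \<open>min \<bar>x\<bar> R\<^bsup>2k\<^esup>\<close>, with an error
  controlled by the moment of order \<open>2k + 2\<close>.
\<close>

subsection \<open>Spectra of real symmetric matrices\<close>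

text \<open>The limiting spectral distribution is given by hypothesis, and this decides the shape of
  the moment part: bounded continuous spectral statistics converge almost surely, dominated
  convergence passes to their expectations, and what remains is to know expected traces. Powers are
  unbounded, so they meet the weak limit only through bounded truncated powers; these are Lipschitz,
  which lets a mean square approximation of the inputs act on them.

  For words the obstacle is the closing condition of a circuit. The last vertex is both tied by a
  link equation and equal to the first vertex; either the resulting congruence holds identically in
  the free vertices, or the proportion of its solutions tends to 0. The same condition makes length
  2 an exception among Catalan words: a double letter inserted into the empty word splits a vertex
  into the two ends of the circuit, which must coincide, so nothing is gained. From length 4 on, one
  copy of the split vertex can be chosen away from the ends, and the limit is at least
  \<theta>.\<close>

definition mtrace :: "'a::comm_semiring_0 mat \<Rightarrow> 'a" where
  "mtrace A = (\<Sum>i<dim_row A. A $$ (i, i))"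

lemma mtrace_mult:
  assumes "A \<in> carrier_mat n m" "B \<in> carrier_mat m n"
  shows "mtrace (A * B) = (\<Sum>i<n. \<Sum>j<m. A $$ (i, j) * B $$ (j, i))"
  using assms by (auto simp: mtrace_def scalar_prod_def lessThan_atLeast0 intro!: sum.cong)

lemma mtrace_mult_commute:
  assumes "A \<in> carrier_mat n m" "B \<in> carrier_mat m n"
  shows "mtrace (A * B) = mtrace (B * A)"
  unfolding mtrace_mult[OF assms] mtrace_mult[OF assms(2,1)]
  by (subst sum.swap) (simp add: mult.commute)

lemma mtrace_similar:
  assumes "similar_mat_wit A B P Q"
  shows "mtrace A = mtrace B"
proof -
  obtain n where c: "A \<in> carrier_mat n n" "B \<in> carrier_mat n n" "P \<in> carrier_mat n n" "Q \<in> carrier_mat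
      n n"
    and QP: "Q * P = 1\<^sub>m n" and A: "A = P * B * Q"
    using similar_mat_witD[OF refl assms] by blast
  have "mtrace A = mtrace (P * (B * Q))"
    unfolding A using c by (simp add: assoc_mult_mat[of _ n n _ n _ n])
  also have "\<dots> = mtrace (B * Q * P)"
    using c by (intro mtrace_mult_commute) auto
  also have "B * Q * P = B"
    using c QP by (simp add: assoc_mult_mat[of _ n n _ n _ n])
  finally show ?thesis .
qed

lemma transpose_smult_mat: "transpose_mat (c \<cdot>\<^sub>m (B :: 'a::comm_ring_1 mat)) = c \<cdot>\<^sub>m transpose_mat B"
  by (intro eq_matI) auto

section \<open>Polynomials of a square matrix\<close>

definition poly_mat :: "'a::comm_ring_1 mat \<Rightarrow> 'a poly \<Rightarrow> 'a mat" where
  "poly_mat A p = fold_coeffs (\<lambda>a M. a \<cdot>\<^sub>m 1\<^sub>m (dim_row A) + A * M) p (0\<^sub>m (dim_row A) (dim_row A))"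

context
  fixes A :: "'a::comm_ring_1 mat" and n
  assumes A: "A \<in> carrier_mat n n"
begin

lemma poly_mat_0 [simp]: "poly_mat A 0 = 0\<^sub>m n n"
  using A by (simp add: poly_mat_def)

lemma poly_mat_pCons: "poly_mat A (pCons a p) = a \<cdot>\<^sub>m 1\<^sub>m n + A * poly_mat A p"
proof (cases "pCons a p = 0")
  case True
  then have "a = 0" "p = 0" by auto
  then show ?thesis using A by (auto intro!: eq_matI simp del: index_mult_mat(1))
next
  case False
  then show ?thesis using A by (cases "p = 0"; cases "a = 0") (auto simp: poly_mat_def)
qed

lemma poly_mat_carrier [simp]: "poly_mat A p \<in> carrier_mat n n"
  by (induction p) (use A in \<open>auto simp: poly_mat_pCons\<close>)

lemma poly_mat_dim [simp]: "dim_row (poly_mat A p) = n" "dim_col (poly_mat A p) = n"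
  using poly_mat_carrier[of p] by (auto simp del: poly_mat_carrier)

lemma poly_mat_commute: "poly_mat A p * A = A * poly_mat A p"
proof (induction p)
  case (pCons a p)
  show ?case
    using A pCons(2) unfolding poly_mat_pCons
    by (subst add_mult_distrib_mat[of _ n n], auto)
       (subst mult_add_distrib_mat[of _ n n], auto simp: mult_smult_distrib[of _ n n]
           mult_smult_assoc_mat[of _ n n] assoc_mult_mat[of _ n n _ n _ n])
qed (use A in auto)

lemma poly_mat_add: "poly_mat A (p + q) = poly_mat A p + poly_mat A q"
proof (induction p q rule: poly_induct2)
  case (pCons a p b q)
  have "A * (poly_mat A p + poly_mat A q) = A * poly_mat A p + A * poly_mat A q"
    using A by (intro mult_add_distrib_mat[of _ n n]) auto
  with A pCons show ?case
    by (intro eq_matI) (auto simp: poly_mat_pCons algebra_simps simp del: index_mult_mat(1))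
qed (use A in auto)

lemma poly_mat_smult: "poly_mat A (Polynomial.smult c p) = c \<cdot>\<^sub>m poly_mat A p"
proof (induction p)
  case (pCons a p)
  have "A * (c \<cdot>\<^sub>m poly_mat A p) = c \<cdot>\<^sub>m (A * poly_mat A p)"
    using A by (intro mult_smult_distrib[of _ n n]) auto
  with A pCons show ?case
    by (intro eq_matI) (auto simp: poly_mat_pCons algebra_simps simp del: index_mult_mat(1))
qed (use A in auto)

lemma poly_mat_mult: "poly_mat A (p * q) = poly_mat A p * poly_mat A q"
proof (induction p)
  case (pCons a p)
  have "poly_mat A (pCons a p * q) = a \<cdot>\<^sub>m poly_mat A q + (0 \<cdot>\<^sub>m 1\<^sub>m n
      + A * (poly_mat A p * poly_mat A q))"
    by (simp add: mult_pCons_left poly_mat_add poly_mat_smult poly_mat_pCons pCons)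
  also have "0 \<cdot>\<^sub>m 1\<^sub>m n + A * (poly_mat A p * poly_mat A q) = A * (poly_mat A p * poly_mat A q)"
    using A by (intro eq_matI) (auto simp del: index_mult_mat(1))
  also have "a \<cdot>\<^sub>m poly_mat A q + \<dots> = poly_mat A (pCons a p) * poly_mat A q"
    unfolding poly_mat_pCons using A
    by (subst add_mult_distrib_mat[of _ n n], auto)
       (subst mult_smult_assoc_mat[of _ n n], auto simp: assoc_mult_mat[of _ n n _ n _ n])
  finally show ?case .
qed (use A in auto)

lemma poly_mat_power: "poly_mat A (monom 1 k) = A ^\<^sub>m k"
proof (induction k)
  case 0
  then show ?case using A by (intro eq_matI) (auto simp: monom_0 poly_mat_pCons carrier_matD[OF A]
      split: if_splits simp del: index_mult_mat(1))
next
  case (Suc k)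
  have "A ^\<^sub>m k \<in> carrier_mat n n" using A by simp
  then have "poly_mat A (monom 1 (Suc k)) = A * A ^\<^sub>m k"
    unfolding monom_Suc poly_mat_pCons Suc using A
    by (intro eq_matI) (auto simp del: index_mult_mat(1) pow_carrier_mat)
  also have "\<dots> = A ^\<^sub>m Suc k"
    using poly_mat_commute[of "monom 1 k"] by (simp add: Suc)
  finally show ?case .
qed

lemma transpose_poly_mat:
  assumes "transpose_mat A = A"
  shows "transpose_mat (poly_mat A p) = poly_mat A p"
proof (induction p)
  case (pCons a p)
  show ?case
    unfolding poly_mat_pCons using A pCons(2) assms
    by (subst transpose_add[of _ n n], auto)
       (subst transpose_mult[of _ n n _ n], auto simp: poly_mat_commute transpose_smult_mat)
qed (use A in auto)

end

lemma poly_mat_similar: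
  assumes A: "A \<in> carrier_mat n n" and "similar_mat_wit A B P Q"
  shows "similar_mat_wit (poly_mat A p) (poly_mat B p) P Q"
proof -
  have c: "B \<in> carrier_mat n n" "P \<in> carrier_mat n n" "Q \<in> carrier_mat n n"
    and PQ: "P * Q = 1\<^sub>m n" and QP: "Q * P = 1\<^sub>m n" and AB: "A = P * B * Q"
    using similar_mat_witD2[OF assms] by auto
  have cB [simp]: "poly_mat B p \<in> carrier_mat n n" for p
    by (rule poly_mat_carrier[OF c(1)])
  have "poly_mat A p = P * poly_mat B p * Q"
  proof (induction p)
    case 0
    then show ?case using c A by (simp add: poly_mat_0[OF c(1)] poly_mat_0[OF A])
  next
    case (pCons a p)
    have "P * poly_mat B (pCons a p) * Q = (P * (a \<cdot>\<^sub>m 1\<^sub>m n) + P * (B * poly_mat B p)) * Q"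
      unfolding poly_mat_pCons[OF c(1)] using c by (subst mult_add_distrib_mat[of _ n n]) auto
    also have "\<dots> = P * (a \<cdot>\<^sub>m 1\<^sub>m n) * Q + P * (B * poly_mat B p) * Q"
      using c by (subst add_mult_distrib_mat[of _ n n]) auto
    also have "P * (a \<cdot>\<^sub>m 1\<^sub>m n) * Q = a \<cdot>\<^sub>m 1\<^sub>m n"
      using c PQ by (subst mult_smult_distrib[of _ n n _ n], auto,
          subst mult_smult_assoc_mat[of _ n n _ n], auto)
    also have "P * (B * poly_mat B p) * Q = P * (B * ((Q * P) * poly_mat B p)) * Q"
      using c QP by simp
    also have "\<dots> = P * B * Q * (P * poly_mat B p * Q)"
      using c by (simp add: assoc_mult_mat[of _ n n _ n _ n] mult_carrier_mat[of _ n n _ n])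
    finally show ?case
      unfolding poly_mat_pCons[OF A] pCons unfolding AB by simp
  qed
  then show ?thesis
    using A c PQ QP by (intro similar_mat_witI[of _ _ n]) (auto simp: poly_mat_carrier[OF A])
qed

text \<open>Products of upper triangular matrices are upper triangular and their diagonal entries
  multiply. Triangularity of \<open>poly_mat T p\<close> is therefore carried through the induction
  together with the diagonal.\<close>

lemma diag_poly_mat:
  fixes T :: "'a::comm_ring_1 mat"
  assumes T: "T \<in> carrier_mat n n" and up: "upper_triangular T" and "i < n"
  shows "poly_mat T p $$ (i, i) = poly p (T $$ (i, i))"
proof -
  have "upper_triangular (poly_mat T p) \<and> (\<forall>i<n. poly_mat T p $$ (i, i) = poly p (T $$ (i, i)))"
  proof (induction p)
    case (pCons a p)
    let ?M = "poly_mat T p"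
    have *: "(T * ?M) $$ (i, j) = (\<Sum>k<n. T $$ (i, k) * ?M $$ (k, j))" if "i < n" "j < n" for i j
      using T that by (auto simp: scalar_prod_def lessThan_atLeast0 poly_mat_dim[OF T])
    have z: "T $$ (i, k) * ?M $$ (k, j) = 0" if "k < n" "i < n" "j < n" "j < i \<or> (i = j \<and> k \<noteq> i)"
        for i j k
    proof (cases "k < i")
      case True
      then show ?thesis using up that T by (auto simp: upper_triangular_def)
    next
      case False
      then have "j < k" using that by auto
      then show ?thesis using pCons(2) that poly_mat_dim[OF T] by (auto simp: upper_triangular_def)
    qed
    have 1: "(T * ?M) $$ (i, j) = 0" if "i < n" "j < i" for i j
      using * z that by (auto intro!: sum.neutral)
    have 2: "(T * ?M) $$ (i, i) = T $$ (i, i) * poly p (T $$ (i, i))" if "i < n" for i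
    proof -
      have "(T * ?M) $$ (i, i) = (\<Sum>k\<in>{i}. T $$ (i, k) * ?M $$ (k, i))"
        unfolding *[OF that that] using that z[of _ i i] by (intro sum.mono_neutral_right) auto
      then show ?thesis using pCons(2) that by simp
    qed
    show ?case
      unfolding poly_mat_pCons[OF T] using T 1 2 poly_mat_dim[OF T]
      by (auto simp: upper_triangular_def simp del: index_mult_mat(1))
  qed (use T in \<open>auto simp: upper_triangular_def\<close>)
  with \<open>i < n\<close> show ?thesis by simp
qed

text \<open>The polynomial splits over the complex numbers. For an eigenvector v to the root a, the
  Hermitian form of A at v equals a times the squared norm of v, and it is its own conjugate by
  symmetry; so a is real. The real factorization follows by comparing coefficients.\<close>

lemma real_symmetric_char_poly_splits:
  fixes A :: "real mat"
  assumes A: "A \<in> carrier_mat n n" and sym: "transpose_mat A = A"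
  shows "\<exists>es. char_poly A = (\<Prod>e\<leftarrow>es. [:- e, 1:]) \<and> length es = n"
proof -
  define C where "C = map_mat complex_of_real A"
  have C: "C \<in> carrier_mat n n" using A by (simp add: C_def)
  have symA: "A $$ (i, j) = A $$ (j, i)" if "i < n" "j < n" for i j
    using A that arg_cong[OF sym, of "\<lambda>M. M $$ (j, i)"] by auto
  obtain as where as: "char_poly C = (\<Prod>a\<leftarrow>as. [:- a, 1:])" "length as = n"
    using char_poly_factorized[OF C] by blast
  have re: "a = of_real (Re a)" if "a \<in> set as" for a
  proof -
    have "poly (char_poly C) a = 0"
      unfolding as using that by (auto simp: poly_prod_list prod_list_zero_iff image_iff)
    then have "eigenvalue C a"
      using eigenvalue_root_char_poly[OF C] by simp
    then obtain v where v: "v \<in> carrier_vec n" "v \<noteq> 0\<^sub>v n" "C *\<^sub>v v = a \<cdot>\<^sub>v v"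
      using C by (auto simp: eigenvalue_def eigenvector_def)
    define S where "S = (\<Sum>i<n. \<Sum>j<n. cnj (v $ i) * of_real (A $$ (i, j)) * v $ j)"
    define N where "N = (\<Sum>i<n. (cmod (v $ i))\<^sup>2)"
    have "S = (\<Sum>i<n. cnj (v $ i) * (C *\<^sub>v v) $ i)"
      unfolding S_def using A v(1)
      by (intro sum.cong) (auto simp: C_def scalar_prod_def lessThan_atLeast0 sum_distrib_left
          mult.assoc)
    also have "\<dots> = a * (\<Sum>i<n. cnj (v $ i) * v $ i)"
      using v by (auto simp: sum_distrib_left mult_ac intro!: sum.cong)
    also have "(\<Sum>i<n. cnj (v $ i) * v $ i) = of_real N"
      unfolding N_def of_real_sum
      by (intro sum.cong refl) (simp only: complex_norm_square mult.commute)
    finally have S: "S = a * of_real N" .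
    have "cnj S = (\<Sum>i<n. \<Sum>j<n. cnj (v $ j) * of_real (A $$ (j, i)) * v $ i)"
      unfolding S_def using symA by (auto simp: mult_ac intro!: sum.cong)
    also have "\<dots> = S"
      unfolding S_def by (rule sum.swap)
    finally have "cnj S = S" .
    moreover have "N \<noteq> 0"
    proof
      assume "N = 0"
      then have "v $ i = 0" if "i < n" for i
        using that unfolding N_def by (subst (asm) sum_nonneg_eq_0_iff) auto
      with v(1,2) show False by auto
    qed
    ultimately have "cnj a = a"
      unfolding S by simp
    then show ?thesis
      by (simp add: complex_eq_iff)
  qed
  have mult: "map_poly complex_of_real (p * q)
      = map_poly complex_of_real p * map_poly complex_of_real q" for p q
    by (intro poly_eqI) (simp add: coeff_mult coeff_map_poly)
  have "map_poly complex_of_real (char_poly A) = char_poly C"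
    unfolding C_def using A by (simp add: of_real_hom.char_poly_hom)
  also have "\<dots> = (\<Prod>a\<leftarrow>map Re as. [:- of_real a, 1:])"
    unfolding as(1) using re by (auto simp: o_def intro!: arg_cong[of _ _ prod_list] map_cong)
  also have "\<dots> = map_poly complex_of_real (\<Prod>a\<leftarrow>map Re as. [:- a, 1:])"
    by (induction as) (simp_all add: mult del: mult_pCons_left mult_pCons_right)
  finally have *: "map_poly complex_of_real (char_poly A)
      = map_poly complex_of_real (\<Prod>a\<leftarrow>map Re as. [:- a, 1:])" .
  have "coeff (char_poly A) i = coeff (\<Prod>a\<leftarrow>map Re as. [:- a, 1:]) i" for i
    using arg_cong[OF *, of "\<lambda>p. coeff p i"] by (simp only: coeff_map_poly of_real_0 of_real_eq_iff)
  then have "char_poly A = (\<Prod>a\<leftarrow>map Re as. [:- a, 1:])"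
    by (intro poly_eqI)
  with as(2) show ?thesis by (intro exI[of _ "map Re as"]) auto
qed

text \<open>Schur triangularization puts the given roots on the diagonal of a similar matrix, where
  a polynomial acts on each diagonal entry separately; the trace is invariant under
  similarity.\<close>

lemma mtrace_poly_mat:
  fixes A :: "real mat"
  assumes A: "A \<in> carrier_mat n n" and es: "char_poly A = (\<Prod>e\<leftarrow>es. [:- e, 1:])"
  shows "mtrace (poly_mat A p) = (\<Sum>e\<leftarrow>es. poly p e)"
proof -
  obtain T P Q where "schur_decomposition A es = (T, P, Q)"
    by (cases "schur_decomposition A es") auto
  from schur_decomposition[OF A es this]
  have sim: "similar_mat_wit A T P Q" and up: "upper_triangular T" and es': "diag_mat T = es"
    by auto
  have T: "T \<in> carrier_mat n n" using similar_mat_witD2[OF A sim] by auto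
  have "mtrace (poly_mat A p) = mtrace (poly_mat T p)"
    by (rule mtrace_similar[OF poly_mat_similar[OF A sim]])
  also have "\<dots> = (\<Sum>i<n. poly p (T $$ (i, i)))"
    using diag_poly_mat[OF T up] by (simp add: mtrace_def poly_mat_dim[OF T])
  also have "\<dots> = (\<Sum>e\<leftarrow>es. poly p e)"
    using T by (simp add: es'[symmetric] diag_mat_def interv_sum_list_conv_sum_set_nat
        lessThan_atLeast0 o_def)
  finally show ?thesis .
qed

lemma proots_prod_linear:
  fixes es :: "real list"
  shows "proots (\<Prod>e\<leftarrow>es. [:- e, 1:]) = mset es"
proof (induction es)
  case (Cons e es)
  have "(\<Prod>e\<leftarrow>es. [:- e, 1:]) \<noteq> (0 :: real poly)"
    by (auto simp: prod_list_zero_iff)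
  moreover have "proots [:- e, 1:] = {#e#}"
    using proots_linear_factor[of "- e"] by simp
  ultimately show ?case using Cons by (simp add: proots_mult del: mult_pCons_left)
qed auto

text \<open>By symmetry the squared Frobenius norm of \<open>poly_mat A p\<close> is the trace of
  \<open>poly_mat A (p * p)\<close>, which is the sum of the squares of p over the spectrum. This
  plays the part of diagonalizability: only the values of a polynomial on the spectrum
  matter.\<close>

lemma poly_mat_eq_0:
  fixes A :: "real mat"
  assumes A: "A \<in> carrier_mat n n" and sym: "transpose_mat A = A"
    and es: "char_poly A = (\<Prod>e\<leftarrow>es. [:- e, 1:])"
    and p: "\<And>e. e \<in> set es \<Longrightarrow> poly p e = 0"
  shows "poly_mat A p = 0\<^sub>m n n"
proof -
  let ?M = "poly_mat A p"
  have s: "?M $$ (j, i) = ?M $$ (i, j)" if "i < n" "j < n" for i j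
    using that arg_cong[OF transpose_poly_mat[OF A sym, of p], of "\<lambda>M. M $$ (i, j)"]
    by (auto simp: poly_mat_dim[OF A])
  have "(\<Sum>i<n. \<Sum>j<n. (?M $$ (i, j))\<^sup>2) = mtrace (?M * ?M)"
    using s by (simp add: mtrace_mult[OF poly_mat_carrier[OF A] poly_mat_carrier[OF A]] power2_eq_square)
  also have "\<dots> = mtrace (poly_mat A (p * p))"
    by (simp add: poly_mat_mult[OF A])
  also have "\<dots> = (\<Sum>e\<leftarrow>es. poly p e * poly p e)"
    by (simp add: mtrace_poly_mat[OF A es])
  also have "\<dots> = 0"
    using p by (auto simp: sum_list_eq_0_iff cong: map_cong)
  finally have "?M $$ (i, j) = 0" if "i < n" "j < n" for i j
    using that by (subst (asm) sum_nonneg_eq_0_iff) (auto simp: sum_nonneg sum_nonneg_eq_0_iff)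
  then show ?thesis
    by (intro eq_matI) (auto simp: poly_mat_dim[OF A])
qed

text \<open>The interpolation polynomial that is 1 at \<open>a\<close> and 0 on the rest of
  \<open>S\<close>. With \<open>S\<close> the spectrum of a symmetric matrix, its value at the
  matrix is the spectral projection of the eigenvalue \<open>a\<close>.\<close>

definition lagrange_basis :: "'a::field set \<Rightarrow> 'a \<Rightarrow> 'a poly" where
  "lagrange_basis S a = (\<Prod>b\<in>S - {a}. Polynomial.smult (1 / (a - b)) [:- b, 1:])"

lemma poly_lagrange_basis:
  assumes "finite S" "a \<in> S" "x \<in> S"
  shows "poly (lagrange_basis S a) x = (if x = a then 1 else 0)"
  using assms
  by (auto simp: lagrange_basis_def poly_prod diff_divide_distrib[symmetric] intro!: prod.neutral)

text \<open>A polynomial and its interpolant on the spectrum agree there, so they have the same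
  value at \<open>A\<close>. This is the spectral decomposition of
  \<open>poly_mat A p\<close>.\<close>

lemma poly_mat_lagrange:
  fixes A :: "real mat"
  assumes A: "A \<in> carrier_mat n n" and sym: "transpose_mat A = A"
    and es: "char_poly A = (\<Prod>e\<leftarrow>es. [:- e, 1:])"
  shows "poly_mat A p = poly_mat A (\<Sum>a\<in>set es. Polynomial.smult (poly p a) (lagrange_basis (set es) a))"
    (is "_ = poly_mat A ?q")
proof -
  have "poly ?q e = poly p e" if "e \<in> set es" for e
    using that by (simp add: poly_sum poly_lagrange_basis sum.delta if_distrib cong: if_cong)
  then have "poly_mat A (p - ?q) = 0\<^sub>m n n"
    by (intro poly_mat_eq_0[OF A sym es]) simp
  moreover have "poly_mat A p = poly_mat A (p - ?q) + poly_mat A ?q"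
    by (simp add: poly_mat_add[OF A, symmetric])
  ultimately show ?thesis
    using poly_mat_carrier[OF A, of ?q] by simp
qed

text \<open>The weights \<open>q a b = tr (P\<^sub>a Q\<^sub>b)\<close>, with \<open>P\<^sub>a\<close> and \<open>Q\<^sub>b\<close> the spectral projections of the two
  matrices, form a coupling of the two spectra whose quadratic cost is the squared Frobenius
  distance.\<close>

lemma spectrum_perturbation:
  fixes A B :: "real mat" and f :: "real \<Rightarrow> real"
  assumes A: "A \<in> carrier_mat n n" and symA: "transpose_mat A = A"
    and B: "B \<in> carrier_mat n n" and symB: "transpose_mat B = B"
    and as: "char_poly A = (\<Prod>e\<leftarrow>as. [:- e, 1:])" and bs: "char_poly B = (\<Prod>e\<leftarrow>bs. [:- e, 1:])"
    and f: "\<And>x y. \<bar>f x - f y\<bar> \<le> \<eta> + K * (x - y)\<^sup>2"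
  shows "\<bar>(\<Sum>e\<leftarrow>as. f e) - (\<Sum>e\<leftarrow>bs. f e)\<bar>
    \<le> \<eta> * n + K * (\<Sum>i<n. \<Sum>j<n. (A $$ (i, j) - B $$ (i, j))\<^sup>2)"
proof -
  note cA = poly_mat_carrier[OF A] and cB = poly_mat_carrier[OF B]
  note dA = poly_mat_dim[OF A] and dB = poly_mat_dim[OF B]
  define \<beta> where "\<beta> p r = mtrace (poly_mat A p * poly_mat B r)" for p r
  define P where "P a = lagrange_basis (set as) a" for a
  define R where "R b = lagrange_basis (set bs) b" for b
  define q where "q a b = \<beta> (P a) (R b)" for a b
  have \<beta>: "\<beta> p r = (\<Sum>i<n. \<Sum>j<n. poly_mat A p $$ (i, j) * poly_mat B r $$ (j, i))" for p r
    unfolding \<beta>_def by (rule mtrace_mult[OF cA cB])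
  have add1: "\<beta> (p + p') r = \<beta> p r + \<beta> p' r" for p p' r
    unfolding \<beta> by (simp add: poly_mat_add[OF A] dA algebra_simps sum.distrib)
  have add2: "\<beta> p (r + r') = \<beta> p r + \<beta> p r'" for p r r'
    unfolding \<beta> by (simp add: poly_mat_add[OF B] dB algebra_simps sum.distrib)
  have smult1: "\<beta> (Polynomial.smult c p) r = c * \<beta> p r" for p c r
    unfolding \<beta> by (simp add: poly_mat_smult[OF A] dA algebra_simps sum_distrib_left)
  have smult2: "\<beta> p (Polynomial.smult c r) = c * \<beta> p r" for p c r
    unfolding \<beta> by (simp add: poly_mat_smult[OF B] dB algebra_simps sum_distrib_left)
  have zero: "\<beta> 0 r = 0" "\<beta> p 0 = 0" for p r
    unfolding \<beta> by (simp_all add: poly_mat_0[OF A] poly_mat_0[OF B])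
  have sum1: "\<beta> (sum g S) r = (\<Sum>s\<in>S. \<beta> (g s) r)" if "finite S" for g r and S :: "real set"
    using that by (induction S) (auto simp: add1 zero)
  have sum2: "\<beta> p (sum g S) = (\<Sum>s\<in>S. \<beta> p (g s))" if "finite S" for g p and S :: "real set"
    using that by (induction S) (auto simp: add2 zero)
  \<comment> \<open>Replacing both polynomials by their interpolants shows that the bilinear form is
    integration of p(a) r(b) against the weights \<open>q\<close>.\<close>
  have rep: "\<beta> p r = (\<Sum>a\<in>set as. \<Sum>b\<in>set bs. poly p a * poly r b * q a b)" for p r
  proof -
    have "\<beta> p r = \<beta> (\<Sum>a\<in>set as. Polynomial.smult (poly p a) (P a)) (\<Sum>b\<in>set bs. Polynomial.smult (poly
        r b) (R b))"
      unfolding \<beta>_def P_def R_def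
      using poly_mat_lagrange[OF A symA as, of p] poly_mat_lagrange[OF B symB bs, of r] by simp
    then show ?thesis
      by (simp add: sum1 sum2 smult1 smult2 q_def sum_distrib_left mult_ac) (rule sum.swap)
  qed
  \<comment> \<open>Both projections are symmetric and idempotent (the latter because the basis
    polynomials are 0 or 1 on the spectrum), so the trace of their product is the squared Frobenius
    norm of the product in the other order.\<close>
  have q_nonneg: "q a b \<ge> 0" if "a \<in> set as" "b \<in> set bs" for a b
  proof -
    let ?M = "poly_mat A (P a)" and ?N = "poly_mat B (R b)"
    have "poly_mat A (P a - P a * P a) = 0\<^sub>m n n"
      using that by (intro poly_mat_eq_0[OF A symA as]) (auto simp: P_def poly_lagrange_basis)
    moreover have "?M = poly_mat A (P a - P a * P a) + poly_mat A (P a * P a)"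
      by (simp add: poly_mat_add[OF A, symmetric])
    ultimately have M: "?M * ?M = ?M"
      by (simp add: poly_mat_mult[OF A] mult_carrier_mat[OF cA cA])
    have "poly_mat B (R b - R b * R b) = 0\<^sub>m n n"
      using that by (intro poly_mat_eq_0[OF B symB bs]) (auto simp: R_def poly_lagrange_basis)
    moreover have "?N = poly_mat B (R b - R b * R b) + poly_mat B (R b * R b)"
      by (simp add: poly_mat_add[OF B, symmetric])
    ultimately have N: "?N * ?N = ?N"
      by (simp add: poly_mat_mult[OF B] mult_carrier_mat[OF cB cB])
    note MN = mult_carrier_mat[OF cA cB, of "P a" "R b"]
    have "?N * ?M * (?M * ?N) = ?N * (?M * (?M * ?N))"
      by (rule assoc_mult_mat[OF cB cA MN])
    also have "?M * (?M * ?N) = ?M * ?N"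
      by (subst assoc_mult_mat[OF cA cA cB, symmetric]) (simp only: M)
    finally have NM: "?N * ?M * (?M * ?N) = ?N * (?M * ?N)" .
    have "q a b = mtrace (?M * (?N * ?N))"
      by (simp only: q_def \<beta>_def N)
    also have "\<dots> = mtrace (?M * ?N * ?N)"
      by (simp only: assoc_mult_mat[OF cA cB cB])
    also have "\<dots> = mtrace (?N * ?M * (?M * ?N))"
      unfolding NM by (rule mtrace_mult_commute[OF MN cB])
    also have "?M * ?N = transpose_mat (?N * ?M)"
      using cA cB transpose_poly_mat[OF A symA] transpose_poly_mat[OF B symB]
      by (simp add: transpose_mult[of _ n n _ n])
    also have "mtrace (?N * ?M * transpose_mat (?N * ?M)) = (\<Sum>i<n. \<Sum>j<n. ((?N * ?M) $$ (i, j))\<^sup>2)"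
      using cA cB by (subst mtrace_mult[of _ n n]) (auto simp: power2_eq_square dA dB simp del:
          index_mult_mat(1))
    finally show ?thesis by (simp add: sum_nonneg)
  qed
  have one: "\<beta> p 1 = (\<Sum>e\<leftarrow>as. poly p e)" "\<beta> 1 r = (\<Sum>e\<leftarrow>bs. poly r e)" for p r
    using cA cB mtrace_poly_mat[OF A as] mtrace_poly_mat[OF B bs]
      poly_mat_power[OF A, of 0] poly_mat_power[OF B, of 0] A B
    by (auto simp: \<beta>_def monom_0 one_pCons)
  define w where "w g = (\<Sum>a\<in>set as. \<Sum>b\<in>set bs. g a b * q a b)" for g
  have fA: "(\<Sum>e\<leftarrow>as. f e) = w (\<lambda>a b. f a)"
  proof -
    \<comment> \<open>The function \<open>f\<close> is arbitrary; its interpolating polynomial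
      brings it into the scope of \<open>rep\<close>. Taking 1 as the second polynomial gives the
      first marginal of \<open>q\<close>.\<close>
    define F where "F = (\<Sum>a\<in>set as. Polynomial.smult (f a) (P a))"
    have F: "poly F e = f e" if "e \<in> set as" for e
      using that by (simp add: F_def P_def poly_sum poly_lagrange_basis sum.delta if_distrib cong:
          if_cong)
    have "(\<Sum>e\<leftarrow>as. f e) = (\<Sum>e\<leftarrow>as. poly F e)"
      using F by (intro arg_cong[of _ _ sum_list] map_cong) auto
    then show ?thesis
      unfolding one(1)[symmetric] rep w_def using F by simp
  qed
  have fB: "(\<Sum>e\<leftarrow>bs. f e) = w (\<lambda>a b. f b)"
  proof -
    define F where "F = (\<Sum>a\<in>set bs. Polynomial.smult (f a) (R a))"
    have F: "poly F e = f e" if "e \<in> set bs" for e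
      using that by (simp add: F_def R_def poly_sum poly_lagrange_basis sum.delta if_distrib cong:
          if_cong)
    have "(\<Sum>e\<leftarrow>bs. f e) = (\<Sum>e\<leftarrow>bs. poly F e)"
      using F by (intro arg_cong[of _ _ sum_list] map_cong) auto
    then show ?thesis
      unfolding one(2)[symmetric] rep w_def using F by simp
  qed
  have total: "w (\<lambda>a b. \<eta>) = \<eta> * n"
  proof -
    have "w (\<lambda>a b. \<eta>) = \<eta> * \<beta> 1 1"
      unfolding rep w_def by (simp add: sum_distrib_left)
    also have "\<beta> 1 1 = mtrace (1\<^sub>m n * 1\<^sub>m n)"
      using poly_mat_power[OF A, of 0] poly_mat_power[OF B, of 0] A B
          by (simp add: \<beta>_def monom_0 one_pCons)
    finally show ?thesis by (simp add: mtrace_def)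
  qed
  have dist: "w (\<lambda>a b. (a - b)\<^sup>2) = (\<Sum>i<n. \<Sum>j<n. (A $$ (i, j) - B $$ (i, j))\<^sup>2)"
  proof -
    let ?x = "[:0, 1 :: real:]"
    have x: "poly_mat A ?x = A" "poly_mat B ?x = B" 
      using poly_mat_power[OF A, of 1] poly_mat_power[OF B, of 1] A B
          by (simp_all add: monom_Suc monom_0)
    have x1: "poly_mat A 1 = 1\<^sub>m n" "poly_mat B 1 = 1\<^sub>m n"
      using poly_mat_power[OF A, of 0] poly_mat_power[OF B, of 0] A B
          by (simp_all add: monom_0 one_pCons)
    have sA: "A $$ (j, i) = A $$ (i, j)" and sB: "B $$ (j, i) = B $$ (i, j)" if "i < n" "j < n" for i j
      using that A B arg_cong[OF symA, of "\<lambda>M. M $$ (i, j)"] arg_cong[OF symB, of "\<lambda>M. M $$ (i, j)"]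
          by auto
    \<comment> \<open>The square is expanded into products p(a) r(b), so that \<open>rep\<close>
      turns the quadratic cost into the trace of A A - 2 A B + B B.\<close>
    have "w (\<lambda>a b. (a - b)\<^sup>2) = \<beta> (?x * ?x) 1 - 2 * \<beta> ?x ?x + \<beta> 1 (?x * ?x)"
      unfolding rep w_def by (simp add: algebra_simps power2_eq_square sum.distrib sum_subtractf
          sum_distrib_left)
    also have "\<beta> (?x * ?x) 1 = mtrace (A * A)"
      using A by (simp only: \<beta>_def poly_mat_mult[OF A] x x1) simp
    also have "\<beta> 1 (?x * ?x) = mtrace (B * B)"
      using B by (simp only: \<beta>_def poly_mat_mult[OF B] x x1) simp
    also have "\<beta> ?x ?x = mtrace (A * B)"
      by (simp only: \<beta>_def x)
    finally show ?thesis
      using sA sB by (simp add: mtrace_mult[OF A A] mtrace_mult[OF B B] mtrace_mult[OF A B]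
          power2_eq_square algebra_simps
          sum.distrib sum_subtractf sum_distrib_left)
  qed
  have "\<bar>w (\<lambda>a b. f a) - w (\<lambda>a b. f b)\<bar> = \<bar>\<Sum>a\<in>set as. \<Sum>b\<in>set bs. (f a - f b) * q a b\<bar>"
    unfolding w_def by (simp add: left_diff_distrib sum_subtractf)
  also have "\<dots> \<le> (\<Sum>a\<in>set as. \<Sum>b\<in>set bs. \<bar>(f a - f b) * q a b\<bar>)"
    by (intro order_trans[OF sum_abs] sum_mono sum_abs)
  also have "\<dots> \<le> (\<Sum>a\<in>set as. \<Sum>b\<in>set bs. (\<eta> + K * (a - b)\<^sup>2) * q a b)"
    using f q_nonneg by (intro sum_mono) (auto simp: abs_mult intro!: mult_right_mono)
  also have "\<dots> = w (\<lambda>a b. \<eta>) + K * w (\<lambda>a b. (a - b)\<^sup>2)"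
    unfolding w_def by (simp add: algebra_simps sum.distrib sum_distrib_left)
  finally show ?thesis
    by (simp only: fA fB total dist)
qed

subsection \<open>Paths, circuits and link values\<close>

lemma sum_PiE_Suc:
  "(\<Sum>\<pi>\<in>{0..Suc h} \<rightarrow>\<^sub>E S. G \<pi>) = (\<Sum>\<pi>\<in>{0..h} \<rightarrow>\<^sub>E S. \<Sum>v\<in>S. G (\<pi>(Suc h := v)))"
proof -
  have "{0..Suc h} = insert (Suc h) {0..h}" by auto
  then have "(\<Sum>\<pi>\<in>{0..Suc h} \<rightarrow>\<^sub>E S. G \<pi>) = (\<Sum>(y, g)\<in>S \<times> ({0..h} \<rightarrow>\<^sub>E S). G (g(Suc h := y)))"
    by (simp only: PiE_insert_eq) (subst sum.reindex[OF inj_combinator],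
        auto simp: o_def case_prod_unfold)
  also have "\<dots> = (\<Sum>v\<in>S. \<Sum>\<pi>\<in>{0..h} \<rightarrow>\<^sub>E S. G (\<pi>(Suc h := v)))"
    by (rule sum.cartesian_product[symmetric])
  also have "\<dots> = (\<Sum>\<pi>\<in>{0..h} \<rightarrow>\<^sub>E S. \<Sum>v\<in>S. G (\<pi>(Suc h := v)))"
    by (rule sum.swap)
  finally show ?thesis .
qed

lemma sum_PiE_0:
  "(\<Sum>\<pi>\<in>{0..0::nat} \<rightarrow>\<^sub>E S. G \<pi>) = (\<Sum>v\<in>S. G ((\<lambda>_. undefined)(0 := v)))"
proof -
  have "bij_betw (\<lambda>v. (\<lambda>_. undefined)(0 := v)) S ({0..0::nat} \<rightarrow>\<^sub>E S)"
  proof (rule bij_betw_byWitness[where f' = "\<lambda>\<pi>. \<pi> 0"])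
    show "\<forall>\<pi>\<in>{0..0::nat} \<rightarrow>\<^sub>E S. (\<lambda>_. undefined)(0 := \<pi> 0) = \<pi>"
      by (auto simp: fun_eq_iff PiE_iff extensional_def)
  qed (auto split: if_splits)
  then show ?thesis
    by (rule sum.reindex_bij_betw[symmetric])
qed

text \<open>The induction appends the last vertex of a path. Matrix indices start at 0 and vertices
  at 1, hence the successors.\<close>

lemma pow_mat_eq_sum_paths:
  fixes a :: "nat \<Rightarrow> nat \<Rightarrow> 'a::comm_semiring_1"
  assumes "x < n" "y < n"
  shows "(mat n n (\<lambda>(i, j). a (Suc i) (Suc j)) ^\<^sub>m h) $$ (x, y) =
    (\<Sum>\<pi>\<in>{0..h} \<rightarrow>\<^sub>E {1..n}. if \<pi> 0 = Suc x \<and> \<pi> h = Suc y then \<Prod>i\<in>{1..h}. a (\<pi> (i - 1)) (\<pi> i) else 0)"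
    (is "(?A ^\<^sub>m h) $$ _ = _")
  using assms(2)
proof (induction h arbitrary: y)
  case 0
  show ?case
    unfolding sum_PiE_0 using 0 assms(1) by (simp add: sum.delta' cong: if_cong)
next
  case (Suc h)
  define w where "w \<pi> = (\<Prod>i\<in>{1..h}. a (\<pi> (i - 1)) (\<pi> i))" for \<pi>
  have "(?A ^\<^sub>m Suc h) $$ (x, y) = (\<Sum>z<n. (?A ^\<^sub>m h) $$ (x, z) * a (Suc z) (Suc y))"
    using assms(1) Suc.prems by (simp add: scalar_prod_def lessThan_atLeast0)
  also have "\<dots> = (\<Sum>z<n. (\<Sum>\<pi>\<in>{0..h} \<rightarrow>\<^sub>E {1..n}. if \<pi> 0 = Suc x \<and> \<pi> h
      = Suc z then w \<pi> else 0) * a (Suc z) (Suc y))"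
    unfolding w_def using Suc.IH by (intro sum.cong refl) simp
  also have "\<dots> = (\<Sum>\<pi>\<in>{0..h} \<rightarrow>\<^sub>E {1..n}. \<Sum>z<n. if \<pi> h = Suc z then (if \<pi> 0
      = Suc x then w \<pi> * a (\<pi> h) (Suc y) else 0) else 0)"
    unfolding sum_distrib_right by (subst sum.swap) (auto intro!: sum.cong)
  also have "\<dots> = (\<Sum>\<pi>\<in>{0..h} \<rightarrow>\<^sub>E {1..n}. if \<pi> 0 = Suc x then w \<pi> * a (\<pi> h) (Suc y) else 0)"
  proof (intro sum.cong refl)
    fix \<pi> assume "\<pi> \<in> {0..h} \<rightarrow>\<^sub>E {1..n}"
    then have "\<pi> h \<in> {1..n}" by auto
    then obtain z where z: "\<pi> h = Suc z" "z < n" by (cases "\<pi> h") auto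
    show "(\<Sum>z<n. if \<pi> h = Suc z then (if \<pi> 0 = Suc x then w \<pi> * a (\<pi> h) (Suc y) else 0) else 0) =
      (if \<pi> 0 = Suc x then w \<pi> * a (\<pi> h) (Suc y) else 0)"
      using z by (simp add: sum.delta')
  qed
  also have "\<dots> = (\<Sum>\<pi>\<in>{0..h} \<rightarrow>\<^sub>E {1..n}. \<Sum>v\<in>{1..n}. if v = Suc y then (if \<pi> 0
      = Suc x then w \<pi> * a (\<pi> h) v else 0) else 0)"
    using Suc.prems by (simp add: sum.delta cong: if_cong)
  also have "\<dots> = (\<Sum>\<pi>\<in>{0..Suc h} \<rightarrow>\<^sub>E {1..n}. if \<pi> 0 = Suc x \<and> \<pi> (Suc h)
      = Suc y then \<Prod>i\<in>{1..Suc h}. a (\<pi> (i - 1)) (\<pi> i) else 0)"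
  proof -
    have "(\<Prod>i\<in>{1..h}. a ((\<pi>(Suc h := v)) (i - 1)) ((\<pi>(Suc h := v)) i)) = w \<pi>" for \<pi> v
      unfolding w_def by (intro prod.cong) auto
    then show ?thesis
      unfolding sum_PiE_Suc by (intro sum.cong refl) (auto simp: prod.atLeast_Suc_atMost_Suc_shift)
  qed
  finally show ?case .
qed

lemma finite_circuits [simp]: "finite (circuits n h)"
  unfolding circuits_def by (rule finite_subset[of _ "{0..h} \<rightarrow>\<^sub>E {1..n}"]) (auto intro!: finite_PiE)

lemma mtrace_pow_mat:
  fixes a :: "nat \<Rightarrow> nat \<Rightarrow> 'a::comm_semiring_1"
  shows "mtrace (mat n n (\<lambda>(i, j). a (Suc i) (Suc j)) ^\<^sub>m h) =
    (\<Sum>\<pi>\<in>circuits n h. \<Prod>i\<in>{1..h}. a (\<pi> (i - 1)) (\<pi> i))" (is "mtrace (?A ^\<^sub>m h) = _")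
proof -
  define w where "w \<pi> = (\<Prod>i\<in>{1..h}. a (\<pi> (i - 1)) (\<pi> i))" for \<pi>
  have "dim_row (?A ^\<^sub>m h) = n" by (metis carrier_matD(1) mat_carrier pow_carrier_mat)
  then have "mtrace (?A ^\<^sub>m h) = (\<Sum>x<n. \<Sum>\<pi>\<in>{0..h} \<rightarrow>\<^sub>E {1..n}. if \<pi> 0 = Suc x \<and> \<pi> h
      = Suc x then w \<pi> else 0)"
    unfolding mtrace_def w_def using pow_mat_eq_sum_paths by (auto intro!: sum.cong)
  also have "\<dots> = (\<Sum>\<pi>\<in>{0..h} \<rightarrow>\<^sub>E {1..n}. \<Sum>x<n. if \<pi> 0 = Suc x then (if \<pi> 0 = \<pi> h then w \<pi> else 0) else 0)"
    by (subst sum.swap) (auto intro!: sum.cong)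
  also have "\<dots> = (\<Sum>\<pi>\<in>{0..h} \<rightarrow>\<^sub>E {1..n}. if \<pi> 0 = \<pi> h then w \<pi> else 0)"
  proof (intro sum.cong refl)
    fix \<pi> assume "\<pi> \<in> {0..h} \<rightarrow>\<^sub>E {1..n}"
    then have "\<pi> 0 \<in> {1..n}" by auto
    then obtain z where "\<pi> 0 = Suc z" "z < n" by (cases "\<pi> 0") auto
    then show "(\<Sum>x<n. if \<pi> 0 = Suc x then (if \<pi> 0 = \<pi> h then w \<pi> else 0) else 0) = (if \<pi> 0
        = \<pi> h then w \<pi> else 0)"
      by (simp add: sum.delta')
  qed
  also have "\<dots> = (\<Sum>\<pi>\<in>circuits n h. w \<pi>)"
    unfolding circuits_def by (intro sum.inter_filter[symmetric] finite_PiE) auto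
  finally show ?thesis unfolding w_def .
qed

section \<open>Representatives of a residue class in an initial segment\<close>

definition lifts :: "nat \<Rightarrow> nat \<Rightarrow> int \<Rightarrow> nat set" where
  "lifts n m z = {v \<in> {1..n}. int v mod int m = z mod int m}"

lemma finite_lifts [simp]: "finite (lifts n m z)"
  by (simp add: lifts_def)

lemma le_zdiv_iff:
  assumes "(m :: int) > 0"
  shows "q \<le> a div m \<longleftrightarrow> q * m \<le> a"
proof
  assume "q \<le> a div m"
  then have "q * m \<le> a div m * m" using assms by (intro mult_right_mono) auto
  also have "\<dots> \<le> a" using assms pos_mod_sign[of m a] div_mult_mod_eq[of a m] by linarith
  finally show "q * m \<le> a" .
next
  assume "q * m \<le> a"
  then have "q * m div m \<le> a div m" using assms by (rule zdiv_mono1)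
  then show "q \<le> a div m" using assms by simp
qed

text \<open>The representatives are z + q m with 0 < z + q m \<le> n, and both inequalities
  translate into bounds on q by integer division.\<close>

lemma card_lifts:
  assumes "m > 0"
  shows "int (card (lifts n m z)) = (int n - z) div int m - (- z) div int m"
proof -
  have "bij_betw (\<lambda>q. nat (z + q * int m)) {(- z) div int m<..(int n - z) div int m} (lifts n m z)"
    unfolding bij_betw_def
  proof
    have lo: "(- z) div int m < q \<longleftrightarrow> 0 < z + q * int m" for q
    proof -
      have "q \<le> (- z) div int m \<longleftrightarrow> q * int m \<le> - z"
        using assms by (simp add: le_zdiv_iff)
      then show ?thesis by linarith
    qed
    have hi: "q \<le> (int n - z) div int m \<longleftrightarrow> z + q * int m \<le> int n" for q
    proof -
      have "q \<le> (int n - z) div int m \<longleftrightarrow> q * int m \<le> int n - z"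
        using assms by (simp add: le_zdiv_iff)
      then show ?thesis by linarith
    qed
    show "inj_on (\<lambda>q. nat (z + q * int m)) {(- z) div int m<..(int n - z) div int m}"
      using assms by (auto simp: inj_on_def lo eq_nat_nat_iff[OF less_imp_le less_imp_le])
    show "(\<lambda>q. nat (z + q * int m)) ` {(- z) div int m<..(int n - z) div int m} = lifts n m z"
    proof (intro equalityI subsetI)
      fix v assume "v \<in> (\<lambda>q. nat (z + q * int m)) ` {(- z) div int m<..(int n - z) div int m}"
      then obtain q where "v = nat (z + q * int m)" "0 < z + q * int m" "z + q * int m \<le> int n"
        by (auto simp: lo hi)
      then show "v \<in> lifts n m z" by (auto simp: lifts_def)
    next
      fix v assume v: "v \<in> lifts n m z"
      then have "int m dvd int v - z" by (auto simp: lifts_def mod_eq_dvd_iff)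
      then obtain q where "int v - z = int m * q" by (elim dvdE)
      then have q: "int v = z + q * int m" by (simp add: mult.commute)
      then have "v = nat (z + q * int m)" by (metis nat_int)
      moreover have "q \<in> {(- z) div int m<..(int n - z) div int m}"
        unfolding greaterThanAtMost_iff lo hi q[symmetric] using v by (auto simp: lifts_def)
      ultimately show "v \<in> (\<lambda>q. nat (z + q * int m)) ` {(- z) div int m<..(int n - z) div int m}"
        by blast
    qed
  qed
  then have "card (lifts n m z) = nat ((int n - z) div int m - (- z) div int m)"
    by (metis bij_betw_same_card card_greaterThanAtMost_int)
  moreover have "(- z) div int m \<le> (int n - z) div int m"
    using assms by (intro zdiv_mono1) auto
  ultimately show ?thesis by simp
qed

text \<open>In this form the count depends on \<open>n\<close> and \<open>z\<close> only through n /
  m and z / m. These ratios will converge, and the floor is locally constant away from the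
  integers.\<close>

lemma card_lifts_floor:
  assumes "m > 0"
  shows "real (card (lifts n m z)) =
    of_int \<lfloor>real n / real m - of_int z / real m\<rfloor> - of_int \<lfloor>- (of_int z / real m)\<rfloor>"
proof -
  have "real (card (lifts n m z)) = of_int (int (card (lifts n m z)))" by simp
  also have "\<dots> = of_int \<lfloor>of_int (int n - z) / (of_int (int m) :: real)\<rfloor> - of_int \<lfloor>of_int (- z) /
      (of_int (int m) :: real)\<rfloor>"
    unfolding card_lifts[OF assms] floor_divide_of_int_eq by simp
  finally show ?thesis by (simp add: diff_divide_distrib)
qed

lemma card_lifts_le:
  assumes "m > 0"
  shows "real (card (lifts n m z)) \<le> real n / real m + 1"
  unfolding card_lifts_floor[OF assms] by linarith

section \<open>The modulus and its ratio to the matrix size\<close>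

definition modulus :: "real \<Rightarrow> nat \<Rightarrow> nat" where
  "modulus \<theta> n = nat \<lfloor>real n / \<theta>\<rfloor>"

lemma link_eq: "link \<theta> n i j = (i + j) mod modulus \<theta> n"
  by (simp add: link_def modulus_def)

lemma link_eq_iff:
  "link \<theta> n i j = link \<theta> n i' j' \<longleftrightarrow> int j mod modulus \<theta> n = (int i' + int j' - int i) mod modulus \<theta> n"
proof -
  have "link \<theta> n i j = link \<theta> n i' j' \<longleftrightarrow> (int i + int j) mod modulus \<theta> n
      = (int i' + int j') mod modulus \<theta> n"
    unfolding link_eq by (metis of_nat_add of_nat_eq_iff zmod_int)
  also have "\<dots> \<longleftrightarrow> int j mod modulus \<theta> n = (int i' + int j' - int i) mod modulus \<theta> n"
    by (simp add: mod_eq_dvd_iff algebra_simps)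
  finally show ?thesis .
qed

lemma real_modulus:
  assumes "\<theta> > 0"
  shows "real n / \<theta> - 1 \<le> real (modulus \<theta> n)" "real (modulus \<theta> n) \<le> real n / \<theta>"
proof -
  have "real n / \<theta> \<ge> 0" using assms by simp
  then have "real (modulus \<theta> n) = of_int \<lfloor>real n / \<theta>\<rfloor>"
    by (simp add: modulus_def)
  then show "real n / \<theta> - 1 \<le> real (modulus \<theta> n)" "real (modulus \<theta> n) \<le> real n / \<theta>"
    by linarith+
qed

text \<open>Rounding down makes the modulus at most n / \<theta>, which is the source of the gain
  \<theta>. Once n \<ge> 2 \<theta>, the loss of 1 in rounding costs at most half of n / \<theta>;
  this gives the constant 2 \<theta> used for domination.\<close>

lemma eventually_modulus:
  assumes "\<theta> > 0"
  shows "eventually (\<lambda>n. modulus \<theta> n > 0 \<and> \<theta> \<le> real n / real (modulus \<theta> n) \<and>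
    real n / real (modulus \<theta> n) \<le> real n / (real n / \<theta> - 1) \<and> real n / real (modulus \<theta> n)
        \<le> 2 * \<theta>) sequentially"
  using eventually_ge_at_top[of "nat \<lceil>2 * \<theta>\<rceil>"] eventually_gt_at_top[of 0]
proof eventually_elim
  case (elim n)
  let ?m = "modulus \<theta> n"
  have "real n \<ge> 2 * \<theta>" using elim by linarith
  then have *: "real n / \<theta> \<ge> 2" using assms by (simp add: field_simps)
  note m = real_modulus[OF assms, of n]
  have "?m > 0" using m * by linarith
  moreover have "\<theta> \<le> real n / real ?m"
    using m assms \<open>?m > 0\<close> by (simp add: field_simps)
  moreover have "real n / real ?m \<le> real n / (real n / \<theta> - 1)"
    using m * \<open>?m > 0\<close> by (intro divide_left_mono) auto
  moreover have "real n / (real n / \<theta> - 1) \<le> 2 * \<theta>"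
    using * assms by (simp add: field_simps)
  ultimately show ?case by auto
qed

lemma modulus_ratio:
  assumes "\<theta> > 0"
  shows "(\<lambda>n. real n / real (modulus \<theta> n)) \<longlonglongrightarrow> \<theta>"
proof (rule tendsto_sandwich)
  show "(\<lambda>n. \<theta>) \<longlonglongrightarrow> \<theta>" by simp
  show "(\<lambda>n. real n / (real n / \<theta> - 1)) \<longlonglongrightarrow> \<theta>"
    using assms by real_asymp
qed (use eventually_modulus[OF assms] in \<open>auto elim: eventually_mono\<close>)

text \<open>Every edge either creates a new link value, leaving all \<open>n\<close> choices for its endpoint, or
  repeats an old one, leaving boundedly many.\<close>

lemma card_paths_distinct_links:
  fixes h n B :: nat
  assumes B: "\<And>z. card (lifts n (modulus \<theta> n) z) \<le> B"
  shows "card {\<pi> \<in> {0..h} \<rightarrow>\<^sub>E {1..n}. card ((\<lambda>i. link \<theta> n (\<pi> (i - 1)) (\<pi> i)) ` {1..h}) = d}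
    \<le> (1 + h * B) ^ h * n ^ (d + 1)"
proof -
  define V where "V h \<pi> = (\<lambda>i. link \<theta> n (\<pi> (i - 1)) (\<pi> i)) ` {1..h}" for h :: nat and \<pi>
  define N where "N h d = (\<Sum>\<pi>\<in>{0..h} \<rightarrow>\<^sub>E {1..n}. if card (V h \<pi>) = d then 1 else 0 :: nat)" for h d
  have N: "N h d = card {\<pi> \<in> {0..h} \<rightarrow>\<^sub>E {1..n}. card (V h \<pi>) = d}" for h d
    unfolding N_def by (subst sum.inter_filter[symmetric]) (auto intro: finite_PiE)
  have V_upd: "V (Suc h) (\<pi>(Suc h := v)) = insert (link \<theta> n (\<pi> h) v) (V h \<pi>)" for h \<pi> v
  proof -
    have "{1..Suc h} = insert (Suc h) {1..h}" by auto
    then have "V (Suc h) (\<pi>(Suc h := v)) = insert (link \<theta> n (\<pi> h) v) ((\<lambda>i. link \<theta> n ((\<pi>(Suc h := v))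
        (i - 1)) ((\<pi>(Suc h := v)) i)) ` {1..h})"
      unfolding V_def by simp
    also have "(\<lambda>i. link \<theta> n ((\<pi>(Suc h := v)) (i - 1)) ((\<pi>(Suc h := v)) i)) ` {1..h} = V h \<pi>"
      unfolding V_def by (intro image_cong) auto
    finally show ?thesis .
  qed
  \<comment> \<open>For each of the \<open>h\<close> edges of the path, the endpoints that repeat
    its link value form a single set of lifts.\<close>
  have old: "card {v \<in> {1..n}. link \<theta> n u v \<in> V h \<pi>} \<le> h * B" for u h \<pi>
  proof -
    have "{v \<in> {1..n}. link \<theta> n u v \<in> V h \<pi>}
        \<subseteq> (\<Union>i\<in>{1..h}. lifts n (modulus \<theta> n) (int (\<pi> (i - 1)) + int (\<pi> i) - int u))"
      by (auto simp: V_def lifts_def link_eq_iff)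
    then have "card {v \<in> {1..n}. link \<theta> n u v \<in> V h \<pi>}
        \<le> card (\<Union>i\<in>{1..h}. lifts n (modulus \<theta> n) (int (\<pi> (i - 1)) + int (\<pi> i) - int u))"
      by (intro card_mono) auto
    also have "\<dots> \<le> (\<Sum>i\<in>{1..h}. card (lifts n (modulus \<theta> n) (int (\<pi> (i - 1)) + int (\<pi> i) - int u)))"
      by (rule card_UN_le) simp
    also have "\<dots> \<le> (\<Sum>i\<in>{1..h}. B)"
      by (intro sum_mono B)
    finally show ?thesis by simp
  qed
  have step: "N (Suc h) d \<le> N h d * (h * B) + (if d = 0 then 0 else N h (d - 1) * n)" for h d
  proof -
    have "N (Suc h) d = (\<Sum>\<pi>\<in>{0..h} \<rightarrow>\<^sub>E {1..n}. card {v \<in> {1..n}. card (insert (link \<theta> n (\<pi> h) v) (V h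
        \<pi>)) = d})"
      unfolding N_def sum_PiE_Suc V_upd by (subst sum.inter_filter[symmetric]) auto
    also have "\<dots> \<le> (\<Sum>\<pi>\<in>{0..h} \<rightarrow>\<^sub>E {1..n}. (if card (V h \<pi>)
        = d then h * B else 0) + (if Suc (card (V h \<pi>)) = d then n else 0))"
    proof (rule sum_mono)
      fix \<pi>
      let ?S = "V h \<pi>"
      let ?X = "{v \<in> {1..n}. card (insert (link \<theta> n (\<pi> h) v) ?S) = d}"
      let ?O = "if card ?S = d then {v \<in> {1..n}. link \<theta> n (\<pi> h) v \<in> ?S} else {}"
      let ?N = "if Suc (card ?S) = d then {1..n} else {}"
      have "finite ?S" by (simp add: V_def)
      then have "?X \<subseteq> ?O \<union> ?N"
        by (auto simp: card_insert_if split: if_splits)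
      then have "card ?X \<le> card (?O \<union> ?N)"
        by (rule card_mono[rotated]) auto
      also have "\<dots> \<le> card ?O + card ?N"
        by (rule card_Un_le)
      also have "\<dots> \<le> (if card ?S = d then h * B else 0) + (if Suc (card ?S) = d then n else 0)"
        using old[of "\<pi> h" h \<pi>] by auto
      finally show "card ?X \<le> (if card ?S = d then h * B else 0) + (if Suc (card ?S)
          = d then n else 0)" .
    qed
    also have "\<dots> = N h d * (h * B) + (if d = 0 then 0 else N h (d - 1) * n)"
      unfolding N_def sum.distrib sum_distrib_right
          by (intro arg_cong2[of _ _ _ _ "(+)"]) (auto intro!: sum.cong)
    finally show ?thesis .
  qed
  \<comment> \<open>Bounding the number of old edges by the final \<open>h\<close> makes the
    constant uniform in \<open>i\<close>: with K = 1 + h B, the recursion gives K^i h B + K^i =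
    K^(i+1).\<close>
  have "N i d \<le> (1 + h * B) ^ i * n ^ (d + 1)" if "i \<le> h" for i d
    using that
  proof (induction i arbitrary: d)
    case 0
    have "N 0 d \<le> (\<Sum>\<pi>\<in>{0..0::nat} \<rightarrow>\<^sub>E {1..n}. if d = 0 then 1 else 0)"
      unfolding N_def by (intro sum_mono) (auto simp: V_def)
    also have "\<dots> \<le> n ^ (d + 1)"
      by (auto simp: card_PiE)
    finally show ?case by simp
  next
    case (Suc i)
    let ?K = "1 + h * B"
    have "N (Suc i) d \<le> N i d * (i * B) + (if d = 0 then 0 else N i (d - 1) * n)"
      by (rule step)
    also have "\<dots> \<le> (?K ^ i * n ^ (d + 1)) * (h * B) + ?K ^ i * n ^ (d + 1)"
    proof (rule add_mono)
      show "N i d * (i * B) \<le> (?K ^ i * n ^ (d + 1)) * (h * B)"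
        using Suc by (intro mult_mono) auto
      show "(if d = 0 then 0 else N i (d - 1) * n) \<le> ?K ^ i * n ^ (d + 1)"
      proof (cases d)
        case (Suc d')
        have "N i d' * n \<le> ?K ^ i * n ^ (d' + 1) * n"
          using Suc.IH[of d'] Suc.prems by (intro mult_mono) auto
        then show ?thesis using Suc by (simp add: algebra_simps)
      qed auto
    qed
    also have "\<dots> = ?K ^ Suc i * n ^ (d + 1)"
      by (simp add: algebra_simps)
    finally show ?case .
  qed
  then have "N h d \<le> (1 + h * B) ^ h * n ^ (d + 1)" by simp
  then show ?thesis unfolding N V_def .
qed

subsection \<open>Existence of word limits\<close>

text \<open>Only the vertices in \<open>G\<close> of a constrained circuit are free: the link equation between the
  edges \<open>p i\<close> and \<open>i\<close> determines vertex \<open>i\<close> modulo the modulus, as the integer combination of the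
  free vertices with coefficients \<open>coef G p i\<close>.\<close>

function coef :: "nat set \<Rightarrow> (nat \<Rightarrow> nat) \<Rightarrow> nat \<Rightarrow> nat \<Rightarrow> int" where
  "coef G p i g = (if i \<in> G \<or> \<not> (0 < p i \<and> p i < i) then (if g = i then 1 else 0)
    else coef G p (p i - 1) g + coef G p (p i) g - coef G p (i - 1) g)"
  by auto
termination by (relation "Wellfounded.measure (\<lambda>(G, p, i, g). i)") auto

declare coef.simps [simp del]

text \<open>Edge \<open>i\<close> runs from vertex \<open>i - 1\<close> to vertex \<open>i\<close>,
  so edges are numbered from 1. For a vertex outside \<open>G\<close>, \<open>p i\<close> is an
  earlier edge that edge \<open>i\<close> has to match; its bounds make the second case of
  \<open>coef\<close> apply. The last vertex \<open>h\<close> is never free, which is what produces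
  a closing condition.\<close>

locale link_pattern =
  fixes G :: "nat set" and p :: "nat \<Rightarrow> nat" and h :: nat
  assumes G: "G \<subseteq> {0..<h}" "0 \<in> G"
    and p: "\<And>i. i \<in> {1..h} - G \<Longrightarrow> 0 < p i \<and> p i < i"
begin

lemma finite_G [simp]: "finite G"
  using G(1) finite_subset by blast

lemma h_pos: "0 < h"
  using G by auto

lemma coef_free: "i \<in> G \<Longrightarrow> coef G p i g = (if g = i then 1 else 0)"
  by (simp add: coef.simps)

lemma coef_bound: "i \<in> {1..h} - G \<Longrightarrow>
    coef G p i g = coef G p (p i - 1) g + coef G p (p i) g - coef G p (i - 1) g"
  using p[of i] by (subst coef.simps) auto

text \<open>The form is polymorphic because it is evaluated at integer vertices, in congruences, and
  at real points of the unit cube, in the limit.\<close>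

definition lin :: "nat \<Rightarrow> (nat \<Rightarrow> 'a::ring_1) \<Rightarrow> 'a" where
  "lin i x = (\<Sum>g\<in>G. of_int (coef G p i g) * x g)"

lemma lin_free:
  assumes "i \<in> G"
  shows "lin i x = x i"
proof -
  have "lin i x = (\<Sum>g\<in>G. if g = i then x g else 0)"
    unfolding lin_def by (intro sum.cong) (auto simp: coef_free[OF assms])
  then show ?thesis using assms by simp
qed

lemma lin_bound: "i \<in> {1..h} - G \<Longrightarrow> lin i x = lin (p i - 1) x + lin (p i) x - lin (i - 1) x"
  unfolding lin_def by (simp add: coef_bound algebra_simps sum.distrib sum_subtractf)

lemma induct_vertex [consumes 1, case_names free bound]:
  assumes "i \<le> h" "\<And>i. i \<in> G \<Longrightarrow> P i"
    and "\<And>i. i \<in> {1..h} - G \<Longrightarrow> P (p i - 1) \<Longrightarrow> P (p i) \<Longrightarrow> P (i - 1) \<Longrightarrow> P i"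
  shows "P i"
  using assms(1)
proof (induction i rule: less_induct)
  case (less i)
  show ?case
  proof (cases "i \<in> G")
    case False
    then have i: "i \<in> {1..h} - G" using G(2) less.prems by (cases i) auto
    have "p i - 1 < i" "p i < i" "i - 1 < i" using p[OF i] by auto
    then show ?thesis using less.prems by (intro assms(3)[OF i] less.IH) auto
  qed (rule assms(2))
qed

text \<open>Alternating signs solve every link equation, so none of the linear forms vanishes.\<close>

lemma lin_alternating: "i \<le> h \<Longrightarrow> lin i (\<lambda>g. (- 1) ^ g :: int) = (- 1) ^ i"
proof (induction rule: induct_vertex)
  case (bound i)
  then obtain j where j: "p i = Suc j" using p[of i] by (cases "p i") auto
  obtain i' where i': "i = Suc i'" using bound by (cases i) auto
  have *: "p i - 1 = j" "i - 1 = i'" using j i' by auto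
  show ?case unfolding lin_bound[OF bound(1)] bound(2-4) unfolding * j by (simp add: i')
qed (simp add: lin_free)

lemma coef_nonzero: "i \<le> h \<Longrightarrow> \<exists>g\<in>G. coef G p i g \<noteq> 0"
  using lin_alternating[of i] by (auto simp: lin_def intro: ccontr)

definition constrained :: "real \<Rightarrow> nat \<Rightarrow> (nat \<Rightarrow> nat) set" where
  "constrained \<theta> n = {\<pi> \<in> circuits n h. \<forall>i\<in>{1..h} - G.
    link \<theta> n (\<pi> (i - 1)) (\<pi> i) = link \<theta> n (\<pi> (p i - 1)) (\<pi> (p i))}"

text \<open>Each link equation expresses a vertex modulo m by earlier ones, and the linear forms
  satisfy the same recursion exactly. Unwinding by induction along the vertices gives one direction;
  substituting the forms back gives the other.\<close>

lemma constrained_iff: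
  assumes "\<pi> \<in> circuits n h"
  shows "\<pi> \<in> constrained \<theta> n \<longleftrightarrow>
    (\<forall>i\<in>{1..h} - G. \<pi> i \<in> lifts n (modulus \<theta> n) (lin i (\<lambda>g. int (\<pi> g))))" (is "_ \<longleftrightarrow> ?R")
proof -
  let ?m = "int (modulus \<theta> n)" and ?l = "\<lambda>i. lin i (\<lambda>g. int (\<pi> g))"
  have lifts: "\<pi> i \<in> lifts n (modulus \<theta> n) (?l i) \<longleftrightarrow> [int (\<pi> i) = ?l i] (mod ?m)" if "i \<le> h" for i
    using that assms by (auto simp: lifts_def cong_def circuits_def PiE_iff)
  have eq: "link \<theta> n (\<pi> (i - 1)) (\<pi> i) = link \<theta> n (\<pi> (p i - 1)) (\<pi> (p i)) \<longleftrightarrow>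
      [int (\<pi> i) = int (\<pi> (p i - 1)) + int (\<pi> (p i)) - int (\<pi> (i - 1))] (mod ?m)" for i
    by (simp add: link_eq_iff cong_def)
  show ?thesis
  proof
    assume "\<pi> \<in> constrained \<theta> n"
    then have c: "[int (\<pi> i) = int (\<pi> (p i - 1))
        + int (\<pi> (p i)) - int (\<pi> (i - 1))] (mod ?m)" if "i \<in> {1..h} - G" for i
      using that unfolding eq[symmetric] by (auto simp: constrained_def)
    have "[int (\<pi> i) = ?l i] (mod ?m)" if "i \<le> h" for i
      using that
    proof (induction rule: induct_vertex)
      case (bound i)
      show ?case
        unfolding lin_bound[OF bound(1)]
            by (rule cong_trans[OF c[OF bound(1)]]) (intro cong_add cong_diff bound)
    qed (simp add: lin_free)
    then show ?R using lifts by auto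
  next
    assume R: ?R
    have l: "[int (\<pi> i) = ?l i] (mod ?m)" if "i \<le> h" for i
    proof (cases "i \<in> G")
      case False
      then show ?thesis using R G(2) that lifts[of i] by (cases i) auto
    qed (simp add: lin_free)
    have "[int (\<pi> i) = int (\<pi> (p i - 1))
        + int (\<pi> (p i)) - int (\<pi> (i - 1))] (mod ?m)" if i: "i \<in> {1..h} - G" for i
    proof -
      have "[?l (p i - 1) + ?l (p i) - ?l (i - 1)
          = int (\<pi> (p i - 1)) + int (\<pi> (p i)) - int (\<pi> (i - 1))] (mod ?m)"
        using p[OF i] i by (intro cong_add cong_diff cong_sym[OF l]) auto
      with l[of i] i show ?thesis unfolding lin_bound[OF i] by (auto intro: cong_trans)
    qed
    then show "\<pi> \<in> constrained \<theta> n" using assms unfolding eq[symmetric] by (auto simp: constrained_def)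
  qed
qed

lemma lin_cong: "(\<And>g. g \<in> G \<Longrightarrow> x g = y g) \<Longrightarrow> lin i x = lin i y"
  unfolding lin_def by (intro sum.cong) auto

text \<open>Given the free vertices, the bound vertices before \<open>h\<close> are chosen
  independently among their lifts. Vertex \<open>h\<close> must equal vertex 0, so it offers no
  choice and leaves a congruence on the free vertices instead.\<close>

lemma card_constrained:
  "card (constrained \<theta> n) = (\<Sum>x\<in>G \<rightarrow>\<^sub>E {1..n}.
    if [lin h (\<lambda>g. int (x g)) = int (x 0)] (mod int (modulus \<theta> n))
    then \<Prod>i\<in>{1..<h} - G. card (lifts n (modulus \<theta> n) (lin i (\<lambda>g. int (x g)))) else 0)"
proof -
  let ?m = "modulus \<theta> n"
  let ?l = "\<lambda>i x. lin i (\<lambda>g. int (x g))"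
  let ?H = "{1..<h} - G"
  let ?cut = "\<lambda>\<pi>. (restrict \<pi> G, restrict \<pi> ?H)"
  let ?glue = "\<lambda>(x, y) i. if i \<in> G then x i else if i = h then x 0 else y i"
  define F where "F x = (if [?l h x = int (x 0)] (mod int ?m)
    then Pi\<^sub>E ?H (\<lambda>i. lifts n ?m (?l i x)) else {})" for x
  have iH: "{0..h} = G \<union> ?H \<union> {h}" using G by (auto simp: Suc_le_eq)
  have hG: "h \<notin> G" using G by auto
  have "bij_betw ?cut (constrained \<theta> n) (Sigma (G \<rightarrow>\<^sub>E {1..n}) F)"
  proof (rule bij_betw_byWitness[where f' = ?glue])
    show "\<forall>\<pi>\<in>constrained \<theta> n. ?glue (restrict \<pi> G, restrict \<pi> ?H) = \<pi>"
    proof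
      fix \<pi> assume "\<pi> \<in> constrained \<theta> n"
      then have "\<pi> \<in> {0..h} \<rightarrow>\<^sub>E {1..n}" "\<pi> 0 = \<pi> h" by (auto simp: constrained_def circuits_def)
      then show "?glue (restrict \<pi> G, restrict \<pi> ?H) = \<pi>"
        using G(2) hG iH by (auto simp: fun_eq_iff PiE_iff extensional_def)
    qed
    show "\<forall>a\<in>Sigma (G \<rightarrow>\<^sub>E {1..n}) F. ?cut (?glue a) = a"
      using hG by (auto simp: F_def fun_eq_iff PiE_iff extensional_def split: if_splits)
    show "?cut ` constrained \<theta> n \<subseteq> Sigma (G \<rightarrow>\<^sub>E {1..n}) F"
    proof (intro subsetI)
      fix a assume "a \<in> ?cut ` constrained \<theta> n"
      then obtain \<pi> where \<pi>: "\<pi> \<in> constrained \<theta> n" and a: "a = (restrict \<pi> G, restrict \<pi> ?H)" by auto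
      have c: "\<pi> \<in> circuits n h" using \<pi> by (auto simp: constrained_def)
      have l: "?l i (restrict \<pi> G) = ?l i \<pi>" for i by (rule lin_cong) auto
      have L: "\<pi> i \<in> lifts n ?m (?l i \<pi>)" if "i \<in> {1..h} - G" for i
        using \<pi> that unfolding constrained_iff[OF c] by auto
      have "[?l h \<pi> = int (\<pi> 0)] (mod int ?m)"
        using L[of h] h_pos hG c by (auto simp: lifts_def cong_def circuits_def)
      moreover have "restrict \<pi> ?H \<in> Pi\<^sub>E ?H (\<lambda>i. lifts n ?m (?l i \<pi>))"
        using L by auto
      moreover have "restrict \<pi> G \<in> G \<rightarrow>\<^sub>E {1..n}"
        using c iH by (auto simp: circuits_def PiE_iff)
      ultimately show "a \<in> Sigma (G \<rightarrow>\<^sub>E {1..n}) F"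
        using G(2) unfolding a mem_Sigma_iff F_def l by simp
    qed
    show "?glue ` Sigma (G \<rightarrow>\<^sub>E {1..n}) F \<subseteq> constrained \<theta> n"
    proof clarify
      fix x y assume x: "x \<in> G \<rightarrow>\<^sub>E {1..n}" and y: "y \<in> F x"
      let ?\<pi> = "\<lambda>i. if i \<in> G then x i else if i = h then x 0 else y i"
      have y: "y \<in> Pi\<^sub>E ?H (\<lambda>i. lifts n ?m (?l i x))" and closed: "[?l h x = int (x 0)] (mod int ?m)"
        using y by (auto simp: F_def split: if_splits)
      have y': "y i \<in> lifts n ?m (?l i x)" if "i \<in> ?H" for i using y that by auto
      have y'': "y i = undefined" if "i \<notin> ?H" for i using y that by (auto simp: PiE_iff extensional_def)
      have l: "?l i ?\<pi> = ?l i x" for i by (rule lin_cong) auto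
      have c: "?\<pi> \<in> circuits n h"
        unfolding circuits_def
      proof (intro CollectI conjI PiE_I)
        fix i assume "i \<in> {0..h}"
        then show "?\<pi> i \<in> {1..n}"
          using x G(2) y'[of i] iH by (auto simp: lifts_def)
      next
        fix i assume "i \<notin> {0..h}"
        then show "?\<pi> i = undefined" using G(1) y''[of i] by auto
      qed (use G(2) hG in auto)
      have x0: "x 0 \<in> {1..n}" using x G(2) by auto
      show "?\<pi> \<in> constrained \<theta> n"
        unfolding constrained_iff[OF c] l
      proof
        fix i assume i: "i \<in> {1..h} - G"
        show "?\<pi> i \<in> lifts n ?m (?l i x)"
        proof (cases "i = h")
          case True
          then show ?thesis using closed hG x0 by (auto simp: lifts_def cong_def)
        next
          case False
          then have "i \<in> ?H" using i by auto
          with y'[OF this] False i show ?thesis by auto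
        qed
      qed
    qed
  qed
  then have "card (constrained \<theta> n) = card (Sigma (G \<rightarrow>\<^sub>E {1..n}) F)"
    by (rule bij_betw_same_card)
  also have "\<dots> = (\<Sum>x\<in>G \<rightarrow>\<^sub>E {1..n}. card (F x))"
    by (intro card_SigmaI ballI finite_PiE) (auto simp: F_def intro!: finite_PiE)
  also have "\<dots> = (\<Sum>x\<in>G \<rightarrow>\<^sub>E {1..n}.
    if [?l h x = int (x 0)] (mod int ?m) then \<Prod>i\<in>?H. card (lifts n ?m (?l i x)) else 0)"
    by (intro sum.cong refl) (simp add: F_def card_PiE)
  finally show ?thesis .
qed

end

section \<open>Independent uniform free vertices\<close>

definition unif :: "real measure" where
  "unif = uniform_measure lborel {0<..1}"

lemma sets_unif [measurable_cong, simp]: "sets unif = sets borel"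
  by (simp add: unif_def)

lemma space_unif [simp]: "space unif = UNIV"
  by (simp add: unif_def)

lemma prob_space_unif: "prob_space unif"
  unfolding unif_def by (rule prob_space_uniform_measure) auto

lemma measure_unif:
  assumes "0 \<le> a" "a \<le> b" "b \<le> 1"
  shows "measure unif {a<..b} = b - a"
proof -
  have "{0<..1} \<inter> {a<..b} = {a<..b}" using assms by auto
  then have "emeasure unif {a<..b} = ennreal (b - a)"
    unfolding unif_def using assms by (subst emeasure_uniform_measure) (auto simp: divide_ennreal_def)
  then show ?thesis using assms by (simp add: measure_def)
qed

lemma AE_unif: "AE u in unif. 0 < u \<and> u \<le> 1"
  unfolding unif_def by (rule AE_uniform_measureI) auto

lemma emeasure_unif_singleton: "emeasure unif {s} = 0"
proof -
  have "emeasure unif {s} = emeasure lborel ({0<..1} \<inter> {s}) / emeasure lborel {0<..1::real}"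
    unfolding unif_def by (subst emeasure_uniform_measure) auto
  also have "emeasure lborel ({0<..1} \<inter> {s}) = 0"
    by (rule emeasure_lborel_countable) auto
  finally show ?thesis by simp
qed

context
  fixes G :: "nat set"
  assumes finite_G: "finite G"
begin

interpretation unif: prob_space unif by (rule prob_space_unif)
interpretation U: product_prob_space "\<lambda>_::nat. unif" G ..
interpretation U: finite_product_prob_space "\<lambda>_::nat. unif" G
  by standard (rule finite_G)

text \<open>By Fubini, integrate over the coordinate \<open>g\<close> last in the nesting order,
  that is innermost: with the others fixed, the equation excludes a single value of it, and points
  are null.\<close>

lemma AE_linear_form_neq:
  assumes "g \<in> G" "c g \<noteq> 0"
  shows "AE u in PiM G (\<lambda>_. unif). (\<Sum>i\<in>G. c i * u i) \<noteq> s"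
proof -
  define H where "H = G - {g}"
  have G: "G = insert g H" and H: "g \<notin> H" "finite H" using assms finite_G by (auto simp: H_def)
  let ?S = "{u \<in> space (PiM G (\<lambda>_. unif)). (\<Sum>i\<in>G. c i * u i) = s}"
  have m: "?S \<in> sets (PiM G (\<lambda>_. unif))" by measurable
  have "emeasure (PiM G (\<lambda>_. unif)) ?S = (\<integral>\<^sup>+u. indicator ?S u \<partial>PiM G (\<lambda>_. unif))"
    using m by simp
  also have "\<dots> = (\<integral>\<^sup>+u. (\<integral>\<^sup>+y. indicator ?S (u(g := y)) \<partial>unif) \<partial>PiM H (\<lambda>_. unif))"
    unfolding G by (rule U.product_nn_integral_insert) (use H m G in auto)
  also have "\<dots> = (\<integral>\<^sup>+u. 0 \<partial>PiM H (\<lambda>_. unif))"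
  proof (rule nn_integral_cong)
    fix u assume "u \<in> space (PiM H (\<lambda>_. unif))"
    let ?t = "(s - (\<Sum>i\<in>H. c i * u i)) / c g"
    have "(\<integral>\<^sup>+y. indicator ?S (u(g := y)) \<partial>unif) \<le> (\<integral>\<^sup>+y. indicator {?t} y \<partial>unif)"
    proof (rule nn_integral_mono)
      fix y
      have "(\<Sum>i\<in>H. c i * (u(g := y)) i) = (\<Sum>i\<in>H. c i * u i)"
        using H by (intro sum.cong) auto
      then have "(\<Sum>i\<in>G. c i * (u(g := y)) i) = c g * y + (\<Sum>i\<in>H. c i * u i)"
        unfolding G using H by simp
      then show "indicator ?S (u(g := y)) \<le> (indicator {?t} y :: ennreal)"
        using assms(2) by (auto simp: indicator_def field_simps)
    qed
    also have "\<dots> = 0" by (simp add: emeasure_unif_singleton)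
    finally show "(\<integral>\<^sup>+y. indicator ?S (u(g := y)) \<partial>unif) = 0" by simp
  qed
  finally have "emeasure (PiM G (\<lambda>_. unif)) ?S = 0" by simp
  then show ?thesis
    using m by (intro AE_I[of _ _ ?S]) auto
qed

lemma AE_component_unif: "AE u in PiM G (\<lambda>_. unif). \<forall>g\<in>G. 0 < u g \<and> u g \<le> 1"
proof (rule AE_finite_allI[OF finite_G])
  fix g assume g: "g \<in> G"
  show "AE u in PiM G (\<lambda>_. unif). 0 < u g \<and> u g \<le> 1"
    using AE_PiM_component[of G "\<lambda>_. unif" g "\<lambda>y. 0 < y \<and> y \<le> 1", OF prob_space_unif g AE_unif] by simp
qed

text \<open>The half-open interval (0, 1] is chosen so that the ceilings of n u are independent and
  uniform on 1, ..., n. The cells \<open>Q x\<close> on which they equal \<open>x\<close> are boxes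
  of volume n^(- card G), and they partition the cube up to a null set.\<close>

lemma integral_ceiling_unif:
  fixes \<Phi> :: "(nat \<Rightarrow> int) \<Rightarrow> real"
  assumes n: "n > 0" and \<Phi>: "\<And>x y. (\<And>g. g \<in> G \<Longrightarrow> x g = y g) \<Longrightarrow> \<Phi> x = \<Phi> y"
  shows "has_bochner_integral (PiM G (\<lambda>_. unif)) (\<lambda>u. \<Phi> (\<lambda>g. \<lceil>real n * u g\<rceil>))
    ((\<Sum>x\<in>G \<rightarrow>\<^sub>E {1..n}. \<Phi> (\<lambda>g. int (x g))) / real n ^ card G)"
proof -
  define Q where "Q x = (\<Pi>\<^sub>E g\<in>G. {(real (x g) - 1) / n <.. real (x g) / n})" for x :: "nat \<Rightarrow> nat"
  have Q [measurable]: "Q x \<in> sets (PiM G (\<lambda>_. unif))" for x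
    unfolding Q_def by (intro sets_PiM_I_finite finite_G) auto
  have meas: "measure (PiM G (\<lambda>_. unif)) (Q x) = 1 / real n ^ card G" if "x \<in> G \<rightarrow>\<^sub>E {1..n}" for x
  proof -
    have "measure (PiM G (\<lambda>_. unif)) (Q x)
        = (\<Prod>g\<in>G. measure unif {(real (x g) - 1) / n <.. real (x g) / n})"
      unfolding Q_def by (rule U.prob_times) auto
    also have "\<dots> = (\<Prod>g\<in>G. 1 / real n)"
    proof (rule prod.cong)
      fix g assume "g \<in> G"
      then have "x g \<in> {1..n}" using that by auto
      then show "measure unif {(real (x g) - 1) / n <.. real (x g) / n} = 1 / real n"
        using n by (subst measure_unif) (auto simp: field_simps)
    qed simp
    finally show ?thesis by (simp add: power_one_over)
  qed
  have fin: "finite (G \<rightarrow>\<^sub>E {1..n})" by (intro finite_PiE finite_G) auto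
  have "has_bochner_integral (PiM G (\<lambda>_. unif)) (\<lambda>u. \<Sum>x\<in>G \<rightarrow>\<^sub>E {1..n}. \<Phi> (\<lambda>g. int (x g)) * indicator (Q
      x) u)
    (\<Sum>x\<in>G \<rightarrow>\<^sub>E {1..n}. \<Phi> (\<lambda>g. int (x g)) * measure (PiM G (\<lambda>_. unif)) (Q x))"
    by (intro has_bochner_integral_sum has_bochner_integral_mult_right
        has_bochner_integral_real_indicator Q U.emeasure_finite)
       (auto simp: U.P.emeasure_eq_measure less_top[symmetric])
  also have "(\<Sum>x\<in>G \<rightarrow>\<^sub>E {1..n}. \<Phi> (\<lambda>g. int (x g)) * measure (PiM G (\<lambda>_. unif)) (Q x)) =
      (\<Sum>x\<in>G \<rightarrow>\<^sub>E {1..n}. \<Phi> (\<lambda>g. int (x g))) / real n ^ card G"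
    using meas by (simp add: sum_divide_distrib)
  finally have int: "has_bochner_integral (PiM G (\<lambda>_. unif)) (\<lambda>u. \<Sum>x\<in>G \<rightarrow>\<^sub>E {1..n}. \<Phi> (\<lambda>g. int (x g)) *
      indicator (Q x) u)
    ((\<Sum>x\<in>G \<rightarrow>\<^sub>E {1..n}. \<Phi> (\<lambda>g. int (x g))) / real n ^ card G)" .
  have eq: "(\<Sum>x\<in>G \<rightarrow>\<^sub>E {1..n}. \<Phi> (\<lambda>g. int (x g)) * indicator (Q x) u) = \<Phi> (\<lambda>g. \<lceil>real n * u g\<rceil>)"
    if u: "u \<in> space (PiM G (\<lambda>_. unif))" "\<forall>g\<in>G. 0 < u g \<and> u g \<le> 1" for u
  proof -
    define y where "y = (\<lambda>g\<in>G. nat \<lceil>real n * u g\<rceil>)"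
    have pos: "0 < \<lceil>real n * u g\<rceil>" "\<lceil>real n * u g\<rceil> \<le> int n" if "g \<in> G" for g
      using u(2) that n by (auto simp: ceiling_le_iff mult_left_le)
    have y: "y \<in> G \<rightarrow>\<^sub>E {1..n}"
    proof (rule PiE_I)
      fix g assume "g \<in> G"
      with pos[of g] show "y g \<in> {1..n}" by (simp add: y_def nat_le_iff Suc_le_eq)
    qed (simp add: y_def)
    have uQ: "u \<in> Q x \<longleftrightarrow> x = y" if x: "x \<in> G \<rightarrow>\<^sub>E {1..n}" for x
    proof -
      have "u \<in> Q x \<longleftrightarrow> (\<forall>g\<in>G. real (x g) - 1 < real n * u g \<and> real n * u g \<le> real (x g))"
        using u(1) n by (auto simp: Q_def space_PiM PiE_iff field_simps)
      also have "\<dots> \<longleftrightarrow> (\<forall>g\<in>G. \<lceil>real n * u g\<rceil> = int (x g))"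
        by (simp add: ceiling_eq_iff)
      also have "\<dots> \<longleftrightarrow> (\<forall>g\<in>G. x g = y g)"
        using pos by (force simp: y_def)
      also have "\<dots> \<longleftrightarrow> x = y"
        using x y by (auto intro: PiE_ext)
      finally show ?thesis .
    qed
    have "(\<Sum>x\<in>G \<rightarrow>\<^sub>E {1..n}. \<Phi> (\<lambda>g. int (x g)) * indicator (Q x) u) =
        (\<Sum>x\<in>G \<rightarrow>\<^sub>E {1..n}. if x = y then \<Phi> (\<lambda>g. int (x g)) else 0)"
      using uQ by (intro sum.cong) (auto simp: indicator_def)
    also have "\<dots> = \<Phi> (\<lambda>g. int (y g))"
      using y fin by simp
    also have "\<dots> = \<Phi> (\<lambda>g. \<lceil>real n * u g\<rceil>)"
    proof (rule \<Phi>)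
      fix g assume "g \<in> G"
      then show "int (y g) = \<lceil>real n * u g\<rceil>"
        using less_imp_le[OF pos(1)[of g]] by (simp only: y_def restrict_apply' int_nat_eq if_True)
    qed
    finally show ?thesis .
  qed
  have ae: "AE u in PiM G (\<lambda>_. unif). (\<Sum>x\<in>G \<rightarrow>\<^sub>E {1..n}. \<Phi> (\<lambda>g. int (x g)) * indicator (Q x) u)
      = \<Phi> (\<lambda>g. \<lceil>real n * u g\<rceil>)"
    using AE_component_unif AE_space by eventually_elim (rule eq)
  have m: "(\<lambda>u. \<Phi> (\<lambda>g. \<lceil>real n * u g\<rceil>)) \<in> borel_measurable (PiM G (\<lambda>_. unif))"
  proof -
    \<comment> \<open>Restricted to \<open>G\<close>, the ceilings take values in a countable set,
      so measurability reduces to that of their fibers, whatever \<Phi> is.\<close>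
    have "(\<lambda>u. \<Phi> (\<lambda>g. \<lceil>real n * u g\<rceil>)) = (\<lambda>u. (\<lambda>z. \<Phi> z) (\<lambda>g\<in>G. \<lceil>real n * u g\<rceil>))"
      by (auto simp: fun_eq_iff intro!: \<Phi>)
    also have "\<dots> \<in> borel_measurable (PiM G (\<lambda>_. unif))"
    proof (rule measurable_compose_countable'[where I="G \<rightarrow>\<^sub>E UNIV" and g="\<lambda>u. \<lambda>g\<in>G. \<lceil>real n * u g\<rceil>"
        and f="\<lambda>z u. \<Phi> z"])
      show "countable (G \<rightarrow>\<^sub>E (UNIV :: int set))" by (intro countable_PiE finite_G) auto
      show "(\<lambda>u. \<lambda>g\<in>G. \<lceil>real n * u g\<rceil>) \<in> PiM G (\<lambda>_. unif) \<rightarrow>\<^sub>M count_space (G \<rightarrow>\<^sub>E UNIV)"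
      proof (subst measurable_count_space_eq_countable)
        show "countable (G \<rightarrow>\<^sub>E (UNIV :: int set))" by (intro countable_PiE finite_G) auto
        show "(\<lambda>u. \<lambda>g\<in>G. \<lceil>real n * u g\<rceil>) \<in> space (PiM G (\<lambda>_. unif)) \<rightarrow> G \<rightarrow>\<^sub>E UNIV \<and>
          (\<forall>a\<in>G \<rightarrow>\<^sub>E UNIV. (\<lambda>u. \<lambda>g\<in>G. \<lceil>real n * u g\<rceil>) -` {a} \<inter> space (PiM G (\<lambda>_. unif)) \<in> sets (PiM G
              (\<lambda>_. unif)))"
        proof (intro conjI ballI)
          fix a assume a: "a \<in> G \<rightarrow>\<^sub>E (UNIV :: int set)"
          have "(\<lambda>u. \<lambda>g\<in>G. \<lceil>real n * u g\<rceil>) -` {a} \<inter> space (PiM G (\<lambda>_. unif)) =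
              {u \<in> space (PiM G (\<lambda>_. unif)). \<forall>g\<in>G. \<lceil>real n * u g\<rceil> = a g}"
            using a by (auto simp: fun_eq_iff PiE_iff extensional_def)
          also have "\<dots> \<in> sets (PiM G (\<lambda>_. unif))"
            using finite_G by measurable
          finally show "(\<lambda>u. \<lambda>g\<in>G. \<lceil>real n * u g\<rceil>) -` {a} \<inter> space (PiM G (\<lambda>_. unif)) \<in> sets (PiM G
              (\<lambda>_. unif))" .
        qed auto
      qed
    qed simp
    finally show ?thesis .
  qed
  show ?thesis
    by (rule has_bochner_integralI_AE[OF int]) (use ae m in auto)
qed

end

lemma ceiling_ratio_tendsto: "(\<lambda>n. of_int \<lceil>real n * u\<rceil> / real n) \<longlonglongrightarrow> u"
proof (rule tendsto_sandwich)
  show "eventually (\<lambda>n. u \<le> of_int \<lceil>real n * u\<rceil> / real n) sequentially"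
    using eventually_gt_at_top[of 0] by eventually_elim (auto simp: field_simps)
  show "eventually (\<lambda>n. of_int \<lceil>real n * u\<rceil> / real n \<le> u + 1 / real n) sequentially"
    using eventually_gt_at_top[of 0]
  proof eventually_elim
    case (elim n)
    have "of_int \<lceil>real n * u\<rceil> \<le> real n * u + 1" by linarith
    with elim show ?case by (auto simp: field_simps)
  qed
  show "(\<lambda>n. u + 1 / real n) \<longlonglongrightarrow> u" by real_asymp
qed auto

section \<open>Pointwise limit and dominated convergence\<close>

context link_pattern
begin

theorem convergent_card_constrained:
  assumes \<theta>: "\<theta> > 0"
  shows "convergent (\<lambda>n. real (card (constrained \<theta> n)) / real n ^ card G)"
proof -
  interpret unif: prob_space unif by (rule prob_space_unif)
  interpret U: product_prob_space "\<lambda>_::nat. unif" G ..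
  interpret U: finite_product_prob_space "\<lambda>_::nat. unif" G by standard simp
  let ?P = "PiM G (\<lambda>_. unif)"
  let ?H = "{1..<h} - G"
  let ?m = "modulus \<theta>"
  define \<Phi> where "\<Phi> n x = (if [lin h x = x 0] (mod int (?m n))
    then \<Prod>i\<in>?H. real (card (lifts n (?m n) (lin i x))) else 0)" for n and x :: "nat \<Rightarrow> int"
  define F where "F n u = \<Phi> n (\<lambda>g. \<lceil>real n * u g\<rceil>)" for n and u :: "nat \<Rightarrow> real"
  have \<Phi>_cong: "\<Phi> n x = \<Phi> n y" if "\<And>g. g \<in> G \<Longrightarrow> x g = y g" for n x y
    using lin_cong[of x y, OF that] that[OF G(2)] by (simp add: \<Phi>_def)
  have int: "has_bochner_integral ?P (F n) (real (card (constrained \<theta> n)) / real n ^ card G)" if "n >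
      0" for n
  proof -
    have "real (card (constrained \<theta> n)) = (\<Sum>x\<in>G \<rightarrow>\<^sub>E {1..n}. \<Phi> n (\<lambda>g. int (x g)))"
      unfolding card_constrained of_nat_sum by (intro sum.cong refl) (simp add: \<Phi>_def)
    with integral_ceiling_unif[where \<Phi>="\<Phi> n" and n=n, OF finite_G that \<Phi>_cong] show ?thesis
      unfolding F_def by simp
  qed
  \<comment> \<open>These are the coefficients of the closing condition
    \<open>lin h x - x 0\<close>. If all vanish, circuits close automatically; otherwise almost
    every point violates the condition in the limit, and the limiting integrand is 0.\<close>
  define c where "c g = coef G p h g - (if g = 0 then 1 else 0)" for g
  have closing: "lin h x - x 0 = (\<Sum>g\<in>G. of_int (c g) * x g)" for x :: "nat \<Rightarrow> 'b::ring_1"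
  proof -
    have "(\<Sum>g\<in>G. of_int (c g) * x g) = lin h x - (\<Sum>g\<in>G. if g = 0 then x g else 0)"
      unfolding lin_def c_def sum_subtractf[symmetric] by (intro sum.cong) (auto simp: algebra_simps)
    then show ?thesis using G(2) by simp
  qed
  define \<Psi> where "\<Psi> u = (if \<forall>g\<in>G. c g = 0 then
    \<Prod>i\<in>?H. real_of_int \<lfloor>\<theta> - \<theta> * lin i u\<rfloor> - of_int \<lfloor>- (\<theta> * lin i u)\<rfloor> else 0)" for u :: "nat \<Rightarrow> real"
  have lim: "AE u in ?P. (\<lambda>n. F n u) \<longlonglongrightarrow> \<Psi> u"
  proof -
    \<comment> \<open>The excluded values are those at which \<theta> times the form, or \<theta>
      minus it, is an integer, that is, where the floors in the lift count jump.\<close>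
    have 1: "AE u in ?P. \<forall>i\<in>?H. \<forall>j::int. lin i u \<noteq> of_int j / \<theta> \<and> lin i u \<noteq> 1 - of_int j / \<theta>"
    proof (rule AE_finite_allI, simp)
      fix i assume "i \<in> ?H"
      then obtain g where "g \<in> G" "coef G p i g \<noteq> 0" using coef_nonzero[of i] by auto
      then have "AE u in ?P. lin i u \<noteq> s" for s :: real
        unfolding lin_def by (intro AE_linear_form_neq) auto
      then show "AE u in ?P. \<forall>j::int. lin i u \<noteq> of_int j / \<theta> \<and> lin i u \<noteq> 1 - of_int j / \<theta>"
        by (subst AE_all_countable) (auto intro: AE_conjI)
    qed
    have 2: "AE u in ?P. (\<exists>g\<in>G. c g \<noteq> 0) \<longrightarrow> (\<forall>j::int. lin h u - u 0 \<noteq> of_int j / \<theta>)"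
    proof (cases "\<exists>g\<in>G. c g \<noteq> 0")
      case True
      then obtain g where "g \<in> G" "c g \<noteq> 0" by auto
      then have "AE u in ?P. lin h u - u 0 \<noteq> s" for s :: real
        unfolding closing by (intro AE_linear_form_neq) auto
      then have "AE u in ?P. \<forall>j::int. lin h u - u 0 \<noteq> of_int j / \<theta>"
        by (subst AE_all_countable) auto
      then show ?thesis by auto
    qed auto
    show ?thesis
      using 1 2
    proof eventually_elim
      case (elim u)
      let ?x = "\<lambda>n g. \<lceil>real n * u g\<rceil>"
      \<comment> \<open>A vertex divided by the modulus is n / m, which tends to \<theta>, times the
        vertex divided by n, which tends to its coordinate \<open>u g\<close>.\<close>
      have conv: "(\<lambda>n. of_int (\<Sum>g\<in>G. d g * ?x n g) / real (?m n)) \<longlonglongrightarrow> \<theta> * (\<Sum>g\<in>G. of_int (d g) * u g)" for d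
      proof -
        have "(\<lambda>n. (real n / real (?m n)) * (\<Sum>g\<in>G. of_int (d g) * (of_int (?x n g) / real n)))
            \<longlonglongrightarrow> \<theta> * (\<Sum>g\<in>G. of_int (d g) * u g)"
          by (intro tendsto_intros modulus_ratio \<theta> ceiling_ratio_tendsto)
        moreover have "eventually (\<lambda>n. (real n / real (?m n)) * (\<Sum>g\<in>G. of_int (d g) * (of_int (?x n g)
            / real n)) =
            of_int (\<Sum>g\<in>G. d g * ?x n g) / real (?m n)) sequentially"
          using eventually_gt_at_top[of 0]
          by eventually_elim (simp add: sum_distrib_left sum_divide_distrib mult_ac)
        ultimately show ?thesis by (rule Lim_transform_eventually)
      qed
      have conv_lin: "(\<lambda>n. of_int (lin i (?x n)) / real (?m n)) \<longlonglongrightarrow> \<theta> * lin i u" for i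
        using conv[of "coef G p i"] by (simp add: lin_def)
      have W: "(\<lambda>n. \<Prod>i\<in>?H. real (card (lifts n (?m n) (lin i (?x n))))) \<longlonglongrightarrow>
          (\<Prod>i\<in>?H. real_of_int \<lfloor>\<theta> - \<theta> * lin i u\<rfloor> - of_int \<lfloor>- (\<theta> * lin i u)\<rfloor>)"
      proof (intro tendsto_prod)
        fix i assume i: "i \<in> ?H"
        have "- (\<theta> * lin i u) \<notin> \<int>"
        proof
          assume "- (\<theta> * lin i u) \<in> \<int>"
          then obtain j where "- (\<theta> * lin i u) = of_int j" by (rule Ints_cases)
          then have "lin i u = of_int (- j) / \<theta>" using \<theta> by (simp add: field_simps)
          with elim(1) i show False by blast
        qed
        moreover have "(\<lambda>n. - (of_int (lin i (?x n)) / real (?m n))) \<longlonglongrightarrow> - (\<theta> * lin i u)"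
          by (intro tendsto_intros conv_lin)
        ultimately have e1: "eventually (\<lambda>n. \<lfloor>- (of_int (lin i (?x n)) / real (?m n))\<rfloor>
            = \<lfloor>- (\<theta> * lin i u)\<rfloor>) sequentially"
          by (intro eventually_floor_eq)
        have "\<theta> - \<theta> * lin i u \<notin> \<int>"
        proof
          assume "\<theta> - \<theta> * lin i u \<in> \<int>"
          then obtain j where "\<theta> - \<theta> * lin i u = of_int j" by (rule Ints_cases)
          then have "lin i u = 1 - of_int j / \<theta>" using \<theta> by (simp add: field_simps)
          with elim(1) i show False by blast
        qed
        moreover have "(\<lambda>n. real n / real (?m n) - of_int (lin i (?x n)) / real (?m n))
            \<longlonglongrightarrow> \<theta> - \<theta> * lin i u"
          by (intro tendsto_intros conv_lin modulus_ratio \<theta>)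
        ultimately have e2: "eventually (\<lambda>n. \<lfloor>real n / real (?m n) - of_int (lin i (?x n)) / real (?m
            n)\<rfloor> = \<lfloor>\<theta> - \<theta> * lin i u\<rfloor>) sequentially"
          by (intro eventually_floor_eq)
        have "eventually (\<lambda>n. real (card (lifts n (?m n) (lin i (?x n))))
            = real_of_int \<lfloor>\<theta> - \<theta> * lin i u\<rfloor> - of_int \<lfloor>- (\<theta> * lin i u)\<rfloor>) sequentially"
          using e1 e2 eventually_modulus[OF \<theta>]
          by eventually_elim (simp add: card_lifts_floor)
        then show "(\<lambda>n. real (card (lifts n (?m n) (lin i (?x n)))))
            \<longlonglongrightarrow> real_of_int \<lfloor>\<theta> - \<theta> * lin i u\<rfloor> - of_int \<lfloor>- (\<theta> * lin i u)\<rfloor>"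
          by (rule tendsto_eventually)
      qed
      show ?case
      proof (cases "\<forall>g\<in>G. c g = 0")
        case True
        then have "lin h x = x 0" for x :: "nat \<Rightarrow> int"
          using closing[of x] by simp
        then have "F n u = (\<Prod>i\<in>?H. real (card (lifts n (?m n) (lin i (?x n)))))" for n
          by (simp add: F_def \<Phi>_def)
        with W True show ?thesis by (simp add: \<Psi>_def)
      next
        case False
        let ?z = "\<theta> * (lin h u - u 0)"
        have nz: "?z \<notin> \<int>"
        proof
          assume "?z \<in> \<int>"
          then obtain j where "?z = of_int j" by (rule Ints_cases)
          then have "lin h u - u 0 = of_int j / \<theta>" using \<theta> by (simp add: field_simps)
          with elim(2) False show False by blast
        qed
        have z: "(\<lambda>n. of_int (lin h (?x n) - ?x n 0) / real (?m n)) \<longlonglongrightarrow> ?z"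
        proof -
          have "lin h (?x n) - ?x n 0 = (\<Sum>g\<in>G. c g * ?x n g)" for n
            using closing[of "?x n"] by simp
          then show ?thesis
            using conv[of c] closing[of u] by simp
        qed
        \<comment> \<open>The integers are closed, so a sequence with non-integer limit eventually
          avoids them, while the closing congruence would make the quotient by the modulus an
          integer.\<close>
        have "eventually (\<lambda>n. of_int (lin h (?x n) - ?x n 0) / real (?m n) \<notin> \<int>) sequentially"
          using topological_tendstoD[OF z, of "- \<int>"] nz closed_Ints[where 'a=real]
              by (auto simp: open_Compl)
        then have "eventually (\<lambda>n. F n u = 0) sequentially"
          using eventually_modulus[OF \<theta>]
        proof eventually_elim
          case (elim n)
          have "\<not> [lin h (?x n) = ?x n 0] (mod int (?m n))"
          proof
            assume "[lin h (?x n) = ?x n 0] (mod int (?m n))"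
            then obtain q where "lin h (?x n) - ?x n 0 = int (?m n) * q"
              by (auto simp: cong_iff_dvd_diff)
            then have "of_int (lin h (?x n) - ?x n 0) / real (?m n) = of_int q"
              using elim by simp
            with elim show False by (metis Ints_of_int)
          qed
          then show ?case by (simp add: F_def \<Phi>_def)
        qed
        moreover have "\<Psi> u = 0" using False by (simp only: \<Psi>_def if_False)
        ultimately show ?thesis by (simp add: tendsto_eventually)
      qed
    qed
  qed
  \<comment> \<open>The dominating bound holds only for large indices, so the sequence is shifted;
    the extra 1 in the shift makes the index positive, as \<open>int\<close> requires.\<close>
  obtain N where N: "\<And>n. n \<ge> N \<Longrightarrow> ?m n > 0 \<and> real n / real (?m n) \<le> 2 * \<theta>"
    using eventually_modulus[OF \<theta>] unfolding eventually_sequentially by blast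
  let ?N = "N + 1"
  have "(\<lambda>n. integral\<^sup>L ?P (F (n + ?N))) \<longlonglongrightarrow> integral\<^sup>L ?P \<Psi>"
  proof (rule integral_dominated_convergence)
    show "\<Psi> \<in> borel_measurable ?P"
      unfolding \<Psi>_def lin_def by measurable
    show "F (n + ?N) \<in> borel_measurable ?P" for n
      using int[of "n + ?N"] by auto
    show "integrable ?P (\<lambda>_. (2 * \<theta> + 1) ^ card ?H)"
      by simp
    show "AE u in ?P. (\<lambda>n. F (n + ?N) u) \<longlonglongrightarrow> \<Psi> u"
      using lim by eventually_elim (rule LIMSEQ_ignore_initial_segment)
    show "AE u in ?P. norm (F (n + ?N) u) \<le> (2 * \<theta> + 1) ^ card ?H" for n
    proof (rule AE_I2)
      fix u
      let ?n = "n + ?N"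
      have bound: "real (card (lifts ?n (?m ?n) z)) \<le> 2 * \<theta> + 1" for z
        using card_lifts_le[of "?m ?n" ?n z] N[of ?n] by linarith
      have "(\<Prod>i\<in>?H. real (card (lifts ?n (?m ?n) (lin i (\<lambda>g. \<lceil>real ?n * u g\<rceil>))))) \<le> (\<Prod>i\<in>?H. 2 * \<theta> + 1)"
        by (intro prod_mono conjI bound of_nat_0_le_iff)
      moreover have "0 \<le> (\<Prod>i\<in>?H. real (card (lifts ?n (?m ?n) (lin i (\<lambda>g. \<lceil>real ?n * u g\<rceil>)))))"
        by (intro prod_nonneg) auto
      ultimately show "norm (F ?n u) \<le> (2 * \<theta> + 1) ^ card ?H"
        using \<theta> by (simp add: F_def \<Phi>_def)
    qed
  qed
  then have "(\<lambda>n. real (card (constrained \<theta> (n + ?N))) / real (n + ?N) ^ card G) \<longlonglongrightarrow> integral\<^sup>L ?P \<Psi>"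
    using has_bochner_integral_integral_eq[OF int] by simp
  then show ?thesis
    unfolding convergent_def by (intro exI LIMSEQ_offset[where k = ?N and f
        = "\<lambda>n. real (card (constrained \<theta> n)) / real n ^ card G"])
qed

end

subsection \<open>Catalan words\<close>

text \<open>A set of vertices rather than of letter positions: vertex \<open>i\<close> is the end of
  edge \<open>i\<close>, which carries the letter \<open>w ! (i - 1)\<close>, and vertex 0 is added
  as the free start of the circuit.\<close>

definition first_occurrences :: "'a list \<Rightarrow> nat set" where
  "first_occurrences w = {0} \<union> {i \<in> {1..length w}. \<forall>j\<in>{1..<i}. w ! (j - 1) \<noteq> w ! (i - 1)}"

definition first_occurrence :: "'a list \<Rightarrow> nat \<Rightarrow> nat" where
  "first_occurrence w i = (LEAST j. 1 \<le> j \<and> w ! (j - 1) = w ! (i - 1))"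

lemma first_occurrence:
  assumes "1 \<le> i"
  shows "1 \<le> first_occurrence w i" "w ! (first_occurrence w i - 1)
      = w ! (i - 1)" "first_occurrence w i \<le> i"
  using LeastI[of "\<lambda>j. 1 \<le> j \<and> w ! (j - 1) = w ! (i - 1)" i] assms
    Least_le[of "\<lambda>j. 1 \<le> j \<and> w ! (j - 1) = w ! (i - 1)" i]
  by (auto simp: first_occurrence_def)

lemma first_occurrence_less:
  assumes "i \<in> {1..length w} - first_occurrences w"
  shows "first_occurrence w i < i"
proof -
  obtain j where "j \<in> {1..<i}" "w ! (j - 1) = w ! (i - 1)"
    using assms by (auto simp: first_occurrences_def)
  then show ?thesis
    using Least_le[of "\<lambda>j. 1 \<le> j \<and> w ! (j - 1) = w ! (i - 1)" j] by (auto simp: first_occurrence_def)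
qed

lemma card_set_pair_matched:
  assumes "\<forall>a\<in>set w. count_list w a = 2"
  shows "length w = 2 * card (set w)"
proof -
  have "length w = (\<Sum>a\<in>set w. count_list w a)" by (simp add: sum_count_set)
  also have "\<dots> = (\<Sum>a\<in>set w. 2)" using assms by (intro sum.cong) auto
  finally show ?thesis by simp
qed

text \<open>New letters correspond to distinct letters, and vertex 0 adds one. For a pair-matched
  word of length 2k this gives k + 1 free vertices, the exponent in
  \<open>word_freq\<close>.\<close>

lemma card_first_occurrences: "card (first_occurrences w) = card (set w) + 1"
proof -
  let ?F = "{i \<in> {1..length w}. \<forall>j\<in>{1..<i}. w ! (j - 1) \<noteq> w ! (i - 1)}"
  have "bij_betw (\<lambda>i. w ! (i - 1)) ?F (set w)"
    unfolding bij_betw_def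
  proof
    show "inj_on (\<lambda>i. w ! (i - 1)) ?F"
    proof (rule inj_onI)
      fix i j assume "i \<in> ?F" "j \<in> ?F" and eq: "w ! (i - 1) = w ! (j - 1)"
      then show "i = j" by (cases i j rule: linorder_cases) (force+)
    qed
    show "(\<lambda>i. w ! (i - 1)) ` ?F = set w"
    proof (intro equalityI subsetI)
      fix a assume "a \<in> set w"
      then obtain i where i: "i < length w" "w ! i = a" by (auto simp: in_set_conv_nth)
      let ?q = "first_occurrence w (Suc i)"
      have q: "1 \<le> ?q" "w ! (?q - 1) = a" "?q \<le> Suc i"
        using first_occurrence[of "Suc i" w] i by auto
      have "w ! (j - 1) \<noteq> w ! (?q - 1)" if "j \<in> {1..<?q}" for j
        using not_less_Least[of j "\<lambda>j. 1 \<le> j \<and> w ! (j - 1) = w ! (Suc i - 1)"] that q i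
        by (auto simp: first_occurrence_def)
      then have "?q \<in> ?F" using q i by auto
      then show "a \<in> (\<lambda>i. w ! (i - 1)) ` ?F" using q by (intro image_eqI[of _ _ ?q]) auto
    qed (auto intro!: nth_mem)
  qed
  then have "card ?F = card (set w)" by (rule bij_betw_same_card)
  then show ?thesis unfolding first_occurrences_def by (subst card_Un_disjoint) auto
qed

text \<open>The last letter cannot be new, since every letter occurs twice; hence the last vertex is
  not free.\<close>

lemma link_pattern_word:
  assumes "w \<noteq> []" and w: "\<forall>a\<in>set w. count_list w a = 2"
  shows "link_pattern (first_occurrences w) (first_occurrence w) (length w)"
proof
  have last: "length w \<notin> first_occurrences w"
  proof
    assume *: "length w \<in> first_occurrences w"
    obtain v a where va: "w = v @ [a]" using assms(1) by (cases w rule: rev_cases) auto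
    have "a \<notin> set v"
    proof
      assume "a \<in> set v"
      then obtain i where "i < length v" "v ! i = a" by (auto simp: in_set_conv_nth)
      with * show False
        by (auto simp: first_occurrences_def va nth_append dest!: bspec[of _ _ "Suc i"])
    qed
    then have "count_list w a = 1" by (simp add: va count_list_0_iff)
    with w va show False by auto
  qed
  moreover have "first_occurrences w \<subseteq> {0..length w}" by (auto simp: first_occurrences_def)
  ultimately show "first_occurrences w \<subseteq> {0..<length w}" by (force simp: order_le_less)
  show "0 \<in> first_occurrences w" by (simp add: first_occurrences_def)
  show "0 < first_occurrence w i \<and> first_occurrence w i < i" if "i \<in> {1..length w} - first_occurrences
      w" for i
    using first_occurrence_less[OF that] first_occurrence(1)[of i w] that by auto
qed

text \<open>Equality of link values is transitive, so comparing each repeated letter with its first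
  occurrence is as strong as comparing all equal letters.\<close>

lemma Pi_star_eq_constrained:
  assumes "w \<noteq> []" "\<forall>a\<in>set w. count_list w a = 2"
  shows "Pi_star \<theta> n w = link_pattern.constrained (first_occurrences w) (first_occurrence w) (length
      w) \<theta> n"
proof -
  interpret link_pattern "first_occurrences w" "first_occurrence w" "length w"
    by (rule link_pattern_word[OF assms])
  let ?q = "first_occurrence w"
  have "\<pi> \<in> constrained \<theta> n \<longleftrightarrow> (\<forall>i\<in>{1..length w}. \<forall>j\<in>{1..length w}. w ! (i - 1) = w ! (j - 1) \<longrightarrow>
       link \<theta> n (\<pi> (i - 1)) (\<pi> i) = link \<theta> n (\<pi> (j - 1)) (\<pi> j))" (is "_ \<longleftrightarrow> ?R")
    if c: "\<pi> \<in> circuits n (length w)" for \<pi>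
  proof
    assume *: "\<pi> \<in> constrained \<theta> n"
    have l: "link \<theta> n (\<pi> (i - 1)) (\<pi> i) = link \<theta> n (\<pi> (?q i - 1)) (\<pi> (?q i))" if i: "i \<in> {1..length
        w}" for i
    proof (cases "i \<in> first_occurrences w")
      case True
      have "?q i = i"
        using first_occurrence[of i w] i True by (force simp: first_occurrences_def order_le_less)
      then show ?thesis by simp
    next
      case False
      then show ?thesis using * i unfolding constrained_def by blast
    qed
    show ?R
    proof (intro ballI impI)
      fix i j assume "i \<in> {1..length w}" "j \<in> {1..length w}" and eq: "w ! (i - 1) = w ! (j - 1)"
      moreover have "?q i = ?q j" using eq by (simp add: first_occurrence_def)
      ultimately show "link \<theta> n (\<pi> (i - 1)) (\<pi> i) = link \<theta> n (\<pi> (j - 1)) (\<pi> j)"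
        using l[of i] l[of j] by simp
    qed
  next
    assume R: ?R
    show "\<pi> \<in> constrained \<theta> n"
      unfolding constrained_def
    proof (intro CollectI conjI ballI c)
      fix i assume i: "i \<in> {1..length w} - first_occurrences w"
      then have "?q i \<in> {1..length w}" "w ! (i - 1) = w ! (?q i - 1)"
        using first_occurrence[of i w] by auto
      then show "link \<theta> n (\<pi> (i - 1)) (\<pi> i) = link \<theta> n (\<pi> (?q i - 1)) (\<pi> (?q i))"
        using R i by blast
    qed
  qed
  then show ?thesis unfolding Pi_star_def by (auto simp: constrained_def)
qed

theorem convergent_word_freq:
  assumes "\<theta> > 0" "w \<noteq> []" "\<forall>a\<in>set w. count_list w a = 2"
  shows "convergent (word_freq \<theta> w)"
proof -
  interpret link_pattern "first_occurrences w" "first_occurrence w" "length w"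
    by (rule link_pattern_word[OF assms(2,3)])
  have "card (first_occurrences w) = length w div 2 + 1"
    using card_first_occurrences[of w] card_set_pair_matched[OF assms(3)] by simp
  then have "word_freq \<theta> w = (\<lambda>n. real (card (constrained \<theta> n)) / real n ^ card (first_occurrences w))"
    by (intro ext) (simp add: word_freq_def Pi_star_eq_constrained[OF assms(2,3)])
  with convergent_card_constrained[OF assms(1)] show ?thesis by simp
qed

section \<open>Inserting a double letter into a circuit\<close>

lemma link_cong:
  assumes "i mod modulus \<theta> n = i' mod modulus \<theta> n" "j mod modulus \<theta> n = j' mod modulus \<theta> n"
  shows "link \<theta> n i j = link \<theta> n i' j'"
  unfolding link_eq by (rule mod_add_cong[OF assms])

text \<open>Replacing vertex \<open>l\<close> of a circuit by a detour \<open>y, x, z\<close>. If \<open>y\<close> and \<open>z\<close> are both congruent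
  to the replaced vertex, the two new edges have the same link value and the old link values are
  unchanged.\<close>

definition detour :: "nat \<Rightarrow> (nat \<Rightarrow> nat) \<Rightarrow> nat \<Rightarrow> nat \<Rightarrow> nat \<Rightarrow> nat \<Rightarrow> nat" where
  "detour l \<pi> y x z i = (if i < l then \<pi> i else if i = l then y else if i = l + 1 then x
    else if i = l + 2 then z else \<pi> (i - 2))"

lemma detour_in_Pi_star:
  assumes \<pi>: "\<pi> \<in> Pi_star \<theta> n (u @ v)" and a: "a \<notin> set (u @ v)"
    and xyz: "x \<in> {1..n}" "y \<in> {1..n}" "z \<in> {1..n}"
    and y: "y mod modulus \<theta> n = \<pi> (length u) mod modulus \<theta> n"
    and z: "z mod modulus \<theta> n = \<pi> (length u) mod modulus \<theta> n"
    and closed: "detour (length u) \<pi> y x z 0 = detour (length u) \<pi> y x z (length (u @ v) + 2)"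
  shows "detour (length u) \<pi> y x z \<in> Pi_star \<theta> n (u @ [a, a] @ v)"
proof -
  let ?l = "length u" and ?h = "length (u @ v)"
  let ?\<pi> = "detour ?l \<pi> y x z" and ?w = "u @ [a, a] @ v"
  have c: "\<pi> \<in> {0..?h} \<rightarrow>\<^sub>E {1..n}" using \<pi> by (auto simp: Pi_star_def circuits_def)
  have in_n: "\<pi> i \<in> {1..n}" if "i \<le> ?h" for i
    by (rule PiE_mem[OF c]) (use that in auto)
  \<comment> \<open>Every edge of the long circuit except the two new ones comes from the edge
    \<open>\<sigma> i\<close> of the old circuit, with ends congruent to the old ends.\<close>
  define \<sigma> where "\<sigma> i = (if i \<le> ?l then i else i - 2)" for i
  have old: "link \<theta> n (?\<pi> (i - 1)) (?\<pi> i) = link \<theta> n (\<pi> (\<sigma> i - 1)) (\<pi> (\<sigma> i)) \<and> ?w ! (i - 1)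
      = (u @ v) ! (\<sigma> i - 1)
      \<and> \<sigma> i \<in> {1..?h}"
    if i: "i \<in> {1..?h + 2}" "i \<noteq> ?l + 1" "i \<noteq> ?l + 2" for i
  proof (cases "i \<le> ?l")
    case True
    then have "?\<pi> (i - 1) = \<pi> (i - 1)" "?\<pi> i mod modulus \<theta> n = \<pi> i mod modulus \<theta> n"
      using i y by (auto simp: detour_def)
    then show ?thesis using True i by (auto simp: \<sigma>_def nth_append intro!: link_cong)
  next
    case False
    then have i': "i \<ge> ?l + 3" using i by auto
    then obtain e where e: "i = ?l + 3 + e" using le_Suc_ex by blast
    then have "?\<pi> (i - 1) mod modulus \<theta> n = \<pi> (i - 3) mod modulus \<theta> n" "?\<pi> i = \<pi> (i - 2)"
      using z by (cases e; auto simp: detour_def numeral_eq_Suc)+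
    moreover have "?w ! (i - 1) = (u @ v) ! (i - 3)"
      using i' by (auto simp: nth_append nth_Cons' numeral_eq_Suc)
    moreover have "\<sigma> i = i - 2" "i - 2 - 1 = i - 3" using i' by (auto simp: \<sigma>_def)
    ultimately show ?thesis using i i' by (auto intro!: link_cong)
  qed
  have new: "link \<theta> n (?\<pi> (i - 1)) (?\<pi> i) = link \<theta> n (\<pi> ?l) x \<and> ?w ! (i - 1) = a"
    if "i = ?l + 1 \<or> i = ?l + 2" for i
  proof (cases "i = ?l + 1")
    case True
    then show ?thesis using y by (auto simp: detour_def nth_append intro!: link_cong)
  next
    case False
    then have "i = ?l + 2" using that by auto
    then have "link \<theta> n (?\<pi> (i - 1)) (?\<pi> i) = link \<theta> n x z" "?w ! (i - 1) = a"
      by (auto simp: detour_def nth_append)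
    moreover have "link \<theta> n x z = link \<theta> n z x" by (simp add: link_eq add.commute)
    moreover have "link \<theta> n z x = link \<theta> n (\<pi> ?l) x" using z by (intro link_cong) auto
    ultimately show ?thesis by simp
  qed
  have not_a: "(u @ v) ! (\<sigma> i - 1) \<noteq> a" if "\<sigma> i \<in> {1..?h}" for i
  proof -
    have "(u @ v) ! (\<sigma> i - 1) \<in> set (u @ v)" using that by (intro nth_mem) auto
    then show ?thesis using a by metis
  qed
  have "?\<pi> \<in> circuits n (length ?w)"
    unfolding circuits_def
  proof (intro CollectI conjI PiE_I)
    fix i assume "i \<in> {0..length ?w}"
    then show "?\<pi> i \<in> {1..n}"
      using in_n[of i] in_n[of "i - 2"] xyz by (auto simp: detour_def)
  next
    fix i assume "i \<notin> {0..length ?w}"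
    then show "?\<pi> i = undefined"
      using c by (auto simp: detour_def PiE_iff extensional_def)
  qed (use closed in simp)
  moreover have "link \<theta> n (?\<pi> (i - 1)) (?\<pi> i) = link \<theta> n (?\<pi> (j - 1)) (?\<pi> j)"
    if ij: "i \<in> {1..length ?w}" "j \<in> {1..length ?w}" and eq: "?w ! (i - 1) = ?w ! (j - 1)" for i j
  proof -
    have ij: "i \<in> {1..?h + 2}" "j \<in> {1..?h + 2}" using ij by auto
    let ?N = "\<lambda>i. i = ?l + 1 \<or> i = ?l + 2"
    consider "?N i" "?N j" | "\<not> ?N i" "\<not> ?N j" | "?N i" "\<not> ?N j" | "\<not> ?N i" "?N j" by blast
    then show ?thesis
    proof cases
      case 1
      then show ?thesis using new by metis
    next
      case 2
      then have "link \<theta> n (\<pi> (\<sigma> i - 1)) (\<pi> (\<sigma> i)) = link \<theta> n (\<pi> (\<sigma> j - 1)) (\<pi> (\<sigma> j))"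
        using \<pi> old[OF ij(1)] old[OF ij(2)] eq unfolding Pi_star_def by simp
      then show ?thesis using 2 old[OF ij(1)] old[OF ij(2)] by simp
    next
      case 3
      then show ?thesis using new[of i] old[OF ij(2)] not_a[of j] eq by metis
    next
      case 4
      then show ?thesis using new[of j] old[OF ij(1)] not_a[of i] eq by metis
    qed
  qed
  ultimately show ?thesis unfolding Pi_star_def by blast
qed

lemma finite_Pi_star [simp]: "finite (Pi_star \<theta> n w)"
  unfolding Pi_star_def by (rule finite_subset[OF _ finite_circuits]) auto

lemma Pi_star_mem: "\<pi> \<in> Pi_star \<theta> n w \<Longrightarrow> i \<le> length w \<Longrightarrow> \<pi> i \<in> {1..n}"
  by (auto simp: Pi_star_def circuits_def PiE_iff)

lemma card_Pi_star_fibers: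
  assumes "j \<le> length w"
  shows "(\<Sum>\<pi>\<in>Pi_star \<theta> n w. f (\<pi> j)) = (\<Sum>x\<in>{1..n}. card {\<pi> \<in> Pi_star \<theta> n w. \<pi> j = x} * (f x :: nat))"
proof -
  have "(\<Sum>\<pi>\<in>Pi_star \<theta> n w. f (\<pi> j)) = (\<Sum>x\<in>{1..n}. \<Sum>\<pi>\<in>{\<pi> \<in> Pi_star \<theta> n w. \<pi> j = x}. f (\<pi> j))"
    by (rule sum.group[symmetric]) (use Pi_star_mem assms in auto)
  then show ?thesis by simp
qed

lemma pair_matched_delete:
  assumes "\<forall>b\<in>set (u @ [a, a] @ v). count_list (u @ [a, a] @ v) b = 2"
  shows "a \<notin> set (u @ v)" "\<forall>b\<in>set (u @ v). count_list (u @ v) b = 2"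
proof -
  have "count_list (u @ [a, a] @ v) a = 2" using assms by auto
  then show a: "a \<notin> set (u @ v)" by (auto simp: count_list_0_iff)
  show "\<forall>b\<in>set (u @ v). count_list (u @ v) b = 2"
  proof
    fix b assume b: "b \<in> set (u @ v)"
    then have "count_list (u @ [a, a] @ v) b = 2" using assms by auto
    moreover have "b \<noteq> a" using a b by auto
    ultimately show "count_list (u @ v) b = 2" by simp
  qed
qed

text \<open>A detour that returns to the same vertex shows that insertion loses nothing. The count
  is made with one vertex pinned because the gain below weights circuits by the value of a vertex.
  If the pinned vertex is the new middle one, all shorter circuits remain available; otherwise it is
  an old vertex and the middle one has n choices.\<close>

lemma card_Pi_star_fiber_ge:
  assumes "reduces_to_empty w" "\<forall>a\<in>set w. count_list w a = 2" "j \<le> length w" "x \<in> {1..n}"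
  shows "n ^ (length w div 2) \<le> card {\<pi> \<in> Pi_star \<theta> n w. \<pi> j = x}"
  using assms
proof (induction arbitrary: j x rule: reduces_to_empty.induct)
  case empty
  have "(\<lambda>_. undefined)(0 := x) \<in> {\<pi> \<in> Pi_star \<theta> n []. \<pi> j = x}"
    using empty by (auto simp: Pi_star_def circuits_def split: if_splits)
  then have "0 < card {\<pi> \<in> Pi_star \<theta> n []. \<pi> j = x}"
    by (subst card_gt_0_iff) auto
  then show ?case by simp
next
  case (delete u v a)
  note pm = pair_matched_delete[OF delete.prems(1)]
  let ?l = "length u" and ?h = "length (u @ v)" and ?w = "u @ [a, a] @ v"
  let ?d = "\<lambda>\<pi> t. detour ?l \<pi> (\<pi> ?l) t (\<pi> ?l)"
  have IH: "n ^ (?h div 2) \<le> card {\<pi> \<in> Pi_star \<theta> n (u @ v). \<pi> i = y}" if "i \<le> ?h" "y \<in> {1..n}" for i y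
    using delete.IH pm(2) that by blast
  have mem: "?d \<pi> t \<in> Pi_star \<theta> n ?w" if "\<pi> \<in> Pi_star \<theta> n (u @ v)" "t \<in> {1..n}" for \<pi> t
  proof (rule detour_in_Pi_star[OF that(1) pm(1) that(2)])
    show "\<pi> ?l \<in> {1..n}" "\<pi> ?l \<in> {1..n}" using Pi_star_mem[OF that(1), of ?l] by auto
    have "\<pi> 0 = \<pi> ?h" using that(1) by (auto simp: Pi_star_def circuits_def)
    moreover have "?d \<pi> t 0 = \<pi> 0" "?d \<pi> t (?h + 2) = \<pi> ?h" by (auto simp: detour_def)
    ultimately show "?d \<pi> t 0 = ?d \<pi> t (?h + 2)" by (simp only:)
  qed auto
  have rec: "\<pi> i = (if i < ?l then ?d \<pi> t i else ?d \<pi> t (i + 2))" "t = ?d \<pi> t (?l + 1)" for \<pi> t i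
    by (auto simp: detour_def)
  have inj: "\<pi> = \<pi>' \<and> t = t'" if "?d \<pi> t = ?d \<pi>' t'" for \<pi> \<pi>' t t'
    using that rec(1)[of \<pi> _ t] rec(1)[of \<pi>' _ t'] rec(2)[of t \<pi>] rec(2)[of t' \<pi>']
    by (metis ext)
  have len: "length ?w div 2 = Suc (?h div 2)" by simp
  show ?case
  proof (cases "j = ?l + 1")
    case True
    have "n ^ (length ?w div 2) = (\<Sum>y\<in>{1..n}. n ^ (?h div 2) * 1)" by (simp add: len)
    also have "\<dots> \<le> (\<Sum>y\<in>{1..n}. card {\<pi> \<in> Pi_star \<theta> n (u @ v). \<pi> 0 = y} * 1)"
      using IH[of 0] by (intro sum_mono mult_right_mono) auto
    also have "\<dots> = card (Pi_star \<theta> n (u @ v))"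
      using card_Pi_star_fibers[of 0 "u @ v" "\<lambda>_. 1" \<theta> n] by simp
    also have "\<dots> \<le> card {\<pi> \<in> Pi_star \<theta> n ?w. \<pi> j = x}"
    proof (rule card_inj_on_le[of "\<lambda>\<pi>. ?d \<pi> x"])
      show "inj_on (\<lambda>\<pi>. ?d \<pi> x) (Pi_star \<theta> n (u @ v))" by (rule inj_onI) (blast dest: inj)
      have "?d \<pi> x j = x" for \<pi> using True by (simp add: detour_def)
      then show "(\<lambda>\<pi>. ?d \<pi> x) ` Pi_star \<theta> n (u @ v) \<subseteq> {\<pi> \<in> Pi_star \<theta> n ?w. \<pi> j = x}"
        using mem[OF _ delete.prems(3)] by (intro image_subsetI CollectI conjI)
    qed simp
    finally show ?thesis .
  next
    case False
    let ?i = "if j \<le> ?l then j else j - 2"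
    have "?i \<le> ?h" using delete.prems(2) False by auto
    then have "n ^ (length ?w div 2) \<le> card ({\<pi> \<in> Pi_star \<theta> n (u @ v). \<pi> ?i = x} \<times> {1..n})"
      using IH[of ?i x] delete.prems(3) by (simp add: len card_cartesian_product)
    also have "\<dots> \<le> card {\<pi> \<in> Pi_star \<theta> n ?w. \<pi> j = x}"
    proof (rule card_inj_on_le[of "\<lambda>(\<pi>, t). ?d \<pi> t"])
      show "inj_on (\<lambda>(\<pi>, t). ?d \<pi> t) ({\<pi> \<in> Pi_star \<theta> n (u @ v). \<pi> ?i = x} \<times> {1..n})"
        by (rule inj_onI) (clarsimp, blast dest: inj)
      have "?d \<pi> t j = \<pi> ?i" for \<pi> t
        using False by (auto simp: detour_def)
      then show "(\<lambda>(\<pi>, t). ?d \<pi> t) ` ({\<pi> \<in> Pi_star \<theta> n (u @ v). \<pi> ?i = x} \<times> {1..n})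
          \<subseteq> {\<pi> \<in> Pi_star \<theta> n ?w. \<pi> j = x}"
        using mem by (intro image_subsetI CollectI conjI) auto
    qed simp
    finally show ?thesis .
  qed
qed

text \<open>Grouping by residues turns the sum into the sum of squared class sizes. The m sizes add
  up to n, so Cauchy-Schwarz gives n^2 / m even when the classes are of unequal size.\<close>

lemma sum_card_lifts_ge:
  assumes "m > 0"
  shows "real n ^ 2 / real m \<le> (\<Sum>x\<in>{1..n}. real (card (lifts n m (int x))))"
proof -
  define c where "c r = card {v \<in> {1..n}. v mod m = r}" for r
  have "real n = (\<Sum>x\<in>{1..n}. 1)" by simp
  also have "\<dots> = (\<Sum>r<m. \<Sum>x\<in>{x \<in> {1..n}. x mod m = r}. 1)"
    by (rule sum.group[symmetric]) (use assms in auto)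
  also have "\<dots> = (\<Sum>r<m. real (c r))" by (simp add: c_def)
  finally have n: "real n = (\<Sum>r<m. real (c r))" .
  have "(\<Sum>x\<in>{1..n}. real (card (lifts n m (int x)))) = (\<Sum>x\<in>{1..n}. real (c (x mod m)))"
    unfolding c_def lifts_def by (simp add: zmod_int[symmetric])
  also have "\<dots> = (\<Sum>r<m. \<Sum>x\<in>{x \<in> {1..n}. x mod m = r}. real (c (x mod m)))"
    by (rule sum.group[symmetric]) (use assms in auto)
  also have "\<dots> = (\<Sum>r<m. (real (c r))\<^sup>2)" by (simp add: c_def power2_eq_square)
  finally have "(real n)\<^sup>2 \<le> real m * (\<Sum>x\<in>{1..n}. real (card (lifts n m (int x))))"
    using sum_squared_le_sum_of_squares[of "\<lambda>r. real (c r)" "{..<m}"] unfolding n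
        by (simp add: mult.commute)
  then show ?thesis using assms by (simp add: field_simps)
qed

text \<open>A shorter circuit, a middle vertex and a second copy of the split vertex, congruent to
  the first, can be recovered from the resulting circuit. The number of copies depends on the value
  of the split vertex, and the fiber bound spreads the shorter circuits over all values.\<close>

lemma card_Pi_star_catalan_ge:
  assumes "reduces_to_empty (u @ v)" "u @ v \<noteq> []"
    and w: "\<forall>b\<in>set (u @ [a, a] @ v). count_list (u @ [a, a] @ v) b = 2"
    and m: "modulus \<theta> n > 0"
  shows "real n ^ (length (u @ v) div 2 + 1) * (real n ^ 2 / real (modulus \<theta> n))
      \<le> real (card (Pi_star \<theta> n (u @ [a, a] @ v)))"
proof -
  note pm = pair_matched_delete[OF w]
  let ?l = "length u" and ?h = "length (u @ v)" and ?w = "u @ [a, a] @ v" and ?m = "modulus \<theta> n"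
  \<comment> \<open>The copy that varies must not be an end of the circuit. For empty
    \<open>u\<close> the first copy is vertex 0, so the second varies; it is not the last vertex
    because \<open>u @ v\<close> is nonempty. Otherwise the first copy varies, which also covers
    empty \<open>v\<close>, where the second copy is the last vertex.\<close>
  define d where "d \<pi> x t = (if ?l = 0 then detour ?l \<pi> (\<pi> ?l) x t else detour ?l \<pi> t x (\<pi> ?l))"
      for \<pi> x t
  let ?S = "SIGMA \<pi> : Pi_star \<theta> n (u @ v). {1..n} \<times> lifts n ?m (int (\<pi> ?l))"
  have mem: "d \<pi> x t \<in> Pi_star \<theta> n ?w" if \<pi>: "\<pi> \<in> Pi_star \<theta> n (u @ v)" and x: "x \<in> {1..n}" and t: "t \<in>
      lifts n ?m (int (\<pi> ?l))" for \<pi> x t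
  proof -
    have t: "t \<in> {1..n}" "t mod ?m = \<pi> ?l mod ?m"
      using t by (auto simp: lifts_def zmod_int[symmetric])
    have l: "\<pi> ?l \<in> {1..n}" using Pi_star_mem[OF \<pi>, of ?l] by auto
    have c: "\<pi> 0 = \<pi> ?h" using \<pi> by (auto simp: Pi_star_def circuits_def)
    show ?thesis
    proof (cases "?l = 0")
      case True
      have "detour ?l \<pi> (\<pi> ?l) x t 0 = \<pi> 0" "detour ?l \<pi> (\<pi> ?l) x t (?h + 2) = \<pi> ?h"
        using True assms(2) by (auto simp: detour_def)
      with c have "detour ?l \<pi> (\<pi> ?l) x t \<in> Pi_star \<theta> n ?w"
        by (intro detour_in_Pi_star \<pi> pm x t l refl) (simp only:)
      with True show ?thesis by (simp add: d_def)
    next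
      case False
      have "detour ?l \<pi> t x (\<pi> ?l) 0 = \<pi> 0" "detour ?l \<pi> t x (\<pi> ?l) (?h + 2) = \<pi> ?h"
        using False by (auto simp: detour_def)
      with c have "detour ?l \<pi> t x (\<pi> ?l) \<in> Pi_star \<theta> n ?w"
        by (intro detour_in_Pi_star \<pi> pm x t l refl) (simp only:)
      with False show ?thesis by (simp add: d_def)
    qed
  qed
  have inj: "\<pi> = \<pi>' \<and> x = x' \<and> t = t'" if "d \<pi> x t = d \<pi>' x' t'" for \<pi> \<pi>' x x' t t'
  proof -
    have vertices: "(if i < ?l \<or> ?l = 0 \<and> i = 0 then d \<pi> x t i else d \<pi> x t (i + 2)) = \<pi> i" for \<pi> x t i
      by (auto simp: d_def detour_def)
    have "\<pi> i = \<pi>' i" for i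
      using vertices[of i \<pi> x t] vertices[of i \<pi>' x' t'] unfolding that by (rule subst)
    moreover have "d \<pi> x t (?l + 1) = x" for \<pi> x t
      by (auto simp: d_def detour_def)
    then have "x = x'" using that by metis
    moreover have "d \<pi> x t (if ?l = 0 then ?l + 2 else ?l) = t" for \<pi> x t
      by (auto simp: d_def detour_def)
    then have "t = t'" using that by metis
    ultimately show ?thesis by blast
  qed
  have "card ?S \<le> card (Pi_star \<theta> n ?w)"
  proof (rule card_inj_on_le[of "\<lambda>(\<pi>, x, t). d \<pi> x t"])
    show "inj_on (\<lambda>(\<pi>, x, t). d \<pi> x t) ?S"
      by (rule inj_onI) (clarsimp, blast dest: inj)
    show "(\<lambda>(\<pi>, x, t). d \<pi> x t) ` ?S \<subseteq> Pi_star \<theta> n ?w"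
      using mem by auto
  qed simp
  moreover have "card ?S = (\<Sum>\<pi>\<in>Pi_star \<theta> n (u @ v). n * card (lifts n ?m (int (\<pi> ?l))))"
    by (subst card_SigmaI) (auto simp: card_cartesian_product)
  also have "\<dots> = (\<Sum>x\<in>{1..n}. card {\<pi> \<in> Pi_star \<theta> n (u @ v). \<pi> ?l = x} * (n * card (lifts n ?m (int x))))"
    by (rule card_Pi_star_fibers) simp
  also have "\<dots> \<ge> (\<Sum>x\<in>{1..n}. n ^ (?h div 2) * (n * card (lifts n ?m (int x))))"
    using card_Pi_star_fiber_ge[OF assms(1) pm(2), of ?l] by (intro sum_mono mult_right_mono) auto
  ultimately have "(\<Sum>x\<in>{1..n}. n ^ (?h div 2) * (n * card (lifts n ?m (int x)))) \<le> card (Pi_star \<theta> n ?w)"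
    by linarith
  then have "real (\<Sum>x\<in>{1..n}. n ^ (?h div 2) * (n * card (lifts n ?m (int x))))
      \<le> real (card (Pi_star \<theta> n ?w))"
    by (simp only: of_nat_le_iff)
  also have "real (\<Sum>x\<in>{1..n}. n ^ (?h div 2) * (n * card (lifts n ?m (int x)))) =
      real n ^ (?h div 2 + 1) * (\<Sum>x\<in>{1..n}. real (card (lifts n ?m (int x))))"
    by (simp add: sum_distrib_left mult_ac)
  finally show ?thesis
    using mult_left_mono[OF sum_card_lifts_ge[OF m, of n], of "real n ^ (?h div 2 + 1)"] by simp
qed

text \<open>A Catalan word of length at least 4 arises from a nonempty Catalan word by one
  insertion. That insertion gains n / m \<ge> \<theta> for all large n, and the lower bound passes
  to the limit.\<close>

theorem word_limit_catalan:
  assumes \<theta>: "\<theta> > 0" and w: "w \<in> catalan_words k" and k: "k \<ge> 2"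
  shows "\<theta> \<le> word_limit \<theta> w"
proof -
  have len: "length w = 2 * k" and red: "reduces_to_empty w" and pm: "\<forall>a\<in>set w. count_list w a = 2"
    using w by (auto simp: catalan_words_def pair_matched_words_def pair_matched_def)
  have ne: "w \<noteq> []" using len k by auto
  from red ne obtain u v a where uv: "w = u @ [a, a] @ v" "reduces_to_empty (u @ v)"
    by (cases rule: reduces_to_empty.cases) auto
  have len': "length (u @ v) = 2 * (k - 1)" using len uv by simp
  then have ne': "u @ v \<noteq> []" using k by auto
  have "eventually (\<lambda>n. \<theta> \<le> word_freq \<theta> w n) sequentially"
    using eventually_modulus[OF \<theta>] eventually_gt_at_top[of 0]
  proof eventually_elim
    case (elim n)
    have "real n ^ k * (real n ^ 2 / real (modulus \<theta> n)) \<le> real (card (Pi_star \<theta> n w))"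
      using card_Pi_star_catalan_ge[OF uv(2) ne' pm[unfolded uv(1)], of \<theta> n] elim len' k unfolding uv(1)
      by (cases k) auto
    then have "real n ^ (k + 1) * (real n / real (modulus \<theta> n)) \<le> real (card (Pi_star \<theta> n w))"
      by (simp add: power2_eq_square mult_ac)
    then have "real n / real (modulus \<theta> n) \<le> word_freq \<theta> w n"
      using elim len by (simp add: word_freq_def field_simps)
    then show ?case using elim by simp
  qed
  moreover have "word_freq \<theta> w \<longlonglongrightarrow> word_limit \<theta> w"
    using convergent_word_freq[OF \<theta> ne pm] by (simp add: word_limit_def convergent_LIMSEQ_iff)
  ultimately show ?thesis
    by (intro tendsto_lowerbound) auto
qed

subsection \<open>Link patterns of circuits\<close>

lemma remdups_map_inj_on: "inj_on f (set xs) \<Longrightarrow> remdups (map f xs) = map f (remdups xs)"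
  by (induction xs) (auto simp: inj_on_def)

lemma first_letters_map:
  "inj_on f (set xs) \<Longrightarrow> rev (remdups (rev (map f xs))) = map f (rev (remdups (rev xs)))"
  using remdups_map_inj_on[of f "rev xs"] by (simp add: rev_map)

lemma same_pattern_map:
  assumes "length u = length v" "\<And>i j. i < length u \<Longrightarrow> j < length u \<Longrightarrow> u ! i = u ! j \<Longrightarrow> v ! i = v ! j"
  shows "\<exists>f. v = map f u"
proof -
  define f where "f x = v ! (SOME i. i < length u \<and> u ! i = x)" for x
  have "f (u ! i) = v ! i" if "i < length u" for i
  proof -
    have "(SOME j. j < length u \<and> u ! j = u ! i) < length u \<and> u ! (SOME j. j < length u \<and> u ! j
        = u ! i) = u ! i"
      by (rule someI[of _ i]) (use that in auto)
    then show ?thesis unfolding f_def using assms(2) that by blast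
  qed
  then show ?thesis using assms(1) by (intro exI[of _ f] nth_equalityI) auto
qed

text \<open>Each entry is relabelled by its rank in the order of first occurrence.\<close>

lemma exists_word_pattern:
  "\<exists>f. inj_on f (set xs) \<and> is_word (map f xs)"
proof -
  let ?d = "rev (remdups (rev xs))"
  have d: "distinct ?d" "set ?d = set xs" by auto
  define f where "f x = (THE i. i < length ?d \<and> ?d ! i = x)" for x
  have f: "f (?d ! i) = i" if "i < length ?d" for i
    unfolding f_def
  proof (rule the_equality)
    fix j assume "j < length ?d \<and> ?d ! j = ?d ! i"
    then show "j = i" using that d(1) nth_eq_iff_index_eq by metis
  qed (use that in blast)
  have map: "map f ?d = [0..<length ?d]"
  proof (rule nth_equalityI)
    fix i assume "i < length (map f ?d)"
    then have i: "i < length ?d" by (simp only: length_map)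
    then show "map f ?d ! i = [0..<length ?d] ! i" using f[OF i] by (simp only: nth_map) simp
  qed simp
  then have "distinct (map f ?d)" by (simp only: distinct_upt)
  then have inj: "inj_on f (set xs)" using d(2) by (metis distinct_map)
  have "card (set (map f xs)) = card (set xs)" using card_image[OF inj] by simp
  also have "\<dots> = length ?d" using distinct_card[OF d(1)] d(2) by simp
  finally have "is_word (map f xs)"
    unfolding is_word_def first_letters_map[OF inj] map by simp
  with inj show ?thesis by blast
qed

text \<open>Injective relabelling preserves the order of first occurrences. That order reads 0, 1,
  2, ... in both words, so the relabelling is the identity on letters.\<close>

lemma word_pattern_unique:
  assumes "is_word u" "is_word (map g u)" "inj_on g (set u)"
  shows "map g u = u"
proof -
  have "card (set (map g u)) = card (set u)" using card_image[OF assms(3)] by simp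
  then have m: "map g [0..<card (set u)] = [0..<card (set u)]"
    using assms(1,2) first_letters_map[OF assms(3)] unfolding is_word_def by simp
  have g: "g i = i" if "i < card (set u)" for i
    using that arg_cong[OF m, of "\<lambda>xs. xs ! i"] by simp
  have "set u = {..<card (set u)}"
    using arg_cong[OF assms(1)[unfolded is_word_def], of set] by (simp add: lessThan_atLeast0)
  then show ?thesis using g by (intro map_idI) auto
qed

section \<open>Circuits sorted by the multiplicities of their link values\<close>

definition links :: "real \<Rightarrow> nat \<Rightarrow> (nat \<Rightarrow> nat) \<Rightarrow> nat \<Rightarrow> nat" where
  "links \<theta> n \<pi> i = link \<theta> n (\<pi> (i - 1)) (\<pi> i)"

definition link_mult :: "real \<Rightarrow> nat \<Rightarrow> nat \<Rightarrow> (nat \<Rightarrow> nat) \<Rightarrow> nat \<Rightarrow> nat" where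
  "link_mult \<theta> n h \<pi> v = card {i \<in> {1..h}. links \<theta> n \<pi> i = v}"

definition pair_circuits :: "real \<Rightarrow> nat \<Rightarrow> nat \<Rightarrow> (nat \<Rightarrow> nat) set" where
  "pair_circuits \<theta> n k = {\<pi> \<in> circuits n (2 * k). \<forall>v\<in>links \<theta> n \<pi> ` {1..2 * k}. link_mult \<theta> n (2 * k) \<pi>
      v = 2}"

definition sparse_circuits :: "real \<Rightarrow> nat \<Rightarrow> nat \<Rightarrow> (nat \<Rightarrow> nat) set" where
  "sparse_circuits \<theta> n k = {\<pi> \<in> circuits n (2 * k). card (links \<theta> n \<pi> ` {1..2 * k}) < k}"

lemma sum_link_mult: "(\<Sum>v\<in>links \<theta> n \<pi> ` {1..h}. link_mult \<theta> n h \<pi> v) = h"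
  using sum.image_gen[of "{1..h}" "\<lambda>_. 1 :: nat" "links \<theta> n \<pi>"] by (simp add: link_mult_def)

lemma prod_links:
  "(\<Prod>i\<in>{1..h}. f (links \<theta> n \<pi> i)) = (\<Prod>v\<in>links \<theta> n \<pi> ` {1..h}. f v ^ link_mult \<theta> n h \<pi> v)"
  for f :: "nat \<Rightarrow> 'b::comm_monoid_mult"
  using prod.image_gen[of "{1..h}" "\<lambda>i. f (links \<theta> n \<pi> i)" "links \<theta> n \<pi>"]
  by (simp add: link_mult_def)

lemma link_mult_pos: "v \<in> links \<theta> n \<pi> ` {1..h} \<Longrightarrow> link_mult \<theta> n h \<pi> v > 0"
  by (auto simp: link_mult_def card_gt_0_iff)

lemma link_mult_le: "link_mult \<theta> n h \<pi> v \<le> h"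
  unfolding link_mult_def by (rule order_trans[OF card_mono[of "{1..h}"]]) auto

lemma link_mult_eq_count: "link_mult \<theta> n h \<pi> v = count_list (map (links \<theta> n \<pi>) [1..<h + 1]) v"
proof -
  have "count_list (map (links \<theta> n \<pi>) [1..<h + 1]) v = length (filter (\<lambda>i. v
      = links \<theta> n \<pi> i) [1..<h + 1])"
    by (simp add: count_list_eq_length_filter filter_map o_def del: upt_Suc)
  also have "\<dots> = card (set (filter (\<lambda>i. v = links \<theta> n \<pi> i) [1..<h + 1]))"
    by (rule distinct_card[symmetric]) (simp del: upt_Suc)
  also have "set (filter (\<lambda>i. v = links \<theta> n \<pi> i) [1..<h + 1]) = {i \<in> {1..h}. links \<theta> n \<pi> i = v}"
    by auto
  finally show ?thesis by (simp only: link_mult_def)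
qed

text \<open>The multiplicities add up to 2k. If none is 1, all are at least 2; if moreover one
  exceeds 2, there are fewer than k values. In the expected trace the three cases give 0, give 1,
  and are negligible.\<close>

lemma links_cases:
  assumes "\<pi> \<in> circuits n (2 * k)"
  obtains (single) v where "v \<in> links \<theta> n \<pi> ` {1..2 * k}" "link_mult \<theta> n (2 * k) \<pi> v = 1"
  | (pair) "\<pi> \<in> pair_circuits \<theta> n k"
  | (sparse) "\<pi> \<in> sparse_circuits \<theta> n k" "\<pi> \<notin> pair_circuits \<theta> n k"
proof (cases "\<exists>v\<in>links \<theta> n \<pi> ` {1..2 * k}. link_mult \<theta> n (2 * k) \<pi> v = 1")
  case False
  let ?V = "links \<theta> n \<pi> ` {1..2 * k}" and ?m = "link_mult \<theta> n (2 * k) \<pi>"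
  have two: "?m v \<ge> 2" if "v \<in> ?V" for v
    using link_mult_pos[OF that] False that by (metis One_nat_def Suc_1 Suc_leI le_neq_implies_less)
  show thesis
  proof (cases "\<pi> \<in> pair_circuits \<theta> n k")
    case False
    then obtain v where v: "v \<in> ?V" "?m v \<noteq> 2" using assms by (auto simp: pair_circuits_def)
    have "(\<Sum>v\<in>?V. 2) < (\<Sum>v\<in>?V. ?m v)"
    proof (rule sum_strict_mono_ex1)
      show "\<exists>v\<in>?V. 2 < ?m v" using two[OF v(1)] v by (intro bexI[of _ v]) auto
    qed (use two in auto)
    then have "card ?V < k" unfolding sum_link_mult by simp
    then show thesis using assms False sparse by (auto simp: sparse_circuits_def)
  qed (rule pair)
qed (use single in blast)

lemma Pi_star_pattern:
  assumes "\<pi> \<in> Pi_star \<theta> n w"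
  obtains f where "map (links \<theta> n \<pi>) [1..<length w + 1] = map f w"
proof -
  have "\<exists>f. map (links \<theta> n \<pi>) [1..<length w + 1] = map f w"
  proof (rule same_pattern_map)
    fix i j assume ij: "i < length w" "j < length w" "w ! i = w ! j"
    have "links \<theta> n \<pi> i' = links \<theta> n \<pi> j'"
      if "i' \<in> {1..length w}" "j' \<in> {1..length w}" "w ! (i' - 1) = w ! (j' - 1)" for i' j'
      using assms that unfolding Pi_star_def links_def by blast
    from this[of "i + 1" "j + 1"] have "links \<theta> n \<pi> (i + 1) = links \<theta> n \<pi> (j + 1)"
      using ij by simp
    then show "map (links \<theta> n \<pi>) [1..<length w + 1] ! i = map (links \<theta> n \<pi>) [1..<length w + 1] ! j"
      using ij by (simp del: upt_Suc)
  qed (simp del: upt_Suc)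
  then show thesis using that by blast
qed

text \<open>The link values are the image of the k letters under \<open>f\<close>; if there are at
  least k of them, no two letters are identified.\<close>

lemma Pi_star_inj_pattern:
  assumes w: "w \<in> pair_matched_words k" and \<pi>: "\<pi> \<in> Pi_star \<theta> n w" "\<pi> \<notin> sparse_circuits \<theta> n k"
  shows "\<exists>f. map (links \<theta> n \<pi>) [1..<2 * k + 1] = map f w \<and> inj_on f (set w)"
proof -
  have len: "length w = 2 * k" and pm: "\<forall>a\<in>set w. count_list w a = 2"
    using w by (auto simp: pair_matched_words_def pair_matched_def)
  obtain f where f: "map (links \<theta> n \<pi>) [1..<2 * k + 1] = map f w"
    using Pi_star_pattern[OF \<pi>(1)] unfolding len by blast
  have "k \<le> card (links \<theta> n \<pi> ` {1..2 * k})"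
    using \<pi> len by (auto simp: sparse_circuits_def Pi_star_def)
  also have "links \<theta> n \<pi> ` {1..2 * k} = f ` set w"
    using arg_cong[OF f, of set] by (simp add: atLeastLessThanSuc_atLeastAtMost del: upt_Suc)
  finally have "card (set w) \<le> card (f ` set w)"
    using card_set_pair_matched[OF pm] len by simp
  then have "inj_on f (set w)"
    using card_image_le[of "set w" f] by (intro eq_card_imp_inj_on) auto
  with f show ?thesis by (intro exI conjI)
qed

lemma Pi_star_pair_or_sparse:
  assumes w: "w \<in> pair_matched_words k" and \<pi>: "\<pi> \<in> Pi_star \<theta> n w"
  shows "\<pi> \<in> pair_circuits \<theta> n k \<union> sparse_circuits \<theta> n k"
proof (rule ccontr)
  assume *: "\<not> ?thesis"
  have len: "length w = 2 * k" and pm: "\<forall>a\<in>set w. count_list w a = 2"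
    using w by (auto simp: pair_matched_words_def pair_matched_def)
  have "\<pi> \<notin> sparse_circuits \<theta> n k" using * by blast
  from Pi_star_inj_pattern[OF w \<pi> this]
  obtain f where f: "map (links \<theta> n \<pi>) [1..<2 * k + 1] = map f w" "inj_on f (set w)"
    by (elim exE conjE)
  note mult = link_mult_eq_count[where \<theta> = \<theta> and n = n and h = "2 * k" and \<pi> = \<pi>]
  have two: "link_mult \<theta> n (2 * k) \<pi> (f a) = 2" if "a \<in> set w" for a
  proof -
    have "count_list (map f w) (f a) = count_list w a"
      using f(2) that by (rule count_list_inj_map)
    then show ?thesis using pm that unfolding mult f(1) by simp
  qed
  have img: "links \<theta> n \<pi> ` {1..2 * k} = f ` set w"
    using arg_cong[OF f(1), of set] by (simp add: atLeastLessThanSuc_atLeastAtMost del: upt_Suc)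
  have "\<pi> \<in> circuits n (2 * k)" using \<pi> len by (simp add: Pi_star_def)
  then have "\<pi> \<in> pair_circuits \<theta> n k" unfolding pair_circuits_def mem_Collect_eq img using two by blast
  with * show False by blast
qed

lemma pair_not_sparse: "\<pi> \<in> pair_circuits \<theta> n k \<Longrightarrow> \<pi> \<notin> sparse_circuits \<theta> n k"
proof
  assume p: "\<pi> \<in> pair_circuits \<theta> n k" and s: "\<pi> \<in> sparse_circuits \<theta> n k"
  have "(\<Sum>v\<in>links \<theta> n \<pi> ` {1..2 * k}. 2) = (\<Sum>v\<in>links \<theta> n \<pi> ` {1..2 * k}. link_mult \<theta> n (2 * k) \<pi> v)"
    using p by (intro sum.cong) (auto simp: pair_circuits_def)
  also have "\<dots> = 2 * k" by (rule sum_link_mult)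
  finally show False using s by (simp add: sparse_circuits_def)
qed

text \<open>The word is the relabelled sequence of link values. Any other candidate also has the
  link sequence as an injective relabelling, because a pair circuit has k values, so the two words
  are relabellings of each other.\<close>

lemma pair_circuit_word:
  assumes \<pi>: "\<pi> \<in> pair_circuits \<theta> n k"
  shows "\<exists>!w. w \<in> pair_matched_words k \<and> \<pi> \<in> Pi_star \<theta> n w"
proof -
  let ?ls = "map (links \<theta> n \<pi>) [1..<2 * k + 1]"
  have c: "\<pi> \<in> circuits n (2 * k)" using \<pi> by (simp add: pair_circuits_def)
  have nth: "map f ?ls ! (i - 1) = f (links \<theta> n \<pi> i)" if "i \<in> {1..2 * k}" for f :: "nat \<Rightarrow> nat" and i
    using that by (cases i) (auto simp del: upt_Suc)
  obtain g where g: "inj_on g (set ?ls)" "is_word (map g ?ls)"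
    using exists_word_pattern[of ?ls] by blast
  let ?w = "map g ?ls"
  note mult = link_mult_eq_count[where \<theta> = \<theta> and n = n and h = "2 * k" and \<pi> = \<pi>, symmetric]
  have "count_list ?w a = 2" if "a \<in> set ?w" for a
  proof -
    have "a \<in> g ` set ?ls" using that by (subst (asm) list.set_map)
    then obtain v where v: "a = g v" "v \<in> set ?ls" by (rule imageE)
    have "count_list ?w a = count_list ?ls v"
      unfolding v(1) using g(1) v(2) by (rule count_list_inj_map)
    also have "\<dots> = 2"
      using \<pi> v(2) unfolding mult by (auto simp: pair_circuits_def simp del: upt_Suc)
    finally show ?thesis .
  qed
  then have w: "?w \<in> pair_matched_words k"
    using g(2) by (auto simp: pair_matched_words_def pair_matched_def simp del: upt_Suc)
  have "\<pi> \<in> Pi_star \<theta> n ?w"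
    unfolding Pi_star_def
  proof (intro CollectI conjI ballI impI)
    show "\<pi> \<in> circuits n (length ?w)" using c by (simp del: upt_Suc)
    fix i j assume ij: "i \<in> {1..length ?w}" "j \<in> {1..length ?w}" and eq: "?w ! (i - 1) = ?w ! (j - 1)"
    then have ij: "i \<in> {1..2 * k}" "j \<in> {1..2 * k}" by (simp_all del: upt_Suc)
    then have "g (links \<theta> n \<pi> i) = g (links \<theta> n \<pi> j)"
      using eq nth by metis
    then have "links \<theta> n \<pi> i = links \<theta> n \<pi> j"
      using g(1) ij by (auto simp: inj_on_def simp del: upt_Suc)
    then show "link \<theta> n (\<pi> (i - 1)) (\<pi> i) = link \<theta> n (\<pi> (j - 1)) (\<pi> j)" by (simp add: links_def)
  qed
  moreover have "u = v" if u: "u \<in> pair_matched_words k" "\<pi> \<in> Pi_star \<theta> n u"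
    and v: "v \<in> pair_matched_words k" "\<pi> \<in> Pi_star \<theta> n v" for u v
  proof -
    from Pi_star_inj_pattern[OF u pair_not_sparse[OF \<pi>]]
    obtain f where f: "?ls = map f u" "inj_on f (set u)"
      by (elim exE conjE)
    from Pi_star_inj_pattern[OF v pair_not_sparse[OF \<pi>]]
    obtain g where g: "?ls = map g v" "inj_on g (set v)"
      by (elim exE conjE)
    \<comment> \<open>Going from \<open>u\<close> to link values and back along \<open>g\<close>
      relabels \<open>u\<close> as \<open>v\<close> injectively.\<close>
    let ?h = "the_inv_into (set v) g \<circ> f"
    have fg: "map f u = map g v" using f(1) g(1) by simp
    then have img: "f ` set u = g ` set v" by (metis list.set_map)
    have "map ?h u = map (the_inv_into (set v) g) (map g v)"
      unfolding fg[symmetric] by simp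
    also have "\<dots> = v"
      using g(2) by (simp add: map_idI the_inv_into_f_f)
    finally have hu: "map ?h u = v" .
    have "inj_on ?h (set u)"
      using f(2) inj_on_the_inv_into[OF g(2)] unfolding img[symmetric] by (intro comp_inj_on)
    then have "map ?h u = u"
      using u(1) v(1) hu by (intro word_pattern_unique) (auto simp: pair_matched_words_def
          pair_matched_def)
    with hu show ?thesis by simp
  qed
  ultimately show ?thesis using w by blast
qed

text \<open>Every pair circuit is counted for exactly one word. The remaining members of the sets
  \<open>Pi_star \<theta> n w\<close> are sparse, and each is counted at most once per word.\<close>

lemma sum_card_Pi_star:
  "\<bar>(\<Sum>w\<in>pair_matched_words k. real (card (Pi_star \<theta> n w))) - real (card (pair_circuits \<theta> n k))\<bar>
    \<le> real (card (pair_matched_words k)) * real (card (sparse_circuits \<theta> n k))"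
proof -
  let ?W = "pair_matched_words k" and ?P = "pair_circuits \<theta> n k" and ?S = "sparse_circuits \<theta> n k"
  have fin: "finite ?P" "finite ?S"
    unfolding pair_circuits_def sparse_circuits_def by auto
  have "card (Pi_star \<theta> n w) = card (Pi_star \<theta> n w \<inter> ?P) + card (Pi_star \<theta> n w \<inter> ?S)" if "w \<in> ?W" for w
  proof -
    have "Pi_star \<theta> n w = (Pi_star \<theta> n w \<inter> ?P) \<union> (Pi_star \<theta> n w \<inter> ?S)"
      using Pi_star_pair_or_sparse[OF that] by blast
    moreover have "card ((Pi_star \<theta> n w \<inter> ?P) \<union> (Pi_star \<theta> n w \<inter> ?S))
        = card (Pi_star \<theta> n w \<inter> ?P) + card (Pi_star \<theta> n w \<inter> ?S)"
      using pair_not_sparse by (intro card_Un_disjoint) auto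
    ultimately show ?thesis by simp
  qed
  then have "(\<Sum>w\<in>?W. card (Pi_star \<theta> n w))
      = (\<Sum>w\<in>?W. card (Pi_star \<theta> n w \<inter> ?P)) + (\<Sum>w\<in>?W. card (Pi_star \<theta> n w \<inter> ?S))"
    by (simp add: sum.distrib)
  also have "(\<Sum>w\<in>?W. card (Pi_star \<theta> n w \<inter> ?P)) = card ?P"
  proof -
    have "(\<Sum>w\<in>?W. card (Pi_star \<theta> n w \<inter> ?P)) = (\<Sum>w\<in>?W. \<Sum>\<pi>\<in>?P. if \<pi> \<in> Pi_star \<theta> n w then 1 else 0)"
      using fin(1) by (intro sum.cong refl) (subst sum.inter_filter[symmetric],
          auto intro!: arg_cong[of _ _ card])
    also have "\<dots> = (\<Sum>\<pi>\<in>?P. \<Sum>w\<in>?W. if \<pi> \<in> Pi_star \<theta> n w then 1 else 0)" by (rule sum.swap)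
    also have "\<dots> = (\<Sum>\<pi>\<in>?P. 1)"
    proof (intro sum.cong refl)
      fix \<pi> assume "\<pi> \<in> ?P"
      from pair_circuit_word[OF this]
      obtain w where w: "w \<in> ?W \<and> \<pi> \<in> Pi_star \<theta> n w" "\<forall>v. v \<in> ?W \<and> \<pi> \<in> Pi_star \<theta> n v \<longrightarrow> v = w"
        by (rule ex1E)
      have "(\<Sum>v\<in>?W. if \<pi> \<in> Pi_star \<theta> n v then 1 else 0) = (\<Sum>v\<in>?W. if v = w then 1 else 0 :: nat)"
      proof (rule sum.cong[OF refl])
        fix v assume "v \<in> ?W"
        then have "\<pi> \<in> Pi_star \<theta> n v \<longleftrightarrow> v = w" using w by blast
        then show "(if \<pi> \<in> Pi_star \<theta> n v then 1 else 0) = (if v = w then 1 else 0 :: nat)"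
            by (simp only:)
      qed
      then show "(\<Sum>w\<in>?W. if \<pi> \<in> Pi_star \<theta> n w then 1 else 0) = (1 :: nat)"
        using w(1) finite_pair_matched_words by simp
    qed
    finally show ?thesis by simp
  qed
  finally have eq: "(\<Sum>w\<in>?W. card (Pi_star \<theta> n w)) = card ?P + (\<Sum>w\<in>?W. card (Pi_star \<theta> n w \<inter> ?S))" .
  have "(\<Sum>w\<in>?W. card (Pi_star \<theta> n w \<inter> ?S)) \<le> (\<Sum>w\<in>?W. card ?S)"
    using fin by (intro sum_mono card_mono) auto
  then have "(\<Sum>w\<in>?W. card (Pi_star \<theta> n w \<inter> ?S)) \<le> card ?W * card ?S" by simp
  then have "real (\<Sum>w\<in>?W. card (Pi_star \<theta> n w \<inter> ?S)) \<le> real (card ?W) * real (card ?S)"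
    by (metis of_nat_le_iff of_nat_mult)
  moreover have "(\<Sum>w\<in>?W. real (card (Pi_star \<theta> n w)))
      = real (card ?P) + real (\<Sum>w\<in>?W. card (Pi_star \<theta> n w \<inter> ?S))"
    unfolding of_nat_sum[symmetric] eq by simp
  moreover have "0 \<le> real (\<Sum>w\<in>?W. card (Pi_star \<theta> n w \<inter> ?S))" by (rule of_nat_0_le_iff)
  ultimately show ?thesis by linarith
qed

text \<open>With d < k link values there are at most a constant times n^(d+1) \<le> n^k paths, one
  power of n below the normalization. The constant \<open>B\<close> bounds the number of lifts, n /
  m + 1 \<le> 2 \<theta> + 1.\<close>

lemma sparse_circuits_negligible:
  assumes \<theta>: "\<theta> > 0" and k: "k > 0"
  shows "(\<lambda>n. real (card (sparse_circuits \<theta> n k)) / real n ^ (k + 1)) \<longlonglongrightarrow> 0"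
proof -
  define B where "B = nat \<lceil>2 * \<theta> + 1\<rceil>"
  define C where "C = k * (1 + 2 * k * B) ^ (2 * k)"
  have upper: "eventually (\<lambda>n. real (card (sparse_circuits \<theta> n k)) / real n ^ (k + 1)
      \<le> real C / real n) sequentially"
    using eventually_modulus[OF \<theta>] eventually_gt_at_top[of 0]
  proof eventually_elim
    case (elim n)
    have B: "card (lifts n (modulus \<theta> n) z) \<le> B" for z
      using card_lifts_le[of "modulus \<theta> n" n z] elim unfolding B_def by linarith
    let ?N = "\<lambda>d. {\<pi> \<in> {0..2 * k} \<rightarrow>\<^sub>E {1..n}. card ((\<lambda>i. link \<theta> n (\<pi> (i - 1)) (\<pi> i)) ` {1..2 * k}) = d}"
    have "sparse_circuits \<theta> n k \<subseteq> (\<Union>d<k. ?N d)"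
      by (auto simp: sparse_circuits_def circuits_def links_def[abs_def])
    then have "card (sparse_circuits \<theta> n k) \<le> card (\<Union>d<k. ?N d)"
      by (intro card_mono finite_UN_I finite_lessThan finite_subset[of "?N d" "{0..2 * k} \<rightarrow>\<^sub>E {1..n}"
          for d]) (auto intro!: finite_PiE)
    also have "\<dots> \<le> (\<Sum>d<k. card (?N d))"
      by (rule card_UN_le) simp
    also have "\<dots> \<le> (\<Sum>d<k. (1 + 2 * k * B) ^ (2 * k) * n ^ k)"
    proof (rule sum_mono)
      fix d assume "d \<in> {..<k}"
      then have "n ^ (d + 1) \<le> n ^ k" using elim by (intro power_increasing) auto
      then show "card (?N d) \<le> (1 + 2 * k * B) ^ (2 * k) * n ^ k"
        using card_paths_distinct_links[OF B, where h = "2 * k" and d = d]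
            by (meson mult_le_mono2 order_trans)
    qed
    also have "\<dots> = C * n ^ k" by (simp add: C_def)
    finally have "real (card (sparse_circuits \<theta> n k)) \<le> real C * real n ^ k"
      by (metis of_nat_le_iff of_nat_mult of_nat_power)
    then show ?case using elim by (simp add: field_simps)
  qed
  have lim: "(\<lambda>n. real C / real n) \<longlonglongrightarrow> 0" by real_asymp
  show ?thesis
    by (rule tendsto_sandwich[OF always_eventually upper tendsto_const lim]) simp
qed

subsection \<open>Expected traces\<close>

lemma mtrace_patterned_matrix:
  "mtrace (patterned_matrix \<theta> n x ^\<^sub>m h) =
    (\<Sum>\<pi>\<in>circuits n h. \<Prod>i\<in>{1..h}. x (links \<theta> n \<pi> i)) / sqrt (real n) ^ h"
proof -
  have "mtrace (patterned_matrix \<theta> n x ^\<^sub>m h) =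
      (\<Sum>\<pi>\<in>circuits n h. \<Prod>i\<in>{1..h}. x (link \<theta> n (\<pi> (i - 1)) (\<pi> i)) / sqrt (real n))"
    using mtrace_pow_mat[where n = n and h = h and a = "\<lambda>i j. x (link \<theta> n i j) / sqrt (real n)"]
    by (simp add: patterned_matrix_def)
  then show ?thesis
    by (simp add: links_def prod_dividef sum_divide_distrib)
qed

text \<open>The inputs for which the trace expansion is evaluated directly. Uniformly bounded inputs
  belong here, and identically distributed ones are brought here by truncation.\<close>

locale bounded_moment_inputs = prob_space M for M :: "'a measure" and X :: "nat \<Rightarrow> 'a \<Rightarrow> real" +
  assumes indep: "indep_vars (\<lambda>_. borel) X UNIV"
    and mean: "\<And>i. expectation (X i) = 0"
    and second_moment: "\<And>i. expectation (\<lambda>\<omega>. (X i \<omega>)\<^sup>2) = 1"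
    and moments: "uniformly_bounded_moments M X"
begin

lemma X_measurable [measurable]: "X i \<in> borel_measurable M"
  using indep by (auto simp: indep_vars_def)

lemma integrable_abs_power: "integrable M (\<lambda>\<omega>. \<bar>X i \<omega>\<bar> ^ m)"
  using moments by (auto simp: uniformly_bounded_moments_def)

lemma integrable_power: "integrable M (\<lambda>\<omega>. X i \<omega> ^ m)"
  by (rule integrable_abs_cancel) (simp_all add: power_abs integrable_abs_power)

lemma
  shows expectation_links: "expectation (\<lambda>\<omega>. \<Prod>i\<in>{1..h}. X (links \<theta> n \<pi> i) \<omega>) =
      (\<Prod>v\<in>links \<theta> n \<pi> ` {1..h}. expectation (\<lambda>\<omega>. X v \<omega> ^ link_mult \<theta> n h \<pi> v))"
    and integrable_links: "integrable M (\<lambda>\<omega>. \<Prod>i\<in>{1..h}. X (links \<theta> n \<pi> i) \<omega>)"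
proof -
  let ?V = "links \<theta> n \<pi> ` {1..h}" and ?m = "link_mult \<theta> n h \<pi>"
  have eq: "(\<lambda>\<omega>. \<Prod>i\<in>{1..h}. X (links \<theta> n \<pi> i) \<omega>) = (\<lambda>\<omega>. \<Prod>v\<in>?V. X v \<omega> ^ ?m v)"
    by (intro ext prod_links[where f = "\<lambda>v. X v \<omega>" for \<omega>])
  have "indep_vars (\<lambda>_. borel) X ?V" by (rule indep_vars_subset[OF indep]) auto
  then have ind: "indep_vars (\<lambda>_. borel) (\<lambda>v \<omega>. X v \<omega> ^ ?m v) ?V"
    by (rule indep_vars_compose2) measurable
  show "expectation (\<lambda>\<omega>. \<Prod>i\<in>{1..h}. X (links \<theta> n \<pi> i) \<omega>) = (\<Prod>v\<in>?V. expectation (\<lambda>\<omega>. X v \<omega> ^ ?m v))"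
    unfolding eq by (rule indep_vars_lebesgue_integral[OF _ ind]) (auto intro: integrable_power)
  show "integrable M (\<lambda>\<omega>. \<Prod>i\<in>{1..h}. X (links \<theta> n \<pi> i) \<omega>)"
    unfolding eq by (rule indep_vars_integrable[OF _ ind]) (auto intro: integrable_power)
qed

text \<open>After grouping equal link values, at most \<open>h\<close> factors remain, each a moment
  of order at most \<open>h\<close>; this makes the bound uniform over matrix size and circuit. The
  summand 1 in \<open>B\<close> ensures \<open>B \<ge> 1\<close>, so that fewer factors also obey
  B^h.\<close>

lemma expectation_links_bounded:
  "\<exists>C\<ge>0. \<forall>\<theta> n \<pi>. \<bar>expectation (\<lambda>\<omega>. \<Prod>i\<in>{1..h}. X (links \<theta> n \<pi> i) \<omega>)\<bar> \<le> C"
proof -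
  obtain b where b: "\<And>m i. expectation (\<lambda>\<omega>. \<bar>X i \<omega>\<bar> ^ m) \<le> b m"
    using moments unfolding uniformly_bounded_moments_def by metis
  define B where "B = 1 + (\<Sum>m\<le>h. \<bar>b m\<bar>)"
  have B: "B \<ge> 1" by (simp add: B_def sum_nonneg)
  have bB: "\<bar>expectation (\<lambda>\<omega>. X i \<omega> ^ m)\<bar> \<le> B" if "m \<le> h" for i m
  proof -
    have "\<bar>expectation (\<lambda>\<omega>. X i \<omega> ^ m)\<bar> \<le> expectation (\<lambda>\<omega>. \<bar>X i \<omega> ^ m\<bar>)"
      by (rule integral_abs_bound)
    also have "\<dots> \<le> b m" using b[of i m] by (simp add: power_abs)
    also have "\<dots> \<le> \<bar>b m\<bar>" by simp
    also have "\<dots> \<le> B" unfolding B_def using that member_le_sum[of m "{..h}" "\<lambda>m. \<bar>b m\<bar>"] by simp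
    finally show ?thesis .
  qed
  have "\<bar>expectation (\<lambda>\<omega>. \<Prod>i\<in>{1..h}. X (links \<theta> n \<pi> i) \<omega>)\<bar> \<le> B ^ h" for \<theta> n \<pi>
  proof -
    have "\<bar>expectation (\<lambda>\<omega>. \<Prod>i\<in>{1..h}. X (links \<theta> n \<pi> i) \<omega>)\<bar> \<le> (\<Prod>v\<in>links \<theta> n \<pi> ` {1..h}. B)"
      unfolding expectation_links abs_prod using link_mult_le bB by (intro prod_mono) auto
    also have "\<dots> \<le> B ^ h"
      using B card_image_le[of "{1..h}" "links \<theta> n \<pi>"] by (simp add: power_increasing)
    finally show ?thesis .
  qed
  then show ?thesis using B by (intro exI[of _ "B ^ h"]) auto
qed

lemma integrable_mtrace: "integrable M (\<lambda>\<omega>. mtrace (patterned_matrix \<theta> n (\<lambda>i. X i \<omega>) ^\<^sub>m h))"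
  unfolding mtrace_patterned_matrix by (intro integrable_divide Bochner_Integration.integrable_sum
      integrable_links)

theorem expected_trace_moments:
  assumes \<theta>: "\<theta> > 0" and k: "k > 0"
  shows "(\<lambda>n. expectation (\<lambda>\<omega>. mtrace (patterned_matrix \<theta> n (\<lambda>i. X i \<omega>) ^\<^sub>m (2 * k)) / real n))
    \<longlonglongrightarrow> (\<Sum>w\<in>pair_matched_words k. word_limit \<theta> w)"
proof -
  let ?W = "pair_matched_words k"
  define e where "e n \<pi> = expectation (\<lambda>\<omega>. \<Prod>i\<in>{1..2 * k}. X (links \<theta> n \<pi> i) \<omega>)" for n \<pi>
  obtain C where C: "C \<ge> 0" "\<And>n \<pi>. \<bar>e n \<pi>\<bar> \<le> C"
    using expectation_links_bounded[of "2 * k"] unfolding e_def by blast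
  define f where "f n = expectation (\<lambda>\<omega>. mtrace (patterned_matrix \<theta> n (\<lambda>i. X i \<omega>) ^\<^sub>m (2 * k)) / real
      n)" for n
  define q where "q n = real (card (sparse_circuits \<theta> n k)) / real n ^ (k + 1)" for n
  \<comment> \<open>The scaling of the entries contributes n^k over 2k edges, and the normalized
    trace one more factor n.\<close>
  have f_eq: "f n = (\<Sum>\<pi>\<in>circuits n (2 * k). e n \<pi>) / real n ^ (k + 1)" for n
  proof -
    have "expectation (\<lambda>\<omega>. \<Sum>\<pi>\<in>circuits n (2 * k). \<Prod>i\<in>{1..2 * k}. X (links \<theta> n \<pi> i) \<omega>)
        = (\<Sum>\<pi>\<in>circuits n (2 * k). e n \<pi>)"
      unfolding e_def by (intro Bochner_Integration.integral_sum integrable_links)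
    moreover have "sqrt (real n) ^ (2 * k) = real n ^ k" by (simp add: power_mult)
    ultimately show ?thesis
      unfolding f_def mtrace_patterned_matrix by (simp add: mult.commute)
  qed
  have e_eq: "\<bar>(\<Sum>\<pi>\<in>circuits n (2 * k). e n \<pi>) - real (card (pair_circuits \<theta> n k))\<bar>
      \<le> C * real (card (sparse_circuits \<theta> n k))" for n
  proof -
    \<comment> \<open>A link value used once brings a factor of mean 0; in a pair circuit every
      factor is a second moment, hence 1. All other circuits go into the sparse error term.\<close>
    have pw: "e n \<pi> = (if \<pi> \<in> pair_circuits \<theta> n k then 1 else 0) +
        (if \<pi> \<in> sparse_circuits \<theta> n k then e n \<pi> else 0)" if \<pi>: "\<pi> \<in> circuits n (2 * k)" for \<pi>
      using \<pi>
    proof (cases rule: links_cases[where \<theta> = \<theta>])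
      case (single v)
      then have e0: "e n \<pi> = 0"
        unfolding e_def expectation_links by (intro prod_zero bexI[of _ v]) (auto simp: mean)
      have "\<pi> \<notin> pair_circuits \<theta> n k"
      proof
        assume "\<pi> \<in> pair_circuits \<theta> n k"
        then have "link_mult \<theta> n (2 * k) \<pi> v = 2"
          using single(1) unfolding pair_circuits_def by blast
        with single(2) show False by simp
      qed
      with e0 show ?thesis by simp
    next
      case pair
      then have "e n \<pi> = 1"
        unfolding e_def expectation_links
            by (intro prod.neutral) (auto simp: pair_circuits_def second_moment)
      then show ?thesis using pair pair_not_sparse[OF pair] by simp
    next
      case sparse
      then show ?thesis by simp
    qed
    have sub: "pair_circuits \<theta> n k \<subseteq> circuits n (2 * k)" "sparse_circuits \<theta> n k \<subseteq> circuits n (2 * k)"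
      by (auto simp: pair_circuits_def sparse_circuits_def)
    have "(\<Sum>\<pi>\<in>circuits n (2 * k). e n \<pi>) =
        (\<Sum>\<pi>\<in>circuits n (2 * k). if \<pi> \<in> pair_circuits \<theta> n k then 1 else 0) +
        (\<Sum>\<pi>\<in>circuits n (2 * k). if \<pi> \<in> sparse_circuits \<theta> n k then e n \<pi> else 0)"
      unfolding sum.distrib[symmetric] by (rule sum.cong[OF refl pw])
    also have "(\<Sum>\<pi>\<in>circuits n (2 * k). if \<pi> \<in> pair_circuits \<theta> n k then 1 else 0 :: real)
        = real (card (pair_circuits \<theta> n k))"
      using sub(1) by (simp add: sum.inter_restrict[symmetric] inf_absorb2)
    also have "(\<Sum>\<pi>\<in>circuits n (2 * k). if \<pi> \<in> sparse_circuits \<theta> n k then e n \<pi> else 0)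
        = (\<Sum>\<pi>\<in>sparse_circuits \<theta> n k. e n \<pi>)"
      using sub(2) by (simp add: sum.inter_restrict[symmetric] inf_absorb2)
    finally have "\<bar>(\<Sum>\<pi>\<in>circuits n (2 * k). e n \<pi>) - real (card (pair_circuits \<theta> n k))\<bar>
        = \<bar>\<Sum>\<pi>\<in>sparse_circuits \<theta> n k. e n \<pi>\<bar>"
      by simp
    also have "\<dots> \<le> (\<Sum>\<pi>\<in>sparse_circuits \<theta> n k. \<bar>e n \<pi>\<bar>)" by (rule sum_abs)
    also have "\<dots> \<le> (\<Sum>\<pi>\<in>sparse_circuits \<theta> n k. C)" by (intro sum_mono C)
    finally show ?thesis by (simp add: mult.commute)
  qed
  have len: "length w div 2 = k" if "w \<in> ?W" for w
    using that by (simp add: pair_matched_words_def)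
  have freq: "(\<Sum>w\<in>?W. word_freq \<theta> w n) = (\<Sum>w\<in>?W. real (card (Pi_star \<theta> n w))) / real n ^ (k + 1)" for n
    unfolding sum_divide_distrib by (intro sum.cong refl) (simp add: word_freq_def len)
  have diff: "\<bar>f n - (\<Sum>w\<in>?W. word_freq \<theta> w n)\<bar> \<le> (C + real (card ?W)) * q n" for n
  proof -
    have "\<bar>(\<Sum>\<pi>\<in>circuits n (2 * k). e n \<pi>) - (\<Sum>w\<in>?W. real (card (Pi_star \<theta> n w)))\<bar>
        \<le> (C + real (card ?W)) * real (card (sparse_circuits \<theta> n k))"
      using e_eq[of n] sum_card_Pi_star[of \<theta> n k] by (simp add: algebra_simps)
    then have "\<bar>(\<Sum>\<pi>\<in>circuits n (2 * k). e n \<pi>) - (\<Sum>w\<in>?W. real (card (Pi_star \<theta> n w)))\<bar> / real n ^ (k + 1)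
        \<le> (C + real (card ?W)) * real (card (sparse_circuits \<theta> n k)) / real n ^ (k + 1)"
      by (rule divide_right_mono) simp
    then show ?thesis
      unfolding f_eq freq q_def diff_divide_distrib[symmetric] abs_divide by simp
  qed
  have lim: "(\<lambda>n. (C + real (card ?W)) * q n) \<longlonglongrightarrow> 0"
    unfolding q_def by (intro tendsto_mult_right_zero sparse_circuits_negligible \<theta> k)
  have "(\<lambda>n. f n - (\<Sum>w\<in>?W. word_freq \<theta> w n)) \<longlonglongrightarrow> 0"
    by (rule Lim_null_comparison[OF _ lim]) (simp add: diff)
  moreover have "(\<lambda>n. \<Sum>w\<in>?W. word_freq \<theta> w n) \<longlonglongrightarrow> (\<Sum>w\<in>?W. word_limit \<theta> w)"
  proof (intro tendsto_sum)
    fix w assume "w \<in> ?W"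
    then have "w \<noteq> []" "\<forall>a\<in>set w. count_list w a = 2"
      using k by (auto simp: pair_matched_words_def pair_matched_def)
    from convergent_word_freq[OF \<theta> this] show "word_freq \<theta> w \<longlonglongrightarrow> word_limit \<theta> w"
      by (simp add: word_limit_def convergent_LIMSEQ_iff)
  qed
  ultimately have "(\<lambda>n. (f n - (\<Sum>w\<in>?W. word_freq \<theta> w n)) + (\<Sum>w\<in>?W. word_freq \<theta> w n))
      \<longlonglongrightarrow> 0 + (\<Sum>w\<in>?W. word_limit \<theta> w)"
    by (rule tendsto_add)
  then show ?thesis by (simp add: f_def)
qed

end

subsection \<open>Spectral means\<close>

text \<open>The integral of \<open>f\<close> against the spectral distribution, built from the same
  multiset of roots as \<open>esd\<close>.\<close>

definition spectral_mean :: "(real \<Rightarrow> real) \<Rightarrow> real mat \<Rightarrow> real" where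
  "spectral_mean f A = (\<Sum>l\<in>#proots (char_poly A). f l) / real (dim_row A)"

lemma spectral_mean_list:
  assumes "A \<in> carrier_mat n n" "char_poly A = (\<Prod>e\<leftarrow>es. [:- e, 1:])"
  shows "spectral_mean f A = (\<Sum>e\<leftarrow>es. f e) / real n"
  using assms(1) by (simp add: spectral_mean_def assms(2) proots_prod_linear mset_map[symmetric]
      sum_mset_sum_list del: mset_map)

lemma spectral_mean_power:
  assumes "A \<in> carrier_mat n n" "transpose_mat A = A"
  shows "spectral_mean (\<lambda>x. x ^ j) A = mtrace (A ^\<^sub>m j) / real n"
proof -
  obtain es where es: "char_poly A = (\<Prod>e\<leftarrow>es. [:- e, 1:])"
    using real_symmetric_char_poly_splits[OF assms] by blast
  have "poly (monom 1 j) = (\<lambda>x :: real. x ^ j)" by (simp add: poly_monom fun_eq_iff)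
  then show ?thesis
    unfolding spectral_mean_list[OF assms(1) es] poly_mat_power[OF assms(1),
        symmetric] mtrace_poly_mat[OF assms(1) es]
    by (simp only:)
qed

lemma spectral_mean_add: "spectral_mean (\<lambda>x. f x + g x) A = spectral_mean f A + spectral_mean g A"
  by (simp add: spectral_mean_def sum_mset.distrib add_divide_distrib)

lemma spectral_mean_cmult: "spectral_mean (\<lambda>x. c * f x) A = c * spectral_mean f A"
proof -
  have "(\<Sum>l\<in>#N. c * f l) = c * (\<Sum>l\<in>#N. f l)" for N
    by (induction N) (auto simp: algebra_simps)
  then show ?thesis by (simp add: spectral_mean_def)
qed

lemma spectral_mean_sum: "finite S \<Longrightarrow> spectral_mean (\<lambda>x. \<Sum>i\<in>S. f i x) A = (\<Sum>i\<in>S. spectral_mean (f i) A)"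
  by (induction S rule: finite_induct) (simp_all add: spectral_mean_add, simp add: spectral_mean_def)

lemma spectral_mean_mono:
  assumes "\<And>x. f x \<le> g x"
  shows "spectral_mean f A \<le> spectral_mean g A"
  unfolding spectral_mean_def using assms by (intro divide_right_mono sum_mset_mono) auto

lemma spectral_mean_diff_le:
  assumes A: "A \<in> carrier_mat n n" "transpose_mat A = A" and n: "n > 0"
    and fg: "\<And>x. x \<in># proots (char_poly A) \<Longrightarrow> \<bar>f x - g x\<bar> \<le> c"
  shows "\<bar>spectral_mean f A - spectral_mean g A\<bar> \<le> c"
proof -
  obtain es where es: "char_poly A = (\<Prod>e\<leftarrow>es. [:- e, 1:])" "length es = n"
    using real_symmetric_char_poly_splits[OF A] by blast
  have fg: "\<bar>f x - g x\<bar> \<le> c" if "x \<in> set es" for x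
    using fg that by (simp add: es(1) proots_prod_linear)
  have "\<bar>(\<Sum>e\<leftarrow>es. f e) - (\<Sum>e\<leftarrow>es. g e)\<bar> = \<bar>\<Sum>e\<leftarrow>es. f e - g e\<bar>"
    by (simp add: sum_list_subtractf)
  also have "\<dots> \<le> (\<Sum>e\<leftarrow>es. \<bar>f e - g e\<bar>)" by (rule sum_list_abs[of "map (\<lambda>e. f e - g e) es",
      unfolded map_map o_def])
  also have "\<dots> \<le> (\<Sum>e\<leftarrow>es. c)" by (rule sum_list_mono) (rule fg)
  also have "\<dots> = c * real n" by (simp add: sum_list_triv es(2))
  finally show ?thesis
    unfolding spectral_mean_list[OF A(1) es(1)] diff_divide_distrib[symmetric] abs_divide
    using n by (simp add: field_simps)
qed

lemma spectral_mean_perturbation: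
  assumes A: "A \<in> carrier_mat n n" "transpose_mat A = A"
    and B: "B \<in> carrier_mat n n" "transpose_mat B = B" and n: "n > 0"
    and f: "\<And>x y. \<bar>f x - f y\<bar> \<le> \<eta> + K * (x - y)\<^sup>2"
  shows "\<bar>spectral_mean f A - spectral_mean f B\<bar>
      \<le> \<eta> + K * (\<Sum>i<n. \<Sum>j<n. (A $$ (i, j) - B $$ (i, j))\<^sup>2) / real n"
proof -
  obtain as where as: "char_poly A = (\<Prod>e\<leftarrow>as. [:- e, 1:])"
    using real_symmetric_char_poly_splits[OF A] by blast
  obtain bs where bs: "char_poly B = (\<Prod>e\<leftarrow>bs. [:- e, 1:])"
    using real_symmetric_char_poly_splits[OF B] by blast
  have "\<bar>(\<Sum>e\<leftarrow>as. f e) - (\<Sum>e\<leftarrow>bs. f e)\<bar> \<le> \<eta> * n + K * (\<Sum>i<n. \<Sum>j<n. (A $$ (i, j) - B $$ (i, j))\<^sup>2)"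
    by (rule spectrum_perturbation[OF A B as bs f])
  then show ?thesis
    unfolding spectral_mean_list[OF A(1) as] spectral_mean_list[OF B(1) bs]
        diff_divide_distrib[symmetric] abs_divide
    using n by (simp add: field_simps)
qed

text \<open>Weak convergence is given for distribution functions, and a measure behind
  \<open>esd\<close> makes test functions available. It is the image of the uniform distribution on
  the positions of a list of eigenvalues, which needs a nonempty list.\<close>

lemma empirical_distribution:
  assumes A: "A \<in> carrier_mat n n" "transpose_mat A = A" and n: "n > 0"
  shows "\<exists>D. real_distribution D \<and> cdf D = esd A \<and> (\<forall>f\<in>borel_measurable borel. integral\<^sup>L D f
      = spectral_mean f A)"
proof -
  obtain es where es: "char_poly A = (\<Prod>e\<leftarrow>es. [:- e, 1:])" "length es = n"
    using real_symmetric_char_poly_splits[OF A] by blast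
  let ?P = "measure_pmf (pmf_of_set {..<n})"
  define D where "D = distr ?P borel (\<lambda>i. es ! i)"
  have ne: "{..<n} \<noteq> {}" "finite {..<n}" using n by auto
  have int: "integral\<^sup>L D f = spectral_mean f A" if [measurable]: "f \<in> borel_measurable borel" for f
  proof -
    have "integral\<^sup>L D f = (\<integral>i. f (es ! i) \<partial>?P)"
      unfolding D_def by (rule integral_distr) auto
    also have "\<dots> = (\<Sum>i<n. f (es ! i)) / real n"
      by (subst integral_pmf_of_set[OF ne]) simp
    also have "(\<Sum>i<n. f (es ! i)) = (\<Sum>e\<leftarrow>es. f e)"
      using es(2) by (simp add: sum_list_sum_nth atLeast0LessThan)
    finally show ?thesis by (simp add: spectral_mean_list[OF A(1) es(1)])
  qed
  have rd: "real_distribution D"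
    unfolding D_def by (rule prob_space.real_distribution_distr[OF prob_space_measure_pmf]) simp
  then interpret D: real_distribution D .
  have "cdf D t = esd A t" for t
  proof -
    have "cdf D t = integral\<^sup>L D (indicator {..t})"
      unfolding cdf_def by simp
    also have "\<dots> = spectral_mean (indicator {..t}) A"
      by (rule int) simp
    also have "\<dots> = (\<Sum>e\<leftarrow>es. indicator {..t} e) / real n"
      by (rule spectral_mean_list[OF A(1) es(1)])
    also have "(\<Sum>e\<leftarrow>es. indicator {..t} e) = real (length (filter (\<lambda>l. l \<le> t) es))"
      by (induction es) (auto simp: indicator_def)
    also have "\<dots> / real n = esd A t"
      using A(1) by (simp add: esd_def es(1) proots_prod_linear mset_filter[symmetric] del: mset_filter)
    finally show ?thesis .
  qed
  with rd int show ?thesis by blast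
qed

lemma spectral_mean_weak_conv:
  assumes A: "\<And>n. A n \<in> carrier_mat n n" "\<And>n. transpose_mat (A n) = A n"
    and \<mu>: "real_distribution \<mu>" and conv: "weak_conv (\<lambda>n. esd (A n)) (cdf \<mu>)"
    and f: "\<And>x. isCont f x" "\<And>x. \<bar>f x\<bar> \<le> B"
  shows "(\<lambda>n. spectral_mean f (A n)) \<longlonglongrightarrow> integral\<^sup>L \<mu> f"
proof -
  \<comment> \<open>The empty matrix has no spectral distribution, so the measures are indexed from
    size 1; the shift does not affect limits.\<close>
  have "\<forall>n. \<exists>D. real_distribution D \<and> cdf D = esd (A (Suc n)) \<and>
      (\<forall>f\<in>borel_measurable borel. integral\<^sup>L D f = spectral_mean f (A (Suc n)))"
    using empirical_distribution[OF A] by blast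
  then obtain D where D: "\<And>n. real_distribution (D n)" "\<And>n. cdf (D n) = esd (A (Suc n))"
    "\<And>n f. f \<in> borel_measurable borel \<Longrightarrow> integral\<^sup>L (D n) f = spectral_mean f (A (Suc n))"
    by metis
  have fm: "f \<in> borel_measurable borel"
    using f(1) by (intro borel_measurable_continuous_onI continuous_at_imp_continuous_on) auto
  have "weak_conv_m D \<mu>"
    using conv unfolding weak_conv_m_def weak_conv_def D(2) by (auto intro: LIMSEQ_Suc)
  then have "(\<lambda>n. integral\<^sup>L (D n) f) \<longlonglongrightarrow> integral\<^sup>L \<mu> f"
    using f by (intro weak_conv_imp_integral_bdd_continuous_conv[where B = B] D \<mu>) auto
  then have "(\<lambda>n. spectral_mean f (A (Suc n))) \<longlonglongrightarrow> integral\<^sup>L \<mu> f"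
    unfolding D(3)[OF fm] .
  then show ?thesis by (rule LIMSEQ_imp_Suc)
qed

text \<open>Uniform polynomial approximation on growing intervals reduces measurability of a spectral
  statistic to that of the traces of powers.\<close>

lemma measurable_spectral_mean:
  assumes A: "\<And>\<omega>. A \<omega> \<in> carrier_mat n n" "\<And>\<omega>. transpose_mat (A \<omega>) = A \<omega>" and n: "n > 0"
    and tr: "\<And>j. (\<lambda>\<omega>. mtrace (A \<omega> ^\<^sub>m j)) \<in> borel_measurable M"
    and f: "continuous_on UNIV f"
  shows "(\<lambda>\<omega>. spectral_mean f (A \<omega>)) \<in> borel_measurable M"
proof -
  have "\<exists>g. real_polynomial_function g \<and> (\<forall>x\<in>{- real N..real N}. \<bar>f x - g x\<bar> < 1 / real (Suc N))" for N
    by (rule Stone_Weierstrass_real_polynomial_function[of "{- real N..real N}" f "1 / real (Suc N)"])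
       (auto intro: continuous_on_subset[OF f])
  then obtain g where g: "\<And>N. real_polynomial_function (g N)"
    "\<And>N x. x \<in> {- real N..real N} \<Longrightarrow> \<bar>f x - g N x\<bar> < 1 / real (Suc N)"
    by metis
  have meas: "(\<lambda>\<omega>. spectral_mean (g N) (A \<omega>)) \<in> borel_measurable M" for N
  proof -
    obtain a d where "g N = (\<lambda>x. \<Sum>i\<le>d. a i * x ^ i)"
      using g(1)[of N] unfolding real_polynomial_function_iff_sum by blast
    then have "spectral_mean (g N) (A \<omega>) = (\<Sum>i\<le>d. a i * (mtrace (A \<omega> ^\<^sub>m i) / real n))" for \<omega>
      by (simp add: spectral_mean_sum spectral_mean_cmult spectral_mean_power[OF A])
    then show ?thesis using tr by simp
  qed
  show ?thesis
  proof (rule borel_measurable_LIMSEQ_real[OF _ meas])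
    fix \<omega> assume "\<omega> \<in> space M"
    let ?S = "set_mset (proots (char_poly (A \<omega>)))"
    \<comment> \<open>The spectrum at a fixed \<omega> is finite, so it lies in [-N, N] for all
      large N; convergence of the approximations is only claimed pointwise.\<close>
    obtain N0 :: nat where N0: "\<And>x. x \<in> ?S \<Longrightarrow> \<bar>x\<bar> \<le> real N0"
    proof -
      have "\<bar>x\<bar> \<le> real (nat \<lceil>Max (insert 0 (abs ` ?S))\<rceil>)" if "x \<in> ?S" for x
      proof -
        have "\<bar>x\<bar> \<le> Max (insert 0 (abs ` ?S))" using that by (intro Max_ge) auto
        then show ?thesis by linarith
      qed
      then show thesis using that by blast
    qed
    have close: "eventually (\<lambda>N. norm (spectral_mean (g N) (A \<omega>) - spectral_mean f (A \<omega>))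
        \<le> 1 / real (Suc N)) sequentially"
      using eventually_ge_at_top[of N0]
    proof eventually_elim
      case (elim N)
      have "\<bar>g N x - f x\<bar> \<le> 1 / real (Suc N)" if "x \<in> ?S" for x
      proof -
        have "x \<in> {- real N..real N}" using N0[OF that] elim by (auto simp: abs_le_iff)
        from g(2)[OF this] show ?thesis by linarith
      qed
      then show ?case
        unfolding real_norm_def by (rule spectral_mean_diff_le[OF A n])
    qed
    have "(\<lambda>N. 1 / real (Suc N)) \<longlonglongrightarrow> 0" by real_asymp
    from Lim_null_comparison[OF close this]
    have "(\<lambda>N. spectral_mean (g N) (A \<omega>) - spectral_mean f (A \<omega>)) \<longlonglongrightarrow> 0" .
    then show "(\<lambda>N. spectral_mean (g N) (A \<omega>)) \<longlonglongrightarrow> spectral_mean f (A \<omega>)"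
      by (simp add: LIM_zero_iff)
  qed
qed

section \<open>Patterned matrices and truncated powers\<close>

lemma patterned_matrix_carrier: "patterned_matrix \<theta> n x \<in> carrier_mat n n"
  by (simp add: patterned_matrix_def)

lemma patterned_matrix_symmetric: "transpose_mat (patterned_matrix \<theta> n x) = patterned_matrix \<theta> n x"
  by (intro eq_matI) (auto simp: patterned_matrix_def link_def add.commute)

lemma patterned_matrix_distance:
  assumes "n > 0"
  shows "(\<Sum>i<n. \<Sum>j<n. (patterned_matrix \<theta> n x $$ (i, j) - patterned_matrix \<theta> n y $$ (i, j))\<^sup>2)
    = (\<Sum>i<n. \<Sum>j<n. (x (link \<theta> n (Suc i) (Suc j)) - y (link \<theta> n (Suc i) (Suc j)))\<^sup>2) / real n"
  using assms by (simp add: patterned_matrix_def sum_divide_distrib diff_divide_distrib[symmetric]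
      power_divide)

text \<open>Cutting the absolute value before taking the power yields a bounded Lipschitz function
  that increases, as \<open>R\<close> grows, to the even power when \<open>m\<close> is
  even.\<close>

definition truncated_power :: "real \<Rightarrow> nat \<Rightarrow> real \<Rightarrow> real" where
  "truncated_power R m x = min \<bar>x\<bar> R ^ m"

lemma truncated_power_continuous: "continuous_on S (truncated_power R m)"
  unfolding truncated_power_def by (intro continuous_intros)

lemma truncated_power_bounds:
  assumes "R \<ge> 0"
  shows "0 \<le> truncated_power R m x" "truncated_power R m x \<le> R ^ m"
  using assms by (auto simp: truncated_power_def intro: power_mono)

text \<open>Where |x| exceeds \<open>R\<close>, the factor x^2 / R^2 is at least 1, so the
  correction term of order 2k + 2 already outweighs x^(2k) and the lower bound is
  nonpositive.\<close>

lemma truncated_power_even: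
  assumes "R > 0"
  shows "truncated_power R (2 * k) x \<le> x ^ (2 * k)"
    "x ^ (2 * k) - x ^ (2 * (k + 1)) / R\<^sup>2 \<le> truncated_power R (2 * k) x"
proof -
  have x: "x ^ (2 * k) = \<bar>x\<bar> ^ (2 * k)" by (simp add: power_even_abs)
  show "truncated_power R (2 * k) x \<le> x ^ (2 * k)"
    unfolding truncated_power_def x using assms by (intro power_mono) auto
  show "x ^ (2 * k) - x ^ (2 * (k + 1)) / R\<^sup>2 \<le> truncated_power R (2 * k) x"
  proof (cases "\<bar>x\<bar> \<le> R")
    case True
    then have "truncated_power R (2 * k) x = x ^ (2 * k)" by (simp add: truncated_power_def x)
    moreover have "0 \<le> x ^ (2 * (k + 1)) / R\<^sup>2"
      by (intro divide_nonneg_nonneg zero_le_even_power) auto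
    ultimately show ?thesis by linarith
  next
    case False
    then have "R\<^sup>2 \<le> x\<^sup>2" using assms by (simp add: abs_le_square_iff[symmetric])
    then have "1 \<le> x\<^sup>2 / R\<^sup>2" using assms by simp
    then have "x ^ (2 * k) * 1 \<le> x ^ (2 * k) * (x\<^sup>2 / R\<^sup>2)" by (intro mult_left_mono) auto
    then have "x ^ (2 * k) - x ^ (2 * (k + 1)) / R\<^sup>2 \<le> 0"
        by (simp add: power_add power2_eq_square mult_ac)
    then show ?thesis using truncated_power_bounds(1)[of R "2 * k" x] assms by linarith
  qed
qed

lemma abs_power_diff_le:
  fixes u v R :: real
  assumes "0 \<le> u" "u \<le> R" "0 \<le> v" "v \<le> R"
  shows "\<bar>u ^ m - v ^ m\<bar> \<le> real m * R ^ (m - 1) * \<bar>u - v\<bar>"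
proof -
  have "\<bar>\<Sum>i<m. v ^ (m - Suc i) * u ^ i\<bar> \<le> (\<Sum>i<m. R ^ (m - 1))"
  proof (intro order_trans[OF sum_abs] sum_mono)
    fix i assume "i \<in> {..<m}"
    then have "m - 1 = (m - Suc i) + i" by auto
    then have "R ^ (m - 1) = R ^ (m - Suc i) * R ^ i" by (simp only: power_add)
    then show "\<bar>v ^ (m - Suc i) * u ^ i\<bar> \<le> R ^ (m - 1)"
      using assms by (auto simp: abs_mult intro!: mult_mono power_mono)
  qed
  then have "\<bar>u - v\<bar> * \<bar>\<Sum>i<m. v ^ (m - Suc i) * u ^ i\<bar> \<le> \<bar>u - v\<bar> * (real m * R ^ (m - 1))"
    by (intro mult_left_mono) auto
  moreover have "\<bar>u ^ m - v ^ m\<bar> = \<bar>u - v\<bar> * \<bar>\<Sum>i<m. v ^ (m - Suc i) * u ^ i\<bar>"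
    by (simp add: power_diff_sumr2 abs_mult)
  ultimately show ?thesis by (simp add: mult_ac)
qed

text \<open>With Lipschitz constant L and t = L |x - y|, the inequality t \<le> \<eta> + t^2 /
  \<eta> trades the linear modulus of continuity for the quadratic one demanded by the comparison of
  spectra. It follows from (t - \<eta>)^2 + t \<eta> \<ge> 0.\<close>

lemma truncated_power_uniform:
  assumes R: "R > 0" and \<eta>: "\<eta> > 0"
  shows "\<exists>K\<ge>0. \<forall>x y. \<bar>truncated_power R m x - truncated_power R m y\<bar> \<le> \<eta> + K * (x - y)\<^sup>2"
proof -
  define L where "L = real m * R ^ (m - 1)"
  have L: "L \<ge> 0" using R by (simp add: L_def)
  have "\<bar>truncated_power R m x - truncated_power R m y\<bar> \<le> \<eta> + L\<^sup>2 / \<eta> * (x - y)\<^sup>2" for x y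
  proof -
    have "\<bar>truncated_power R m x - truncated_power R m y\<bar> \<le> L * \<bar>min \<bar>x\<bar> R - min \<bar>y\<bar> R\<bar>"
      unfolding truncated_power_def L_def using R by (intro abs_power_diff_le) auto
    also have "\<dots> \<le> L * \<bar>x - y\<bar>" using L by (intro mult_left_mono) auto
    also have "\<dots> \<le> \<eta> + (L * \<bar>x - y\<bar>)\<^sup>2 / \<eta>"
    proof -
      let ?t = "L * \<bar>x - y\<bar>"
      have "0 \<le> (?t - \<eta>)\<^sup>2 + ?t * \<eta>" using L \<eta> by simp
      then have "?t * \<eta> \<le> \<eta> * \<eta> + ?t\<^sup>2" by (simp add: power2_eq_square algebra_simps)
      then show ?thesis using \<eta> by (simp add: field_simps power2_eq_square)
    qed
    finally show ?thesis by (simp add: power_mult_distrib)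
  qed
  then show ?thesis using \<eta> by (intro exI[of _ "L\<^sup>2 / \<eta>"]) auto
qed

subsection \<open>Truncation and the moment method\<close>

lemma uniformly_bounded_imp_moments:
  assumes "prob_space M" and X: "\<And>i. X i \<in> borel_measurable M" and "uniformly_bounded M X"
  shows "uniformly_bounded_moments M X"
proof -
  interpret prob_space M by fact
  obtain B where B: "\<And>i. AE \<omega> in M. \<bar>X i \<omega>\<bar> \<le> B"
    using assms(3) unfolding uniformly_bounded_def by blast
  define C where "C = max B 0"
  have bound: "AE \<omega> in M. \<bar>X i \<omega>\<bar> ^ m \<le> C ^ m" for i m
    using B[of i] by eventually_elim (auto simp: C_def intro!: power_mono)
  have int: "integrable M (\<lambda>\<omega>. \<bar>X i \<omega>\<bar> ^ m)" for i m
    using bound[of i m] X by (intro integrable_const_bound[of _ "C ^ m"]) auto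
  have "(\<integral>\<omega>. \<bar>X i \<omega>\<bar> ^ m \<partial>M) \<le> (\<integral>\<omega>. C ^ m \<partial>M)" for i m
    by (rule integral_mono_AE[OF int _ bound]) simp
  then have "(\<integral>\<omega>. \<bar>X i \<omega>\<bar> ^ m \<partial>M) \<le> C ^ m" for i m
    by (simp add: prob_space)
  with int show ?thesis unfolding uniformly_bounded_moments_def by blast
qed

lemma input_sequence_moments:
  assumes "input_sequence M X"
  shows "integrable M (X i)" "integrable M (\<lambda>\<omega>. (X i \<omega>)\<^sup>2)" "(\<integral>\<omega>. X i \<omega> \<partial>M) = 0" "(\<integral>\<omega>. (X i \<omega>)\<^sup>2 \<partial>M) = 1"
proof -
  show mean: "(\<integral>\<omega>. X i \<omega> \<partial>M) = 0" and "integrable M (X i)" "integrable M (\<lambda>\<omega>. (X i \<omega>)\<^sup>2)"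
    using assms by (auto simp: input_sequence_def)
  have "(\<integral>\<omega>. (X i \<omega> - (\<integral>\<omega>. X i \<omega> \<partial>M))\<^sup>2 \<partial>M) = 1"
    using assms unfolding input_sequence_def by blast
  then show "(\<integral>\<omega>. (X i \<omega>)\<^sup>2 \<partial>M) = 1" by (simp only: mean diff_0_right)
qed

lemma input_sequence_bounded_moments:
  assumes "input_sequence M X" "uniformly_bounded_moments M X"
  shows "bounded_moment_inputs M X"
proof -
  interpret prob_space M using assms by (simp add: input_sequence_def)
  show ?thesis
  proof unfold_locales
    show "indep_vars (\<lambda>_. borel) X UNIV" using assms(1) by (simp add: input_sequence_def)
  qed (rule input_sequence_moments[OF assms(1)] assms(2))+
qed

definition trunc :: "real \<Rightarrow> real \<Rightarrow> real" where
  "trunc c x = (if \<bar>x\<bar> \<le> c then x else 0)"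

lemma trunc_measurable [measurable]: "trunc c \<in> borel_measurable borel"
  unfolding trunc_def[abs_def] by measurable

text \<open>Truncating at a high level and renormalizing changes a standardized variable little in
  mean square, because \<open>X \<cdot> trunc c X = (trunc c X)\<^sup>2\<close>.\<close>

lemma (in prob_space) exists_standardized_truncation:
  fixes Z :: "'a \<Rightarrow> real"
  assumes Z: "integrable M Z" "integrable M (\<lambda>\<omega>. (Z \<omega>)\<^sup>2)" "expectation Z
      = 0" "expectation (\<lambda>\<omega>. (Z \<omega>)\<^sup>2) = 1"
    and \<delta>: "\<delta> > 0"
  shows "\<exists>g K. g \<in> borel_measurable borel \<and> (\<forall>x. \<bar>g x\<bar> \<le> K) \<and> expectation (\<lambda>\<omega>. g (Z \<omega>)) = 0 \<and>
    expectation (\<lambda>\<omega>. (g (Z \<omega>))\<^sup>2) = 1 \<and> integrable M (\<lambda>\<omega>. (Z \<omega> - g (Z \<omega>))\<^sup>2) \<and>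
    expectation (\<lambda>\<omega>. (Z \<omega> - g (Z \<omega>))\<^sup>2) \<le> \<delta>"
proof -
  have [measurable]: "Z \<in> borel_measurable M" using Z(1) by auto
  define T where "T c \<omega> = trunc (real c) (Z \<omega>)" for c :: nat and \<omega>
  have [measurable]: "T c \<in> borel_measurable M" for c unfolding T_def by measurable
  define m where "m c = expectation (T c)" for c
  define q where "q c = expectation (\<lambda>\<omega>. (T c \<omega>)\<^sup>2)" for c
  have T_le: "\<bar>T c \<omega>\<bar> \<le> \<bar>Z \<omega>\<bar>" "\<bar>T c \<omega>\<bar> \<le> real c" for c \<omega> by (auto simp: T_def trunc_def)
  have T_lim: "(\<lambda>c. T c \<omega>) \<longlonglongrightarrow> Z \<omega>" for \<omega>
  proof (rule tendsto_eventually)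
    show "eventually (\<lambda>c. T c \<omega> = Z \<omega>) sequentially"
      using eventually_ge_at_top[of "nat \<lceil>\<bar>Z \<omega>\<bar>\<rceil>"]
      by eventually_elim (auto simp: T_def trunc_def; linarith)
  qed
  have m_lim: "m \<longlonglongrightarrow> 0"
    unfolding m_def Z(3)[symmetric]
    by (rule integral_dominated_convergence[where w = "\<lambda>\<omega>. \<bar>Z \<omega>\<bar>"]) (use Z T_le T_lim in auto)
  have q_lim: "q \<longlonglongrightarrow> 1"
    unfolding q_def Z(4)[symmetric]
  proof (rule integral_dominated_convergence[where w = "\<lambda>\<omega>. (Z \<omega>)\<^sup>2"])
    show "AE \<omega> in M. (\<lambda>c. (T c \<omega>)\<^sup>2) \<longlonglongrightarrow> (Z \<omega>)\<^sup>2"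
      by (intro AE_I2 tendsto_power T_lim)
    show "AE \<omega> in M. norm ((T c \<omega>)\<^sup>2) \<le> (Z \<omega>)\<^sup>2" for c
      using T_le(1) by (intro AE_I2) (simp add: abs_le_square_iff)
  qed (use Z in auto)
  define s where "s c = sqrt (q c - (m c)\<^sup>2)" for c
  have s_lim: "s \<longlonglongrightarrow> 1"
  proof -
    have "(\<lambda>c. sqrt (q c - (m c)\<^sup>2)) \<longlonglongrightarrow> sqrt (1 - 0\<^sup>2)" by (intro tendsto_intros m_lim q_lim)
    then show ?thesis by (simp add: s_def[abs_def])
  qed
  \<comment> \<open>This is the mean square distance between \<open>Z\<close> and its standardized
    truncation: 1 + 1 minus twice the cross moment, which turns out to be q / s.\<close>
  have "(\<lambda>c. 2 - 2 * (q c / s c)) \<longlonglongrightarrow> 2 - 2 * (1 / 1)" by (intro tendsto_intros q_lim s_lim) auto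
  then have "(\<lambda>c. 2 - 2 * (q c / s c)) \<longlonglongrightarrow> 0" by simp
  then have "eventually (\<lambda>c. 2 - 2 * (q c / s c) < \<delta>) sequentially" by (rule order_tendstoD) (rule \<delta>)
  moreover have "eventually (\<lambda>c. s c > 0) sequentially" by (rule order_tendstoD(1)[OF s_lim]) simp
  ultimately have "eventually (\<lambda>c. 2 - 2 * (q c / s c) < \<delta> \<and> s c > 0) sequentially"
      by eventually_elim simp
  from eventually_happens'[OF sequentially_bot this]
  obtain c where c: "2 - 2 * (q c / s c) < \<delta>" "s c > 0"
    by (elim exE conjE)
  have s2: "(s c)\<^sup>2 = q c - (m c)\<^sup>2" using c(2) by (simp add: s_def)
  define g where "g x = (trunc (real c) x - m c) / s c" for x
  have gm [measurable]: "g \<in> borel_measurable borel" unfolding g_def by measurable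
  have gK: "\<bar>g x\<bar> \<le> (real c + \<bar>m c\<bar>) / s c" for x
  proof -
    have "\<bar>trunc (real c) x - m c\<bar> \<le> real c + \<bar>m c\<bar>" by (auto simp: trunc_def)
    then show ?thesis using c(2) by (simp add: g_def divide_right_mono)
  qed
  have iT: "integrable M (T c)" by (rule integrable_const_bound[of _ "real c"]) (use T_le in auto)
  have iT2: "integrable M (\<lambda>\<omega>. (T c \<omega>)\<^sup>2)"
  proof (rule integrable_const_bound[of _ "(real c)\<^sup>2"])
    show "AE \<omega> in M. norm ((T c \<omega>)\<^sup>2) \<le> (real c)\<^sup>2"
      using T_le(2)[of c] by (intro AE_I2) (simp add: power2_le_iff_abs_le)
  qed simp
  have gT: "g (Z \<omega>) = (T c \<omega> - m c) / s c" for \<omega> by (simp add: g_def T_def)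
  have mean: "expectation (\<lambda>\<omega>. g (Z \<omega>)) = 0"
    unfolding gT using iT by (simp add: m_def prob_space)
  have sq: "has_bochner_integral M (\<lambda>\<omega>. (T c \<omega> - m c)\<^sup>2) ((s c)\<^sup>2)"
  proof -
    have "has_bochner_integral M (\<lambda>\<omega>. (T c \<omega>)\<^sup>2 - 2 * m c * T c \<omega> + (m c)\<^sup>2) (q c - 2 * m c * m c
        + (m c)\<^sup>2 * prob (space M))"
      unfolding q_def using has_bochner_integral_integrable[OF iT2] has_bochner_integral_integrable[OF
          iT]
      by (intro has_bochner_integral_add has_bochner_integral_diff has_bochner_integral_mult_right)
         (auto simp: m_def has_bochner_integral_iff)
    moreover have "(\<lambda>\<omega>. (T c \<omega>)\<^sup>2 - 2 * m c * T c \<omega> + (m c)\<^sup>2) = (\<lambda>\<omega>. (T c \<omega> - m c)\<^sup>2)"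
      by (simp add: power2_eq_square algebra_simps)
    moreover have "q c - 2 * m c * m c + (m c)\<^sup>2 * prob (space M) = (s c)\<^sup>2"
      unfolding s2 by (simp add: power2_eq_square prob_space)
    ultimately show ?thesis by (simp only:)
  qed
  have second: "has_bochner_integral M (\<lambda>\<omega>. (g (Z \<omega>))\<^sup>2) 1"
    using has_bochner_integral_divide_zero[OF sq, of "(s c)\<^sup>2"] c(2) by (simp add: gT power_divide)
  have ZT: "Z \<omega> * T c \<omega> = (T c \<omega>)\<^sup>2" for \<omega> by (simp add: T_def trunc_def power2_eq_square)
  \<comment> \<open>Since Z T = T^2 and \<open>Z\<close> has mean 0, centering \<open>T\<close> does
    not change its cross moment with \<open>Z\<close>; only the division by \<open>s c\<close>
    does.\<close>
  have cross: "has_bochner_integral M (\<lambda>\<omega>. Z \<omega> * g (Z \<omega>)) (q c / s c)"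
  proof -
    have "has_bochner_integral M (\<lambda>\<omega>. ((T c \<omega>)\<^sup>2 - m c * Z \<omega>) / s c) ((q c - m c * 0) / s c)"
      unfolding q_def using has_bochner_integral_integrable[OF iT2] has_bochner_integral_integrable[OF
          Z(1)] Z(3)
      by (intro has_bochner_integral_divide_zero has_bochner_integral_diff
          has_bochner_integral_mult_right) auto
    moreover have "((T c \<omega>)\<^sup>2 - m c * Z \<omega>) / s c = Z \<omega> * g (Z \<omega>)" for \<omega>
      unfolding gT ZT[symmetric] by (simp add: algebra_simps)
    ultimately show ?thesis by simp
  qed
  have "has_bochner_integral M (\<lambda>\<omega>. (Z \<omega>)\<^sup>2 - 2 * (Z \<omega> * g (Z \<omega>)) + (g (Z \<omega>))\<^sup>2) (1 - 2 * (q c / s c)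
      + 1)"
    using has_bochner_integral_integrable[OF Z(2)] Z(4) cross second
    by (intro has_bochner_integral_add has_bochner_integral_diff has_bochner_integral_mult_right) auto
  then have "has_bochner_integral M (\<lambda>\<omega>. (Z \<omega> - g (Z \<omega>))\<^sup>2) (2 - 2 * (q c / s c))"
    by (simp add: power2_eq_square algebra_simps)
  then show ?thesis
    using gm gK mean second c(1) unfolding has_bochner_integral_iff
    by (intro exI[of _ g] exI[of _ "(real c + \<bar>m c\<bar>) / s c"]) auto
qed

text \<open>With bounded moments the inputs approximate themselves. In the identically distributed
  case one truncation, chosen for the first input, serves all of them with the same error, and
  applying it to each input keeps independence.\<close>

lemma approximating_inputs:
  assumes X: "input_sequence M X" and \<delta>: "\<delta> > 0"
  shows "\<exists>Y. bounded_moment_inputs M Y \<and>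
    (\<forall>i. integrable M (\<lambda>\<omega>. (X i \<omega> - Y i \<omega>)\<^sup>2) \<and> (\<integral>\<omega>. (X i \<omega> - Y i \<omega>)\<^sup>2 \<partial>M) \<le> \<delta>)"
proof -
  interpret prob_space M using X by (simp add: input_sequence_def)
  have ind: "indep_vars (\<lambda>_. borel) X UNIV" using X by (simp add: input_sequence_def)
  have Xm [measurable]: "X i \<in> borel_measurable M" for i using ind by (auto simp: indep_vars_def)
  note X0 = input_sequence_moments[OF X]
  consider "uniformly_bounded_moments M X" | "identically_distributed M X"
    using X uniformly_bounded_imp_moments[OF prob_space_axioms Xm] by (auto simp: input_sequence_def)
  then show ?thesis
  proof cases
    case 1
    then show ?thesis
      using input_sequence_bounded_moments[OF X] \<delta> by (intro exI[of _ X]) auto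
  next
    case 2
    obtain g K where g: "g \<in> borel_measurable borel" "\<And>x. \<bar>g x\<bar> \<le> K" "expectation (\<lambda>\<omega>. g (X 0 \<omega>)) = 0"
      "expectation (\<lambda>\<omega>. (g (X 0 \<omega>))\<^sup>2) = 1" "integrable M (\<lambda>\<omega>. (X 0 \<omega> - g (X 0 \<omega>))\<^sup>2)"
      "expectation (\<lambda>\<omega>. (X 0 \<omega> - g (X 0 \<omega>))\<^sup>2) \<le> \<delta>"
      using exists_standardized_truncation[OF X0[of 0] \<delta>] by blast
    note [measurable] = g(1)
    have same: "expectation (\<lambda>\<omega>. h (X i \<omega>)) = expectation (\<lambda>\<omega>. h (X 0 \<omega>))"
      "integrable M (\<lambda>\<omega>. h (X i \<omega>)) \<longleftrightarrow> integrable M (\<lambda>\<omega>. h (X 0 \<omega>))"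
      if [measurable]: "h \<in> borel_measurable borel" for h :: "real \<Rightarrow> real" and i
    proof -
      have d: "distr M borel (X i) = distr M borel (X 0)"
        using 2 by (auto simp: identically_distributed_def)
      have "expectation (\<lambda>\<omega>. h (X j \<omega>)) = integral\<^sup>L (distr M borel (X j)) h" for j
        by (rule integral_distr[symmetric]) auto
      then show "expectation (\<lambda>\<omega>. h (X i \<omega>)) = expectation (\<lambda>\<omega>. h (X 0 \<omega>))" using d by metis
      have "integrable M (\<lambda>\<omega>. h (X j \<omega>)) \<longleftrightarrow> integrable (distr M borel (X j)) h" for j
        by (rule integrable_distr_eq[symmetric]) auto
      then show "integrable M (\<lambda>\<omega>. h (X i \<omega>)) \<longleftrightarrow> integrable M (\<lambda>\<omega>. h (X 0 \<omega>))" using d by metis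
    qed
    let ?Y = "\<lambda>i \<omega>. g (X i \<omega>)"
    have "bounded_moment_inputs M ?Y"
    proof unfold_locales
      show "indep_vars (\<lambda>_. borel) ?Y UNIV"
        by (rule indep_vars_compose2[OF ind]) simp
      show "expectation (?Y i) = 0" for i
        using same(1)[of g i] g(3) by simp
      show "expectation (\<lambda>\<omega>. (?Y i \<omega>)\<^sup>2) = 1" for i
        using same(1)[of "\<lambda>x. (g x)\<^sup>2" i] g(4) by simp
      show "uniformly_bounded_moments M ?Y"
        by (rule uniformly_bounded_imp_moments[OF prob_space_axioms])
           (use g(2) in \<open>auto simp: uniformly_bounded_def\<close>)
    qed
    moreover have "integrable M (\<lambda>\<omega>. (X i \<omega> - ?Y i \<omega>)\<^sup>2)" "expectation (\<lambda>\<omega>. (X i \<omega> - ?Y i \<omega>)\<^sup>2) \<le> \<delta>"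
        for i
      using same[of "\<lambda>x. (x - g x)\<^sup>2" i] g(5,6) by simp_all
    ultimately show ?thesis by blast
  qed
qed

section \<open>Passing to the given weak limit\<close>

context
  fixes \<theta> :: real
  assumes \<theta>: "\<theta> > 0"
begin

abbreviation (input) random_matrix :: "(nat \<Rightarrow> 'a \<Rightarrow> real) \<Rightarrow> nat \<Rightarrow> 'a \<Rightarrow> real mat" where
  "random_matrix X n \<omega> \<equiv> patterned_matrix \<theta> n (\<lambda>i. X i \<omega>)"

lemma measurable_spectral_mean_random_matrix:
  assumes X: "\<And>i. X i \<in> borel_measurable M" and n: "n > 0" and f: "continuous_on UNIV f"
  shows "(\<lambda>\<omega>. spectral_mean f (random_matrix X n \<omega>)) \<in> borel_measurable M"
proof (rule measurable_spectral_mean[OF patterned_matrix_carrier patterned_matrix_symmetric n _ f])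
  show "(\<lambda>\<omega>. mtrace (random_matrix X n \<omega> ^\<^sub>m j)) \<in> borel_measurable M" for j
    unfolding mtrace_patterned_matrix using X by measurable
qed

lemma integrable_spectral_mean:
  assumes "prob_space M" and X: "\<And>i. X i \<in> borel_measurable M" and n: "n > 0"
    and f: "continuous_on UNIV f" "\<And>x. \<bar>f x\<bar> \<le> B"
  shows "integrable M (\<lambda>\<omega>. spectral_mean f (random_matrix X n \<omega>))"
    and "\<bar>spectral_mean f (random_matrix X n \<omega>)\<bar> \<le> B"
proof -
  interpret prob_space M by fact
  show b: "\<bar>spectral_mean f (random_matrix X n \<omega>)\<bar> \<le> B" for \<omega>
    using spectral_mean_diff_le[OF patterned_matrix_carrier patterned_matrix_symmetric n,
        of \<theta> _ f "\<lambda>_. 0" B] f(2)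
    by (simp add: spectral_mean_def)
  show "integrable M (\<lambda>\<omega>. spectral_mean f (random_matrix X n \<omega>))"
    by (rule integrable_const_bound[of _ B])
       (use b measurable_spectral_mean_random_matrix[OF X n f(1)] in auto)
qed

abbreviation (input) limit_moment :: "nat \<Rightarrow> real" where
  "limit_moment k \<equiv> (\<Sum>w\<in>pair_matched_words k. word_limit \<theta> w)"

text \<open>The integral against \<mu> is the limit of expected spectral means for the original
  inputs. Up to an arbitrarily small error these may be replaced by inputs with bounded moments, for
  which the truncated power lies between combinations of powers whose expected traces converge. The
  limit \<mu> thus receives bounds that no longer mention the approximation.\<close>

lemma limit_moment_approx:
  assumes X: "input_sequence M X" and conv: "almost_sure_limiting_spectral_distribution \<theta> M X \<mu>"
    and k: "k > 0" and R: "R > 0"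
  shows "limit_moment k - limit_moment (k + 1) / R\<^sup>2 \<le> integral\<^sup>L \<mu> (truncated_power R (2 * k))"
    and "integral\<^sup>L \<mu> (truncated_power R (2 * k)) \<le> limit_moment k"
proof -
  interpret prob_space M using X by (simp add: input_sequence_def)
  have Xm [measurable]: "X i \<in> borel_measurable M" for i
    using X by (auto simp: input_sequence_def indep_vars_def)
  have \<mu>: "real_distribution \<mu>" using conv by (simp add: almost_sure_limiting_spectral_distribution_def)
  let ?f = "truncated_power R (2 * k)"
  note fc = truncated_power_continuous[of UNIV R "2 * k"]
  have fb: "\<bar>?f x\<bar> \<le> R ^ (2 * k)" for x
    using truncated_power_bounds[of R "2 * k" x] R by simp
  let ?S = "\<lambda>X n \<omega>. spectral_mean ?f (random_matrix X n \<omega>)"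
  have lim: "(\<lambda>n. expectation (?S X (Suc n))) \<longlonglongrightarrow> integral\<^sup>L \<mu> ?f"
  proof -
    have "(\<lambda>n. expectation (?S X (Suc n))) \<longlonglongrightarrow> expectation (\<lambda>_. integral\<^sup>L \<mu> ?f)"
    proof (rule integral_dominated_convergence[where w = "\<lambda>_. R ^ (2 * k)"])
      show "AE \<omega> in M. (\<lambda>n. ?S X (Suc n) \<omega>) \<longlonglongrightarrow> integral\<^sup>L \<mu> ?f"
        using conv unfolding almost_sure_limiting_spectral_distribution_def
      proof (elim conjE eventually_mono)
        fix \<omega> assume "weak_conv (\<lambda>n. esd (random_matrix X n \<omega>)) (cdf \<mu>)"
        then have "(\<lambda>n. ?S X n \<omega>) \<longlonglongrightarrow> integral\<^sup>L \<mu> ?f"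
          by (rule spectral_mean_weak_conv[OF patterned_matrix_carrier patterned_matrix_symmetric \<mu> _
              _ fb])
             (use fc in \<open>simp add: continuous_on_eq_continuous_at\<close>)
        then show "(\<lambda>n. ?S X (Suc n) \<omega>) \<longlonglongrightarrow> integral\<^sup>L \<mu> ?f" by (rule LIMSEQ_Suc)
      qed
      show "?S X (Suc n) \<in> borel_measurable M" for n
        by (rule measurable_spectral_mean_random_matrix[OF Xm _ fc]) simp
      show "AE \<omega> in M. norm (?S X (Suc n) \<omega>) \<le> R ^ (2 * k)" for n
        using integrable_spectral_mean(2)[OF prob_space_axioms Xm _ fc fb, of "Suc n"] by simp
    qed auto
    then show ?thesis by (simp add: prob_space)
  qed
  have near: "limit_moment k - limit_moment (k + 1) / R\<^sup>2 - 2 * \<eta> \<le> integral\<^sup>L \<mu> ?f"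
    "integral\<^sup>L \<mu> ?f \<le> limit_moment k + 2 * \<eta>" if \<eta>: "\<eta> > 0" for \<eta>
  proof -
    obtain K where K: "K \<ge> 0" "\<And>x y. \<bar>?f x - ?f y\<bar> \<le> \<eta> + K * (x - y)\<^sup>2"
      using truncated_power_uniform[OF R \<eta>] by blast
    \<comment> \<open>The constant \<open>K\<close> depends on \<eta>, so the accuracy of the inputs
      is chosen after it; the added 1 guards against K = 0.\<close>
    define \<delta> where "\<delta> = \<eta> / (K + 1)"
    have \<delta>: "\<delta> > 0" "K * \<delta> \<le> \<eta>" using \<eta> K(1) by (auto simp: \<delta>_def field_simps)
    obtain Y where Y: "bounded_moment_inputs M Y" "\<And>i. integrable M (\<lambda>\<omega>. (X i \<omega> - Y i \<omega>)\<^sup>2)"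
      "\<And>i. expectation (\<lambda>\<omega>. (X i \<omega> - Y i \<omega>)\<^sup>2) \<le> \<delta>"
      using approximating_inputs[OF X \<delta>(1)] by blast
    interpret Y: bounded_moment_inputs M Y by (rule Y(1))
    let ?t = "\<lambda>j n \<omega>. mtrace (random_matrix Y n \<omega> ^\<^sub>m (2 * j)) / real n"
    define T where "T j n = expectation (\<lambda>\<omega>. ?t j n \<omega>)" for j n
    have T_lim: "(\<lambda>n. T j (Suc n)) \<longlonglongrightarrow> limit_moment j" if "j > 0" for j
      unfolding T_def by (rule LIMSEQ_Suc) (rule Y.expected_trace_moments[OF \<theta> that])
    have pw: "spectral_mean (\<lambda>x. x ^ j) (random_matrix Y n \<omega>)
        = mtrace (random_matrix Y n \<omega> ^\<^sub>m j) / real n" for j n \<omega>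
      by (rule spectral_mean_power[OF patterned_matrix_carrier patterned_matrix_symmetric])
    have iX: "integrable M (?S X n)" if "n > 0" for n
      by (rule integrable_spectral_mean(1)[OF prob_space_axioms Xm that fc fb])
    have iY: "integrable M (?S Y n)" if "n > 0" for n
      by (rule integrable_spectral_mean(1)[OF prob_space_axioms Y.X_measurable that fc fb])
    have XY: "\<bar>expectation (?S X n) - expectation (?S Y n)\<bar> \<le> 2 * \<eta>" if n: "n > 0" for n
    proof -
      \<comment> \<open>One division by n comes from the scaling of the matrix entries, the other
        from averaging over the n eigenvalues. Together they compensate the n^2 entries, so the mean
        of \<open>E\<close> is at most \<delta>.\<close>
      define E where "E \<omega> = (\<Sum>i<n. \<Sum>j<n. (X (link \<theta> n (Suc i) (Suc j)) \<omega> - Y (link \<theta> n (Suc i) (Suc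
          j)) \<omega>)\<^sup>2) / real n / real n" for \<omega>
      have iE: "integrable M E"
        unfolding E_def by (intro integrable_divide Bochner_Integration.integrable_sum Y(2))
      have "expectation E = (\<Sum>i<n. \<Sum>j<n. expectation (\<lambda>\<omega>. (X (link \<theta> n (Suc i) (Suc j)) \<omega> - Y (link \<theta>
          n (Suc i) (Suc j)) \<omega>)\<^sup>2)) / real n / real n"
        unfolding E_def by (simp add: Bochner_Integration.integral_sum
            Bochner_Integration.integrable_sum Y(2))
      also have "\<dots> \<le> (\<Sum>i<n. \<Sum>j<n. \<delta>) / real n / real n"
        by (intro divide_right_mono sum_mono Y(3)) auto
      finally have E: "expectation E \<le> \<delta>" using n by simp
      have "\<bar>?S X n \<omega> - ?S Y n \<omega>\<bar> \<le> \<eta> + K * E \<omega>" for \<omega>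
        using spectral_mean_perturbation[OF patterned_matrix_carrier patterned_matrix_symmetric
            patterned_matrix_carrier patterned_matrix_symmetric n K(2), of \<theta> "\<lambda>i. X i \<omega>" \<theta> "\<lambda>i. Y i \<omega>"]
        by (simp add: patterned_matrix_distance[OF n] E_def)
      then have "expectation (\<lambda>\<omega>. \<bar>?S X n \<omega> - ?S Y n \<omega>\<bar>) \<le> expectation (\<lambda>\<omega>. \<eta> + K * E \<omega>)"
        using iX[OF n] iY[OF n] iE by (intro integral_mono) auto
      also have "\<dots> = \<eta> + K * expectation E" using iE by (simp add: prob_space)
      also have "\<dots> \<le> \<eta> + K * \<delta>" using E K(1) by (intro add_left_mono mult_left_mono)
      also have "\<dots> \<le> 2 * \<eta>" using \<delta>(2) by simp
      finally have "expectation (\<lambda>\<omega>. \<bar>?S X n \<omega> - ?S Y n \<omega>\<bar>) \<le> 2 * \<eta>" .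
      moreover have "\<bar>expectation (?S X n) - expectation (?S Y n)\<bar>
          = \<bar>expectation (\<lambda>\<omega>. ?S X n \<omega> - ?S Y n \<omega>)\<bar>"
        using iX[OF n] iY[OF n] by simp
      moreover have "\<dots> \<le> expectation (\<lambda>\<omega>. \<bar>?S X n \<omega> - ?S Y n \<omega>\<bar>)"
        by (rule integral_abs_bound)
      ultimately show ?thesis by linarith
    qed
    have i_tr: "integrable M (\<lambda>\<omega>. mtrace (random_matrix Y n \<omega> ^\<^sub>m j) / real n)" for n j
      by (intro integrable_divide Y.integrable_mtrace)
    have up: "expectation (?S Y n) \<le> T k n" if n: "n > 0" for n
    proof -
      have "?S Y n \<omega> \<le> ?t k n \<omega>" for \<omega>
        unfolding pw[symmetric] by (rule spectral_mean_mono) (rule truncated_power_even(1)[OF R])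
      then show ?thesis
        unfolding T_def using iY[OF n] i_tr[of n "2 * k"] by (intro integral_mono)
    qed
    have lo: "T k n - T (k + 1) n / R\<^sup>2 \<le> expectation (?S Y n)" if n: "n > 0" for n
    proof -
      have low: "?t k n \<omega> - ?t (k + 1) n \<omega> / R\<^sup>2 \<le> ?S Y n \<omega>" for \<omega>
      proof -
        have "spectral_mean (\<lambda>x. x ^ (2 * k) + (- 1 / R\<^sup>2) * x ^ (2 * (k + 1))) (random_matrix Y n \<omega>)
            \<le> ?S Y n \<omega>"
          using truncated_power_even(2)[OF R, of _ k]
              by (intro spectral_mean_mono) (simp add: field_simps)
        then show ?thesis
          unfolding spectral_mean_add spectral_mean_cmult pw by (simp add: mult.commute)
      qed
      note i_diff = Bochner_Integration.integrable_diff[OF i_tr integrable_divide[OF i_tr]]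
      have "T k n - T (k + 1) n / R\<^sup>2 = expectation (\<lambda>\<omega>. ?t k n \<omega> -
          ?t (k + 1) n \<omega> / R\<^sup>2)"
        unfolding T_def by (subst Bochner_Integration.integral_diff[OF i_tr integrable_divide[OF
            i_tr]]) simp
      also have "\<dots> \<le> expectation (?S Y n)"
        by (rule integral_mono[OF i_diff iY[OF n] low])
      finally show ?thesis .
    qed
    have "(\<lambda>n. T k (Suc n) - T (k + 1) (Suc n) / R\<^sup>2 - 2 * \<eta>)
        \<longlonglongrightarrow> limit_moment k - limit_moment (k + 1) / R\<^sup>2 - 2 * \<eta>"
      by (intro tendsto_intros T_lim) (use k R in auto)
    then show "limit_moment k - limit_moment (k + 1) / R\<^sup>2 - 2 * \<eta> \<le> integral\<^sup>L \<mu> ?f"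
    proof (rule LIMSEQ_le[OF _ lim], intro exI allI impI)
      fix n
      show "T k (Suc n) - T (k + 1) (Suc n) / R\<^sup>2 - 2 * \<eta> \<le> expectation (?S X (Suc n))"
        using lo[of "Suc n"] XY[of "Suc n"] by linarith
    qed
    have "(\<lambda>n. T k (Suc n) + 2 * \<eta>) \<longlonglongrightarrow> limit_moment k + 2 * \<eta>"
      by (intro tendsto_intros T_lim k)
    then show "integral\<^sup>L \<mu> ?f \<le> limit_moment k + 2 * \<eta>"
    proof (rule LIMSEQ_le[OF lim], intro exI allI impI)
      fix n
      show "expectation (?S X (Suc n)) \<le> T k (Suc n) + 2 * \<eta>"
        using up[of "Suc n"] XY[of "Suc n"] by linarith
    qed
  qed
  show "limit_moment k - limit_moment (k + 1) / R\<^sup>2 \<le> integral\<^sup>L \<mu> ?f"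
  proof (rule field_le_epsilon)
    fix e :: real assume "e > 0"
    then show "limit_moment k - limit_moment (k + 1) / R\<^sup>2 \<le> integral\<^sup>L \<mu> ?f + e"
      using near(1)[of "e / 2"] by linarith
  qed
  show "integral\<^sup>L \<mu> ?f \<le> limit_moment k"
  proof (rule field_le_epsilon)
    fix e :: real assume "e > 0"
    then show "integral\<^sup>L \<mu> ?f \<le> limit_moment k + e"
      using near(2)[of "e / 2"] by linarith
  qed
qed

text \<open>Integrability of the power under \<mu> is part of the conclusion: the truncated powers
  increase to it and their integrals converge to a finite limit, being squeezed with an error of
  order 1 / R^2. Monotone convergence gives both claims. The levels \<open>real (Suc r)\<close> keep
  the truncation positive.\<close>

theorem limit_moment_has_integral:
  assumes X: "input_sequence M X" and conv: "almost_sure_limiting_spectral_distribution \<theta> M X \<mu>"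
    and k: "k > 0"
  shows "has_bochner_integral \<mu> (\<lambda>x. x ^ (2 * k)) (limit_moment k)"
proof -
  interpret real_distribution \<mu> using conv by (simp add: almost_sure_limiting_spectral_distribution_def)
  define f where "f r = truncated_power (real (Suc r)) (2 * k)" for r
  have [measurable]: "f r \<in> borel_measurable \<mu>" for r
    unfolding f_def
    by (subst measurable_cong_sets[OF events_eq_borel refl])
       (rule borel_measurable_continuous_onI[OF truncated_power_continuous])
  show ?thesis
  proof (rule has_bochner_integral_monotone_convergence[where f = f])
    show "integrable \<mu> (f r)" for r
    proof (rule integrable_const_bound[of _ "real (Suc r) ^ (2 * k)"])
      show "AE x in \<mu>. norm (f r x) \<le> real (Suc r) ^ (2 * k)"
        using truncated_power_bounds[of "real (Suc r)" "2 * k"] by (intro AE_I2) (simp add: f_def)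
    qed simp
    show "AE x in \<mu>. mono (\<lambda>r. f r x)"
      by (intro AE_I2 monoI) (auto simp: f_def truncated_power_def intro!: power_mono)
    show "AE x in \<mu>. (\<lambda>r. f r x) \<longlonglongrightarrow> x ^ (2 * k)"
    proof (intro AE_I2 tendsto_eventually)
      fix x
      show "eventually (\<lambda>r. f r x = x ^ (2 * k)) sequentially"
        using eventually_ge_at_top[of "nat \<lceil>\<bar>x\<bar>\<rceil>"]
      proof eventually_elim
        case (elim r)
        then have "min \<bar>x\<bar> (real (Suc r)) = \<bar>x\<bar>" by (simp add: min_def)
        then show ?case by (simp add: f_def truncated_power_def power_even_abs)
      qed
    qed
    have "(\<lambda>r. a - b / (real (Suc r))\<^sup>2) \<longlonglongrightarrow> a" for a b :: real
      by real_asymp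
    note lower = this[of "limit_moment k" "limit_moment (k + 1)"]
    show "(\<lambda>r. integral\<^sup>L \<mu> (f r)) \<longlonglongrightarrow> limit_moment k"
    proof (rule tendsto_sandwich[OF always_eventually always_eventually lower tendsto_const])
      show "\<forall>r. limit_moment k - limit_moment (k + 1) / (real (Suc r))\<^sup>2 \<le> integral\<^sup>L \<mu> (f r)"
        "\<forall>r. integral\<^sup>L \<mu> (f r) \<le> limit_moment k"
        unfolding f_def using limit_moment_approx[OF X conv k] by auto
    qed
  qed simp
qed

end

theorem corollary4p2:
  fixes \<theta> :: real and k :: nat
  assumes "\<theta> > 1" and "k \<ge> 1"
  shows "(\<forall>w \<in> pair_matched_words k. convergent (word_freq \<theta> w)) \<and>
    (k \<ge> 2 \<longrightarrow> (\<forall>w \<in> catalan_words k. word_limit \<theta> w > 1)) \<and>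
    (\<forall>(M :: 'a measure) X \<mu>.
       input_sequence M X \<longrightarrow> almost_sure_limiting_spectral_distribution \<theta> M X \<mu> \<longrightarrow>
       has_bochner_integral \<mu> (\<lambda>x. x ^ (2 * k)) (\<Sum>w \<in> pair_matched_words k. word_limit \<theta> w))"
proof (intro conjI ballI impI allI)
  have \<theta>: "\<theta> > 0" using assms(1) by simp
  show "convergent (word_freq \<theta> w)" if "w \<in> pair_matched_words k" for w
    using that assms(2) by (intro convergent_word_freq \<theta>) (auto simp: pair_matched_words_def
        pair_matched_def)
  \<comment> \<open>The lower bound on the limit is \<theta> itself, so strictness is exactly the
    assumption \<theta> > 1.\<close>
  show "1 < word_limit \<theta> w" if "k \<ge> 2" "w \<in> catalan_words k" for w
    using word_limit_catalan[OF \<theta> that(2,1)] assms(1) by simp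
  show "has_bochner_integral \<mu> (\<lambda>x. x ^ (2 * k)) (\<Sum>w\<in>pair_matched_words k. word_limit \<theta> w)"
    if "input_sequence M X" "almost_sure_limiting_spectral_distribution \<theta> M X \<mu>"
    for M :: "'a measure" and X \<mu>
    using limit_moment_has_integral[OF \<theta> that] assms(2) by simp
qed

end
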